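(* Let $(X_i)_{i\ge 1}$ be i.i.d. real random variables with $\mathbb E X_1=0$, $\mathbb E X_1^2=\sigma^2\in(0,\infty)$. Assume that $X_1$ is non-lattice and that $\mathbb E|X_1|^{2+\delta}<\infty$ for some $\delta>0$. Let $\eta\ge1$ be any fixed real number. Let $f:\mathbb R\to\mathbb R$ be any directly Riemann integrable function with support in $\mathbb R_+$ satisfying $\int_{\mathbb R_+}f(t)(1+t)\,dt<\infty$. Then there exists a constant $q_0>0$ such that for any $q\in(0,q_0)$, we have, as $n\to\infty$, uniformly in $x\in[\eta^{-1}\sqrt n,\eta\sqrt n]$ and $y\in[\eta^{-1}\sqrt n,\sigma\sqrt{qn\log n}]$, $$\mathbb E\big(f(x+S_n-y);\,\tau_x>n\big)\sim\frac{1}{\sigma\sqrt n}\,\psi\Big(\frac{y}{\sigma\sqrt n},\frac{x}{\sigma\sqrt n}\Big)\int_{\mathbb R_+}f(t)\,dt.$$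
   Context: Notation: $\mathbb R_+=[0,\infty)$; $S_n=\sum_{i=1}^n X_i$; for $x\ge0$, $\tau_x=\inf\{k\ge1:\ x+S_k<0\}$; $\mathbb E(Z;B)=\mathbb E(Z\mathbf 1_B)$. A random variable $X$ is non-lattice if for all $h>0$ and $a\in[0,h)$, $\mathbb P(X\in h\mathbb Z+a)\ne1$. $\psi(s,x)=\frac1{\sqrt{2\pi}}\big(e^{-(s-x)^2/2}-e^{-(s+x)^2/2}\big)$ for $s,x\in\mathbb R$. Directly Riemann integrable: for Borel $f:\mathbb R\to\mathbb R_+$ and $\delta>0$, let $I_k=[k\delta,(k+1)\delta)$, $\overline f_\delta=\sum_{k\in\mathbb Z}\mathbf 1_{I_k}\sup_{I_k}f$, $\underline f_\delta=\sum_{k\in\mathbb Z}\mathbf 1_{I_k}\inf_{I_k}f$; $f$ is directly Riemann integrable if $\int_{\mathbb R}\overline f_\delta\,du<\infty$ for all small enough $\delta>0$ and $\int_{\mathbb R}(\overline f_\delta-\underline f_\delta)\,du\to0$ as $\delta\to0$. A real-valued Borel function is directly Riemann integrable if both its positive and negative parts are. Uniform asymptotic equivalence: $a_n(\theta)\sim b_n(\theta)$ uniformly in $\theta\in A_n$ as $n\to\infty$ means $\lim_{n\to\infty}\sup_{\theta\in A_n}\left|\frac{a_n(\theta)}{b_n(\theta)}-1\right|=0$ (this presupposes $b_n(\theta)\neq 0$). *)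

theory Defs
  imports "HOL-Probability.Probability" "HOL-Library.Extended_Nat"
begin

definition psi :: "real \<Rightarrow> real \<Rightarrow> real" where
  "psi s x = 1 / sqrt (2 * pi) * (exp (- (s - x)\<^sup>2 / 2) - exp (- (s + x)\<^sup>2 / 2))"

definition walk :: "(nat \<Rightarrow> 'a \<Rightarrow> real) \<Rightarrow> nat \<Rightarrow> 'a \<Rightarrow> real" where
  "walk X n \<omega> = (\<Sum>i = 1..n. X i \<omega>)"

(* The infimum of the empty set in enat is \<infinity>: the walk may never become negative. *)
definition exit_time :: "(nat \<Rightarrow> 'a \<Rightarrow> real) \<Rightarrow> real \<Rightarrow> 'a \<Rightarrow> enat" where
  "exit_time X x \<omega> = Inf (enat ` {k. 1 \<le> k \<and> x + walk X k \<omega> < 0})"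

definition nonlattice :: "'a measure \<Rightarrow> ('a \<Rightarrow> real) \<Rightarrow> bool" where
  "nonlattice M Y \<longleftrightarrow>
     (\<forall>h>0. \<forall>a\<in>{0..<h}. measure M {\<omega> \<in> space M. \<exists>k::int. Y \<omega> = h * of_int k + a} \<noteq> 1)"

definition grid_interval :: "real \<Rightarrow> int \<Rightarrow> real set" where
  "grid_interval \<delta> k = {of_int k * \<delta>..<(of_int k + 1) * \<delta>}"

(* The envelopes are meant for nonnegative f. They take values in ennreal because f may be
   unbounded on a cell, in which case the upper envelope is \<infinity> there. *)
definition upper_envelope :: "(real \<Rightarrow> real) \<Rightarrow> real \<Rightarrow> real \<Rightarrow> ennreal" where
  "upper_envelope f \<delta> u =
     (\<Sum>\<^sub>\<infinity>k::int. indicator (grid_interval \<delta> k) u * (SUP v\<in>grid_interval \<delta> k. ennreal (f v)))"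

definition lower_envelope :: "(real \<Rightarrow> real) \<Rightarrow> real \<Rightarrow> real \<Rightarrow> ennreal" where
  "lower_envelope f \<delta> u =
     (\<Sum>\<^sub>\<infinity>k::int. indicator (grid_interval \<delta> k) u * (INF v\<in>grid_interval \<delta> k. ennreal (f v)))"

definition nonneg_directly_Riemann_integrable :: "(real \<Rightarrow> real) \<Rightarrow> bool" where
  "nonneg_directly_Riemann_integrable f \<longleftrightarrow>
     f \<in> borel_measurable borel \<and> (\<forall>t. 0 \<le> f t) \<and>
     (\<forall>\<^sub>F \<delta> in at_right 0. (\<integral>\<^sup>+u. upper_envelope f \<delta> u \<partial>lborel) < \<infinity>) \<and>
     ((\<lambda>\<delta>. \<integral>\<^sup>+u. (upper_envelope f \<delta> u - lower_envelope f \<delta> u) \<partial>lborel) \<longlongrightarrow> 0) (at_right 0)"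

definition directly_Riemann_integrable :: "(real \<Rightarrow> real) \<Rightarrow> bool" where
  "directly_Riemann_integrable f \<longleftrightarrow>
     f \<in> borel_measurable borel \<and>
     nonneg_directly_Riemann_integrable (\<lambda>t. max (f t) 0) \<and>
     nonneg_directly_Riemann_integrable (\<lambda>t. max (- f t) 0)"

(* The supremum is taken in ennreal, so it is \<infinity> for unbounded families and 0 for empty A n.
   Since z / 0 = 0, a zero of b n in A n makes the supremum at least 1; hence the limit
   forces b n to have no zero on A n for all large n. *)
definition uniformly_equivalent ::
    "(nat \<Rightarrow> 'b set) \<Rightarrow> (nat \<Rightarrow> 'b \<Rightarrow> real) \<Rightarrow> (nat \<Rightarrow> 'b \<Rightarrow> real) \<Rightarrow> bool" where
  "uniformly_equivalent A a b \<longleftrightarrow>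
     (\<lambda>n. SUP \<theta>\<in>A n. ennreal \<bar>a n \<theta> / b n \<theta> - 1\<bar>) \<longlonglongrightarrow> 0"

end

theory Submission
  imports Defs "HOL-Real_Asymp.Real_Asymp"
begin

text \<open>Conditioning on \<open>\<tau>\<^sub>x > n\<close> amounts to iterating the transition operator killed below \<open>0\<close>.
  Split \<open>n = N + m\<close> with \<open>m\<close> close to \<open>n powr (1 - \<epsilon>)\<close>. Over the last \<open>m\<close> steps killing is
  negligible, since \<open>y\<close> is of order at least \<open>sqrt n\<close>, and Stone's local limit theorem replaces the
  indicator of an interval at \<open>y\<close> by a heat kernel of variance \<open>\<sigma>\<^sup>2 m\<close>. Over the first \<open>N\<close> steps a Lindeberg
  exchange applied to the odd reflection of that kernel, which vanishes at the boundary, reproduces the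
  heat kernel of the half-line, and the semigroup property yields exactly \<open>\<psi>\<close> at time \<open>n\<close>.
  The Lindeberg error is a power of \<open>n\<close> smaller than \<open>1 / sqrt n\<close>, which a moderate deviation of
  \<open>y\<close> with small \<open>q\<close> does not reach. The error of the local limit theorem carries no rate, but it is small
  uniformly and decays quadratically on the scale \<open>sqrt m\<close>, so it is dominated by a sum of Gaussians of dyadic
  widths, each of which is treated by the same exchange.\<close>

section \<open>Free and killed transition operators\<close>

text \<open>At \<open>y\<close> of order sqrt (n log n) the limit is nearly as small as n powr (-1/2
  - q/2), so an error o(1 / sqrt n) is not enough. Every error is therefore measured against
  \<open>heat (\<sigma>\<^sup>2 * real n) (x - y)\<close>, up to a term n powr (-1/2 - rate). The
  lower bounds on \<open>x\<close> and \<open>y\<close> keep x * y / n away from 0, so reflection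
  removes only a fixed fraction of that kernel. The size of \<open>m\<close> is squeezed from both
  sides. The Lindeberg error is about r / m with r = n powr (1 / (2 + \<alpha>)), the order of an
  overshoot, and falls below 1 / sqrt n only if m exceeds n powr (1 - \<theta>), where \<theta> =
  1/2 - 1 / (2 + \<alpha>). The mass killed in the last m steps is about sqrt m / y^2, which forces
  m to be a power of n below n itself. The main obstacle is the local limit theorem over m steps:
  its error e / sqrt m is far larger than 1 / sqrt n. Only because this error is concentrated within
  distance of order sqrt m of \<open>y\<close> does averaging over the first N steps, whose smoothed
  density is at most of order 1 / sqrt n, bring it down to order e / sqrt n.\<close>

definition bdd_borel :: "(real \<Rightarrow> real) set" where
  "bdd_borel = {g \<in> borel_measurable borel. \<exists>B. \<forall>z. \<bar>g z\<bar> \<le> B}"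

definition free_step :: "real measure \<Rightarrow> (real \<Rightarrow> real) \<Rightarrow> real \<Rightarrow> real" where
  "free_step \<mu> g z = (\<integral>t. g (z + t) \<partial>\<mu>)"

text \<open>The indicator tests the landing point and not the starting point, in accordance with an
  exit time that ranges over k >= 1.\<close>

definition killed_step :: "real measure \<Rightarrow> (real \<Rightarrow> real) \<Rightarrow> real \<Rightarrow> real" where
  "killed_step \<mu> g z = (\<integral>t. indicator {0..} (z + t) * g (z + t) \<partial>\<mu>)"

lemma bdd_borelI: "g \<in> borel_measurable borel \<Longrightarrow> (\<And>z. \<bar>g z\<bar> \<le> B) \<Longrightarrow> g \<in> bdd_borel"
  by (auto simp: bdd_borel_def)

lemma bdd_borel_measurable: "g \<in> bdd_borel \<Longrightarrow> g \<in> borel_measurable borel"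
  by (auto simp: bdd_borel_def)

lemma bdd_borelE:
  assumes "g \<in> bdd_borel" obtains B where "\<And>z. \<bar>g z\<bar> \<le> B" "B \<ge> 0"
proof -
  obtain B where B: "\<And>z. \<bar>g z\<bar> \<le> B" using assms by (auto simp: bdd_borel_def)
  then have "B \<ge> 0" using abs_ge_zero[of "g 0"] order_trans by blast
  with B show ?thesis by (rule that)
qed

lemma bdd_borel_add: "g \<in> bdd_borel \<Longrightarrow> h \<in> bdd_borel \<Longrightarrow> (\<lambda>z. g z + h z) \<in> bdd_borel"
proof -
  assume g: "g \<in> bdd_borel" and h: "h \<in> bdd_borel"
  obtain B where B: "\<And>z. \<bar>g z\<bar> \<le> B" "B \<ge> 0" using g by (rule bdd_borelE) auto
  obtain C where C: "\<And>z. \<bar>h z\<bar> \<le> C" "C \<ge> 0" using h by (rule bdd_borelE) auto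
  have [measurable]: "g \<in> borel_measurable borel" "h \<in> borel_measurable borel"
    using g h bdd_borel_measurable by auto
  show ?thesis
    by (rule bdd_borelI[of _ "B + C"]) (auto intro!: order_trans[OF abs_triangle_ineq] add_mono B(1) C(1))
qed

lemma bdd_borel_cmult: "g \<in> bdd_borel \<Longrightarrow> (\<lambda>z. c * g z) \<in> bdd_borel"
proof -
  assume g: "g \<in> bdd_borel"
  obtain B where B: "\<And>z. \<bar>g z\<bar> \<le> B" "B \<ge> 0" using g by (rule bdd_borelE) auto
  have [measurable]: "g \<in> borel_measurable borel"
    using g bdd_borel_measurable by auto
  show ?thesis
    by (rule bdd_borelI[of _ "\<bar>c\<bar> * B"]) (use B in \<open>auto simp: abs_mult mult_left_mono\<close>)
qed

lemma bdd_borel_diff: "g \<in> bdd_borel \<Longrightarrow> h \<in> bdd_borel \<Longrightarrow> (\<lambda>z. g z - h z) \<in> bdd_borel"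
  using bdd_borel_add[of g "\<lambda>z. (-1) * h z"] bdd_borel_cmult[of h "-1"] by simp

lemma bdd_borel_const [simp]: "(\<lambda>z. c) \<in> bdd_borel"
  by (rule bdd_borelI[of _ "\<bar>c\<bar>"]) auto

lemma bdd_borel_sum: "(\<And>i. i \<in> I \<Longrightarrow> g i \<in> bdd_borel) \<Longrightarrow> (\<lambda>z. \<Sum>i\<in>I. g i z) \<in> bdd_borel"
  by (induction I rule: infinite_finite_induct) (auto intro: bdd_borel_add)

lemma bdd_borel_shift: "g \<in> bdd_borel \<Longrightarrow> (\<lambda>z. g (z + c)) \<in> bdd_borel"
  by (auto simp: bdd_borel_def)

lemma bdd_borel_indicator [intro]: "A \<in> sets borel \<Longrightarrow> (indicator A :: real \<Rightarrow> real) \<in> bdd_borel"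
  by (rule bdd_borelI[of _ 1]) (auto simp: indicator_def)

lemma bdd_borel_restrict: "g \<in> bdd_borel \<Longrightarrow> (\<lambda>z. indicator {0..} z * g z) \<in> bdd_borel"
proof -
  assume g: "g \<in> bdd_borel"
  obtain B where B: "\<And>z. \<bar>g z\<bar> \<le> B" "B \<ge> 0" using g by (rule bdd_borelE) auto
  have [measurable]: "g \<in> borel_measurable borel"
    using g bdd_borel_measurable by auto
  show ?thesis
    by (rule bdd_borelI[of _ B]) (auto simp: indicator_def B)
qed

lemma killed_step_eq: "killed_step \<mu> g = free_step \<mu> (\<lambda>w. indicator {0..} w * g w)"
  by (auto simp: killed_step_def free_step_def)

lemma free_pow_Suc: "(free_step \<mu> ^^ Suc n) g z = (\<integral>t. (free_step \<mu> ^^ n) g (z + t) \<partial>\<mu>)"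
  by (subst funpow.simps, subst o_apply, rule free_step_def)

lemma killed_pow_Suc:
  "(killed_step \<mu> ^^ Suc n) g z = free_step \<mu> (\<lambda>w. indicator {0..} w * (killed_step \<mu> ^^ n) g w) z"
  by (subst funpow.simps, subst o_apply, rule fun_cong[OF killed_step_eq])

context real_distribution
begin

lemma prob_UNIV [simp]: "prob UNIV = 1"
  using prob_space by simp

lemma integrable_shift: "g \<in> bdd_borel \<Longrightarrow> integrable M (\<lambda>t. g (z + t))"
proof -
  assume g: "g \<in> bdd_borel"
  obtain B where B: "\<And>z. \<bar>g z\<bar> \<le> B" "B \<ge> 0" using g by (rule bdd_borelE) auto
  have [measurable]: "g \<in> borel_measurable borel"
    using g bdd_borel_measurable by auto
  show ?thesis
    by (rule integrable_const_bound[of _ B]) (auto simp: B)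
qed

lemma integrable_shift_restrict:
  "g \<in> bdd_borel \<Longrightarrow> integrable M (\<lambda>t. indicator {0..} (z + t) * g (z + t))"
  using integrable_shift[OF bdd_borel_restrict] .

lemma free_step_mono:
  assumes "g \<in> bdd_borel" "h \<in> bdd_borel" "\<And>w. g w \<le> h w"
  shows "free_step M g z \<le> free_step M h z"
  unfolding free_step_def by (intro integral_mono integrable_shift assms)

lemma free_step_const [simp]: "free_step M (\<lambda>_. c) z = c"
  by (simp add: free_step_def)

lemma free_step_bdd_borel: "g \<in> bdd_borel \<Longrightarrow> free_step M g \<in> bdd_borel"
proof -
  assume g: "g \<in> bdd_borel"
  obtain B where B: "\<And>z. \<bar>g z\<bar> \<le> B" "B \<ge> 0" using g by (rule bdd_borelE) auto
  have [measurable]: "g \<in> borel_measurable borel"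
    using g bdd_borel_measurable by auto
  have "free_step M g z \<le> B" "- B \<le> free_step M g z" for z
    using free_step_mono[OF g bdd_borel_const[of B]] free_step_mono[OF bdd_borel_const[of "-B"] g] B(1)
    by (auto simp: abs_le_iff minus_le_iff)
  then show ?thesis
    by (intro bdd_borelI[of _ B]) (auto simp: free_step_def[abs_def] abs_le_iff minus_le_iff)
qed

lemma killed_step_bdd_borel: "g \<in> bdd_borel \<Longrightarrow> killed_step M g \<in> bdd_borel"
  unfolding killed_step_eq by (intro free_step_bdd_borel bdd_borel_restrict)

lemma free_pow_bdd_borel: "g \<in> bdd_borel \<Longrightarrow> (free_step M ^^ n) g \<in> bdd_borel"
  by (induction n) (auto intro: free_step_bdd_borel)

lemma killed_pow_bdd_borel: "g \<in> bdd_borel \<Longrightarrow> (killed_step M ^^ n) g \<in> bdd_borel"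
  by (induction n) (auto intro: killed_step_bdd_borel)

lemma free_step_linear:
  assumes "g \<in> bdd_borel" "h \<in> bdd_borel"
  shows "free_step M (\<lambda>w. a * g w + b * h w) z = a * free_step M g z + b * free_step M h z"
  unfolding free_step_def using integrable_shift[OF assms(1)] integrable_shift[OF assms(2)] by simp

lemma free_pow_linear:
  assumes "g \<in> bdd_borel" "h \<in> bdd_borel"
  shows "(free_step M ^^ n) (\<lambda>w. a * g w + b * h w) z = a * (free_step M ^^ n) g z + b * (free_step M ^^ n) h z"
proof (induction n arbitrary: z)
  case (Suc n)
  have "(free_step M ^^ n) (\<lambda>w. a * g w + b * h w) = (\<lambda>w. a * (free_step M ^^ n) g w + b * (free_step M ^^ n) h w)"
    using Suc by auto
  then show ?case
    using free_step_linear[OF free_pow_bdd_borel[OF assms(1)] free_pow_bdd_borel[OF assms(2)]] by simp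
qed auto

lemma killed_pow_linear:
  assumes "g \<in> bdd_borel" "h \<in> bdd_borel"
  shows "(killed_step M ^^ n) (\<lambda>w. a * g w + b * h w) z = a * (killed_step M ^^ n) g z + b * (killed_step M ^^ n) h z"
proof (induction n arbitrary: z)
  case (Suc n)
  let ?G = "(killed_step M ^^ n) g" and ?H = "(killed_step M ^^ n) h"
  have "(killed_step M ^^ n) (\<lambda>w. a * g w + b * h w) = (\<lambda>w. a * ?G w + b * ?H w)"
    using Suc by auto
  then have "(killed_step M ^^ Suc n) (\<lambda>w. a * g w + b * h w) z
     = free_step M (\<lambda>w. a * (indicator {0..} w * ?G w) + b * (indicator {0..} w * ?H w)) z"
    unfolding killed_pow_Suc by (simp add: algebra_simps)
  also have "\<dots> = a * free_step M (\<lambda>w. indicator {0..} w * ?G w) z + b * free_step M (\<lambda>w. indicator {0..} w * ?H w) z"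
    by (intro free_step_linear bdd_borel_restrict killed_pow_bdd_borel assms)
  finally show ?case unfolding killed_pow_Suc .
qed auto

lemma free_pow_mono:
  assumes "g \<in> bdd_borel" "h \<in> bdd_borel" "\<And>w. g w \<le> h w"
  shows "(free_step M ^^ n) g z \<le> (free_step M ^^ n) h z"
proof (induction n arbitrary: z)
  case (Suc n) then show ?case
    using free_step_mono[OF free_pow_bdd_borel[OF assms(1)] free_pow_bdd_borel[OF assms(2)]] by simp
qed (auto simp: assms)

lemma free_pow_const: "(free_step M ^^ n) (\<lambda>_. c) = (\<lambda>_. c)"
proof (induction n)
  case (Suc n)
  show ?case by (rule ext, subst free_pow_Suc) (simp add: Suc)
qed simp

lemma free_pow_cmult:
  assumes "g \<in> bdd_borel" shows "(free_step M ^^ n) (\<lambda>w. a * g w) z = a * (free_step M ^^ n) g z"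
  using free_pow_linear[OF assms assms, of n a 0 z] by simp

lemma free_pow_nonneg:
  assumes "g \<in> bdd_borel" "\<And>w. 0 \<le> g w" shows "0 \<le> (free_step M ^^ n) g z"
  using free_pow_mono[of "\<lambda>_. 0" g n z] assms by (simp add: free_pow_const)

lemma free_pow_le_const:
  assumes "g \<in> bdd_borel" "\<And>w. g w \<le> B" shows "(free_step M ^^ n) g z \<le> B"
  using free_pow_mono[of g "\<lambda>_. B" n z] assms by (simp add: free_pow_const)

lemma free_pow_shift: "(free_step M ^^ n) (\<lambda>w. g (w + c)) z = (free_step M ^^ n) g (z + c)"
proof (induction n arbitrary: z)
  case (Suc n)
  have "(free_step M ^^ n) (\<lambda>w. g (w + c)) = (\<lambda>w. (free_step M ^^ n) g (w + c))"
    using Suc by auto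
  then show ?case unfolding free_pow_Suc by (simp add: algebra_simps)
qed auto

text \<open>Surviving paths are evaluated only on the half-line, so a comparison there is enough.
  This matters because the majorants built later hold for nonnegative arguments only.\<close>

lemma killed_pow_mono_on:
  assumes "g \<in> bdd_borel" "h \<in> bdd_borel" "\<And>w. w \<ge> 0 \<Longrightarrow> g w \<le> h w" "z \<ge> 0"
  shows "(killed_step M ^^ n) g z \<le> (killed_step M ^^ n) h z"
  using assms(4)
proof (induction n arbitrary: z)
  case (Suc n)
  show ?case
    unfolding killed_pow_Suc
    using Suc.IH by (intro free_step_mono bdd_borel_restrict killed_pow_bdd_borel assms)
      (auto simp: indicator_def)
qed (auto simp: assms)

lemma killed_pow_le_const:
  assumes "g \<in> bdd_borel" "\<And>w. w \<ge> 0 \<Longrightarrow> g w \<le> B" "B \<ge> 0" "z \<ge> 0"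
  shows "(killed_step M ^^ n) g z \<le> B"
  using assms(4)
proof (induction n arbitrary: z)
  case (Suc n)
  have "free_step M (\<lambda>w. indicator {0..} w * (killed_step M ^^ n) g w) z \<le> free_step M (\<lambda>_. B) z"
    using Suc.IH by (intro free_step_mono bdd_borel_restrict killed_pow_bdd_borel assms bdd_borel_const)
      (auto simp: indicator_def assms)
  then show ?case unfolding killed_pow_Suc by simp
qed (auto simp: assms)

lemma killed_pow_le_free_pow:
  assumes "g \<in> bdd_borel" "\<And>w. 0 \<le> g w"
  shows "(killed_step M ^^ n) g z \<le> (free_step M ^^ n) g z"
proof (induction n arbitrary: z)
  case (Suc n)
  have "0 \<le> (free_step M ^^ n) g w" for w
    using assms by (rule free_pow_nonneg)
  moreover have free: "(free_step M ^^ Suc n) g z = free_step M ((free_step M ^^ n) g) z" by simp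
  ultimately show ?case
    unfolding killed_pow_Suc free
    using Suc.IH by (intro free_step_mono bdd_borel_restrict killed_pow_bdd_borel free_pow_bdd_borel assms)
      (auto simp: indicator_def)
qed auto

text \<open>Only paths that have entered the negative half-line contribute to the difference, and from
  there the mass seen by \<open>g\<close> is at most \<open>B\<close> whatever the remaining number of steps.\<close>

lemma free_pow_minus_killed_pow:
  assumes "g \<in> bdd_borel" "\<And>j w. j < n \<Longrightarrow> w < 0 \<Longrightarrow> (free_step M ^^ j) g w \<le> B" "B \<ge> 0"
  shows "(free_step M ^^ n) g z - (killed_step M ^^ n) g z \<le> B"
  using assms(2)
proof (induction n arbitrary: z)
  case (Suc n)
  let ?F = "(free_step M ^^ n) g" and ?K = "(killed_step M ^^ n) g"
  have "?F w - indicator {0..} w * ?K w \<le> B" for w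
  proof (cases "w \<ge> 0")
    case True
    then show ?thesis using Suc.IH[of w] Suc.prems by auto
  next
    case False
    then show ?thesis using Suc.prems[of n w] by auto
  qed
  then have "free_step M (\<lambda>w. 1 * ?F w + (-1) * (indicator {0..} w * ?K w)) z \<le> free_step M (\<lambda>_. B) z"
    by (intro free_step_mono bdd_borel_add bdd_borel_cmult bdd_borel_restrict killed_pow_bdd_borel
         free_pow_bdd_borel assms bdd_borel_const) auto
  then show ?case
    by (subst (asm) free_step_linear)
       (auto intro!: free_pow_bdd_borel bdd_borel_restrict killed_pow_bdd_borel assms
         simp: killed_pow_Suc simp del: funpow.simps(2) simp add: funpow.simps(2)[where f = "free_step M"])
qed (auto simp: assms)

end

section \<open>Heat kernels and the Lindeberg step\<close>

text \<open>The centred Gaussian density, parametrised by its variance so that the semigroup law is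
  addition of parameters.\<close>

definition heat :: "real \<Rightarrow> real \<Rightarrow> real" where
  "heat v z = exp (- z\<^sup>2 / (2 * v)) / sqrt (2 * pi * v)"

lemma heat_eq_normal_density: "v > 0 \<Longrightarrow> heat v z = normal_density 0 (sqrt v) z"
  by (simp add: heat_def normal_density_def)

lemma heat_nonneg [simp]: "v \<ge> 0 \<Longrightarrow> 0 \<le> heat v z"
  by (simp add: heat_def)

lemma heat_pos: "v > 0 \<Longrightarrow> 0 < heat v z"
  by (simp add: heat_def)

lemma heat_uminus [simp]: "heat v (- z) = heat v z"
  by (simp add: heat_def)

lemma heat_measurable [measurable]: "heat v \<in> borel_measurable borel"
  unfolding heat_def[abs_def] by measurable

lemma heat_le: "v > 0 \<Longrightarrow> heat v z \<le> 1 / sqrt v"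
proof -
  assume v: "v > 0"
  have "exp (- z\<^sup>2 / (2 * v)) \<le> 1" using v by simp
  moreover have "sqrt v \<le> sqrt (2 * pi * v)"
    using v pi_gt3 by simp
  ultimately show ?thesis unfolding heat_def using v by (intro frac_le) auto
qed

lemma heat_bdd_borel: "v > 0 \<Longrightarrow> (\<lambda>z. heat v (z + c)) \<in> bdd_borel"
  by (rule bdd_borelI[of _ "1 / sqrt v"]) (auto simp: heat_le abs_of_nonneg)

lemma exp_half_square_ge: "s ^ 4 / 8 \<le> exp (s\<^sup>2 / 2 :: real)"
proof -
  have "1 + s\<^sup>2/2 + (s\<^sup>2/2)\<^sup>2 / 2 \<le> exp (s\<^sup>2 / 2)"
    using exp_lower_Taylor_quadratic[of "s\<^sup>2/2"] by simp
  moreover have "(s\<^sup>2/2)\<^sup>2 / 2 = s ^ 4 / 8"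
    by (simp add: power2_eq_square power4_eq_xxxx)
  ultimately show ?thesis using zero_le_power2[of s] by linarith
qed

lemma abs_exp_half_square_le: "\<bar>s\<bar> * exp (- s\<^sup>2 / 2) \<le> (1 :: real)"
proof -
  have "\<bar>s\<bar> \<le> 1 + s\<^sup>2 / 2"
    using sum_squares_bound[of 1 "\<bar>s\<bar>"] by (simp add: power2_eq_square) 
  also have "\<dots> \<le> exp (s\<^sup>2 / 2)" by (rule exp_ge_add_one_self)
  finally show ?thesis by (simp add: exp_minus field_simps)
qed

lemma power_exp_half_square_le:
  assumes "k \<le> 4" shows "\<bar>s\<bar> ^ k * exp (- s\<^sup>2 / 2) \<le> (9 :: real)"
proof -
  have "\<bar>s\<bar> ^ k \<le> 1 + s ^ 4"
  proof (cases "\<bar>s\<bar> \<le> 1")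
    case True
    then have "\<bar>s\<bar> ^ k \<le> 1" by (simp add: power_le_one)
    moreover have "0 \<le> s ^ 4" by simp
    ultimately show ?thesis by linarith
  next
    case False
    then have "\<bar>s\<bar> ^ k \<le> \<bar>s\<bar> ^ 4" using assms by (intro power_increasing) auto
    then show ?thesis by simp
  qed
  also have "\<dots> \<le> 9 * exp (s\<^sup>2 / 2)"
  proof -
    have "1 \<le> exp (s\<^sup>2 / 2)" by simp
    then show ?thesis using exp_half_square_ge[of s] by linarith
  qed
  finally show ?thesis by (simp add: exp_minus field_simps)
qed

text \<open>The remainder is of order |t|^3 for small t and t^2 for large t. Since 0 < \<alpha> <=
  1, the single power 2 + \<alpha> dominates the former for |t| <= 1 and the latter for |t| >= 1, so
  that a fractional moment can control it.\<close>

lemma gauss_Taylor: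
  fixes z t \<alpha> :: real
  assumes \<alpha>: "0 < \<alpha>" "\<alpha> \<le> 1"
  shows "\<bar>exp (- (z + t)\<^sup>2 / 2) - exp (- z\<^sup>2 / 2) + z * exp (- z\<^sup>2 / 2) * t
           - (z\<^sup>2 - 1) * exp (- z\<^sup>2 / 2) * t\<^sup>2 / 2\<bar> \<le> 16 * \<bar>t\<bar> powr (2 + \<alpha>)" (is "\<bar>?D\<bar> \<le> _")
proof -
  define diff where "diff m x = (if m = 0 then exp (- x\<^sup>2 / 2) else if m = 1 then - x * exp (- x\<^sup>2 / 2)
     else if m = 2 then (x\<^sup>2 - 1) * exp (- x\<^sup>2 / 2) else (3 * x - x ^ 3) * exp (- x\<^sup>2 / 2))" for m :: nat and x :: real
  have bounds: "\<bar>s\<bar> * exp (- s\<^sup>2 / 2) \<le> 9" "\<bar>s\<bar>\<^sup>2 * exp (- s\<^sup>2 / 2) \<le> 9" "\<bar>s\<bar>^3 * exp (- s\<^sup>2 / 2) \<le> 9" for s :: real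
    using power_exp_half_square_le[of 1 s] power_exp_half_square_le[of 2 s] power_exp_half_square_le[of 3 s] by auto
  have e1: "exp (- s\<^sup>2 / 2) \<le> 1" for s :: real by simp
  show ?thesis
  proof (cases "\<bar>t\<bar> \<le> 1")
    case True
    show ?thesis
    proof (cases "t = 0")
      case True then show ?thesis by simp
    next
      case False
      have DER: "DERIV (diff m) x :> diff (Suc m) x" if "m < 3" for m x
      proof -
        have "m = 0 \<or> m = 1 \<or> m = 2" using that by auto
        then show ?thesis
          unfolding diff_def
          by (elim disjE) (auto intro!: derivative_eq_intros simp: power2_eq_square power3_eq_cube field_simps)
      qed
      have "\<exists>s. (if z + t < z then z + t < s \<and> s < z else z < s \<and> s < z + t) \<and>
          diff 0 (z + t) = (\<Sum>m<3. (diff m z / fact m) * (z + t - z) ^ m) + (diff 3 s / fact 3) * (z + t - z) ^ 3"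
        by (rule Taylor[where a = "min z (z + t)" and b = "max z (z + t)"]) (use DER False in auto)
      then obtain s where s: "diff 0 (z + t) = (\<Sum>m<3. (diff m z / fact m) * t ^ m) + (diff 3 s / fact 3) * t ^ 3"
        by auto
      then have "?D = diff 3 s / 6 * t ^ 3"
        by (simp add: diff_def numeral_3_eq_3 fact_numeral) (simp add: algebra_simps power2_eq_square power3_eq_cube)
      \<comment> \<open>36 = 3 * 9 + 9, from the bound 9 on each |s|^k exp (-s^2 / 2); division by
        3! leaves 6.\<close>
      moreover have "\<bar>diff 3 s\<bar> \<le> 36"
      proof -
        have "\<bar>diff 3 s\<bar> = \<bar>3 * s - s^3\<bar> * exp (- s\<^sup>2 / 2)" by (simp add: diff_def abs_mult)
        also have "\<dots> \<le> (3 * \<bar>s\<bar> + \<bar>s\<bar>^3) * exp (- s\<^sup>2 / 2)"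
          by (intro mult_right_mono) (auto simp: abs_mult power_abs[symmetric] intro: order_trans[OF abs_triangle_ineq4])
        also have "\<dots> \<le> 36" using bounds(1)[of s] bounds(3)[of s] by (simp add: algebra_simps)
        finally show ?thesis .
      qed
      then have "\<bar>diff 3 s / 6 * t ^ 3\<bar> \<le> 6 * \<bar>t\<bar> ^ 3"
        unfolding abs_mult abs_divide power_abs by (intro mult_right_mono) auto
      ultimately have "\<bar>?D\<bar> \<le> 6 * \<bar>t\<bar> ^ 3" by (simp only:)
      have "\<bar>t\<bar> ^ 3 = \<bar>t\<bar> powr 3" using False by (simp add: powr_numeral)
      also have "\<dots> \<le> \<bar>t\<bar> powr (2 + \<alpha>)"
        using True False \<alpha> by (intro powr_mono') auto
      finally show ?thesis using \<open>\<bar>?D\<bar> \<le> 6 * \<bar>t\<bar> ^ 3\<close> powr_ge_zero[of "\<bar>t\<bar>" "2 + \<alpha>"] by linarith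
    qed
  next
    case False
    \<comment> \<open>Without any cancellation: the difference of the exponentials, the linear and
      the quadratic term contribute at most 1, 9 and 5 times t^2.\<close>
    then have t: "\<bar>t\<bar> \<ge> 1" by simp
    have t2: "\<bar>t\<bar> \<le> t\<^sup>2" "1 \<le> t\<^sup>2"
      using t mult_left_mono[of 1 "\<bar>t\<bar>" "\<bar>t\<bar>"] by (auto simp: power2_eq_square)
    have 1: "\<bar>z * exp (- z\<^sup>2 / 2) * t\<bar> \<le> 9 * t\<^sup>2"
      using bounds(1)[of z] t2 by (simp add: abs_mult) (intro mult_mono; simp)
    have "\<bar>(z\<^sup>2 - 1) * exp (- z\<^sup>2 / 2)\<bar> \<le> 10"
    proof -
      have "0 \<le> z\<^sup>2 * exp (- z\<^sup>2 / 2)" by simp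
      then show ?thesis
        using bounds(2)[of z] e1[of z] exp_gt_zero[of "- z\<^sup>2 / 2"] unfolding left_diff_distrib power2_abs by linarith
    qed
    then have 2: "\<bar>(z\<^sup>2 - 1) * exp (- z\<^sup>2 / 2) * t\<^sup>2 / 2\<bar> \<le> 5 * t\<^sup>2"
      by (simp add: abs_mult mult_right_mono)
    have "\<bar>?D\<bar> \<le> 16 * t\<^sup>2"
      using 1 2 t2 e1[of z] e1[of "z + t"] exp_gt_zero[of "- z\<^sup>2 / 2"] exp_gt_zero[of "- (z+t)\<^sup>2 / 2"]
      by linarith
    also have "t\<^sup>2 = \<bar>t\<bar> powr 2" using t by (simp add: powr_numeral)
    also have "\<bar>t\<bar> powr 2 \<le> \<bar>t\<bar> powr (2 + \<alpha>)"
      using t \<alpha> by (intro powr_mono) auto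
    finally show ?thesis by simp
  qed
qed

text \<open>The cap \<open>\<alpha> \<le> 1\<close> fits a second order expansion, whose remainder
  has order at most three. Both the law of a step and the Gaussian law of the same variance are
  instances; the Lindeberg exchange compares the two.\<close>

locale centred_law = real_distribution +
  fixes \<sigma> \<alpha> :: real
  assumes sigma_pos: "\<sigma> > 0" and alpha_pos: "\<alpha> > 0" and alpha_le: "\<alpha> \<le> 1"
    and mean_integrable: "integrable M (\<lambda>t. t)" and mean_zero: "expectation (\<lambda>t. t) = 0"
    and sq_integrable: "integrable M (\<lambda>t. t\<^sup>2)" and sq_mean: "expectation (\<lambda>t. t\<^sup>2) = \<sigma>\<^sup>2"
    and moment_integrable: "integrable M (\<lambda>t. \<bar>t\<bar> powr (2 + \<alpha>))"
begin

definition moment :: real where "moment = expectation (\<lambda>t. \<bar>t\<bar> powr (2 + \<alpha>))"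

lemma moment_nonneg: "0 \<le> moment"
  unfolding moment_def by (intro integral_nonneg_AE) auto

text \<open>After integration the Taylor polynomial depends on the law only through \<sigma>, so
  laws of equal variance share it. The power of v comes from using \<open>gauss_Taylor\<close> at z
  / sqrt v and t / sqrt v.\<close>

lemma gauss_step:
  assumes v: "v > 0"
  shows "\<bar>(\<integral>t. exp (- (z + t)\<^sup>2 / (2 * v)) \<partial>M) - exp (- z\<^sup>2 / (2 * v))
     - (z\<^sup>2 / v - 1) * exp (- z\<^sup>2 / (2 * v)) * \<sigma>\<^sup>2 / (2 * v)\<bar> \<le> 16 * moment / v powr (1 + \<alpha> / 2)"
proof -
  let ?e = "exp (- z\<^sup>2 / (2 * v))"
  let ?D = "\<lambda>t. exp (- (z + t)\<^sup>2 / (2 * v)) - ?e + z / v * ?e * t - (z\<^sup>2 / v - 1) * ?e / (2 * v) * t\<^sup>2"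
  have pt: "\<bar>?D t\<bar> \<le> 16 / v powr (1 + \<alpha> / 2) * \<bar>t\<bar> powr (2 + \<alpha>)" for t
  proof -
    have sv: "sqrt v > 0" "sqrt v * sqrt v = v" using v by auto
    have eqs: "(z / sqrt v + t / sqrt v)\<^sup>2 = (z + t)\<^sup>2 / v" "(z / sqrt v)\<^sup>2 = z\<^sup>2 / v" "(t / sqrt v)\<^sup>2 = t\<^sup>2 / v"
      using v by (auto simp: power_divide add_divide_distrib[symmetric])
    have "\<bar>?D t\<bar> \<le> 16 * \<bar>t / sqrt v\<bar> powr (2 + \<alpha>)"
      using gauss_Taylor[OF alpha_pos alpha_le, of "z / sqrt v" "t / sqrt v"] sv
      unfolding eqs by (simp add: field_simps)
    also have "\<bar>t / sqrt v\<bar> powr (2 + \<alpha>) = \<bar>t\<bar> powr (2 + \<alpha>) / v powr (1 + \<alpha> / 2)"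
      using v by (simp add: powr_divide powr_half_sqrt[symmetric] powr_powr algebra_simps add_divide_distrib)
    finally show ?thesis by simp
  qed
  have int: "integrable M (\<lambda>t. exp (- (z + t)\<^sup>2 / (2 * v)))"
    using v by (intro integrable_const_bound[of _ 1]) auto
  have "(\<integral>t. ?D t \<partial>M) = (\<integral>t. exp (- (z + t)\<^sup>2 / (2 * v)) \<partial>M) - ?e
     - (z\<^sup>2 / v - 1) * ?e / (2 * v) * \<sigma>\<^sup>2"
    using int mean_integrable sq_integrable mean_zero sq_mean by (simp add: prob_space)
  moreover have "\<bar>\<integral>t. ?D t \<partial>M\<bar> \<le> (\<integral>t. \<bar>?D t\<bar> \<partial>M)"
    by (rule integral_abs_bound)
  moreover have "(\<integral>t. \<bar>?D t\<bar> \<partial>M) \<le> (\<integral>t. 16 / v powr (1 + \<alpha> / 2) * \<bar>t\<bar> powr (2 + \<alpha>) \<partial>M)"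
    using int mean_integrable sq_integrable moment_integrable pt
    by (intro integral_mono) auto
  ultimately show ?thesis by (simp add: moment_def)
qed

end

text \<open>Provides the other side of the exchange: \<open>gauss_step\<close> becomes available for
  the Gaussian law, with that law's own \<open>moment\<close>.\<close>

lemma normal_law_centred:
  assumes s: "s > 0" and \<alpha>: "0 < \<alpha>" "\<alpha> \<le> 1"
  shows "centred_law (density lborel (normal_density 0 s)) s \<alpha>"
proof -
  let ?N = "density lborel (\<lambda>x. ennreal (normal_density 0 s x))"
  interpret N: prob_space ?N using prob_space_normal_density[OF s] .
  have ii: "integrable ?N f \<longleftrightarrow> integrable lborel (\<lambda>x. normal_density 0 s x * f x)"
    if "f \<in> borel_measurable borel" for f :: "real \<Rightarrow> real"
    using that by (subst integrable_density) auto
  have il: "integral\<^sup>L ?N f = integral\<^sup>L lborel (\<lambda>x. normal_density 0 s x * f x)"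
    if "f \<in> borel_measurable borel" for f :: "real \<Rightarrow> real"
    using that by (subst integral_density) auto
  have "integrable lborel (\<lambda>x. normal_density 0 s x * \<bar>x\<bar> powr (2 + \<alpha>))"
  proof (rule Bochner_Integration.integrable_bound)
    show "integrable lborel (\<lambda>x. normal_density 0 s x + normal_density 0 s x * \<bar>x\<bar> ^ 3)"
      using integrable_normal_moment_abs[OF s, of 0 3] integrable_normal_density[OF s, of 0] by auto
    have "\<bar>x\<bar> powr (2 + \<alpha>) \<le> 1 + \<bar>x\<bar> ^ 3" for x :: real
    proof (cases "\<bar>x\<bar> \<le> 1")
      case True
      then have "\<bar>x\<bar> powr (2 + \<alpha>) \<le> 1" using \<alpha> by (intro powr_le1) auto
      then show ?thesis by (smt (verit) zero_le_power abs_ge_zero)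
    next
      case False
      then have "\<bar>x\<bar> powr (2 + \<alpha>) \<le> \<bar>x\<bar> powr 3" using \<alpha> by (intro powr_mono) auto
      then show ?thesis using False by (simp add: powr_numeral)
    qed
    then have "normal_density 0 s x * \<bar>x\<bar> powr (2 + \<alpha>) \<le> normal_density 0 s x * (1 + \<bar>x\<bar> ^ 3)" for x
      by (intro mult_left_mono) auto
    then show "AE x in lborel. norm (normal_density 0 s x * \<bar>x\<bar> powr (2 + \<alpha>))
        \<le> norm (normal_density 0 s x + normal_density 0 s x * \<bar>x\<bar> ^ 3)"
      by (intro AE_I2) (simp add: algebra_simps abs_of_nonneg)
  qed simp
  then show ?thesis
    using s \<alpha> integrable_normal_moment_nz_1[OF s, of 0] integral_normal_moment_nz_1[OF s, of 0]
      integrable_normal_moment[OF s, of 0 2] integral_normal_moment_even[OF s, of 0 1]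
    by unfold_locales (auto simp: ii il)
qed

lemma normal_law_heat:
  assumes s: "s > 0" and v: "v > 0"
  shows "(\<integral>t. heat v (z + t) \<partial>density lborel (normal_density 0 s)) = heat (v + s\<^sup>2) z"
proof -
  have eq: "heat v (z + t) = normal_density 0 (sqrt v) (- z - t)" for t
    using heat_eq_normal_density[OF v, of "- z - t"] heat_uminus[of v "z + t"] by simp
  have "(\<integral>t. heat v (z + t) \<partial>density lborel (normal_density 0 s)) =
      (\<integral>t. normal_density 0 (sqrt v) (- z - t) * normal_density 0 s t \<partial>lborel)"
    by (subst integral_density) (auto simp: eq mult.commute)
  also have "\<dots> = enn2real (\<integral>\<^sup>+t. normal_density 0 (sqrt v) (- z - t) * normal_density 0 s t \<partial>lborel)"
    by (rule integral_eq_nn_integral) auto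
  also have "\<dots> = normal_density 0 (sqrt ((sqrt v)\<^sup>2 + s\<^sup>2)) (- z)"
    using fun_cong[OF conv_normal_density_zero_mean[of "sqrt v" s], of "- z"] s v by simp
  also have "\<dots> = heat (v + s\<^sup>2) z"
    using v s heat_eq_normal_density[of "v + s\<^sup>2" "- z"] by (simp add: add_pos_pos)
  finally show ?thesis .
qed

text \<open>The derivative is - x / v times the density, and |s| exp (-s^2 / 2) <= 1 at s = x / sqrt
  v bounds it by 1 / v.\<close>

lemma heat_Lipschitz:
  assumes v: "v > 0" shows "\<bar>heat v a - heat v b\<bar> \<le> \<bar>a - b\<bar> / v"
proof -
  have *: "\<bar>heat v b - heat v a\<bar> \<le> \<bar>b - a\<bar> / v" if ab: "a < b" for a b
  proof -
    have D: "DERIV (heat v) x :> - x / v * heat v x" for x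
      unfolding heat_def[abs_def] using v
      by (auto intro!: derivative_eq_intros simp: field_simps)
    obtain c where c: "a < c" "c < b" "heat v b - heat v a = (b - a) * (- c / v * heat v c)"
      using MVT2[OF ab, of "heat v" "\<lambda>x. - x / v * heat v x"] D by blast
    have "\<bar>c / v * heat v c\<bar> \<le> 1 / v"
    proof -
      have "\<bar>c / sqrt v\<bar> * exp (- (c / sqrt v)\<^sup>2 / 2) \<le> 1" by (rule abs_exp_half_square_le)
      then have "\<bar>c\<bar> * exp (- c\<^sup>2 / (2 * v)) \<le> sqrt v"
        using v by (simp add: power_divide field_simps)
      also have "\<dots> \<le> sqrt (2 * pi * v)" using v pi_gt3 by simp
      finally have "\<bar>c\<bar> * heat v c \<le> 1"
        using v by (simp add: heat_def divide_le_eq)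
      then show ?thesis using v by (simp add: abs_mult divide_right_mono)
    qed
    then have "\<bar>heat v b - heat v a\<bar> \<le> \<bar>b - a\<bar> * (1 / v)"
      unfolding c(3) by (subst abs_mult) (intro mult_left_mono, auto simp: abs_mult)
    then show ?thesis by simp
  qed
  show ?thesis using *[of a b] *[of b a]
    by (cases a b rule: linorder_cases) (auto simp: abs_minus_commute)
qed

context centred_law
begin

text \<open>The law and the Gaussian law are close to the same Taylor expression, and a Gaussian
  step turns variance v into \<open>v + \<sigma>\<^sup>2\<close> exactly. The normalising factor of
  the density raises the exponent 1 + \<alpha> / 2 by 1/2.\<close>

lemma heat_step:
  "\<exists>C\<ge>0. \<forall>v>0. \<forall>z. \<bar>(\<integral>t. heat v (z + t) \<partial>M) - heat (v + \<sigma>\<^sup>2) z\<bar> \<le> C / v powr ((3 + \<alpha>) / 2)"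
proof -
  let ?N = "density lborel (\<lambda>x. ennreal (normal_density 0 \<sigma> x))"
  interpret N: centred_law ?N \<sigma> \<alpha>
    using normal_law_centred[OF sigma_pos alpha_pos alpha_le] .
  let ?C = "16 * (moment + N.moment)"
  have "\<bar>(\<integral>t. heat v (z + t) \<partial>M) - heat (v + \<sigma>\<^sup>2) z\<bar> \<le> ?C / v powr ((3 + \<alpha>) / 2)" if v: "v > 0" for v z
  proof -
    let ?E = "\<lambda>t. exp (- (z + t)\<^sup>2 / (2 * v))"
    have "\<bar>(\<integral>t. ?E t \<partial>M) - (\<integral>t. ?E t \<partial>?N)\<bar> \<le> ?C / v powr (1 + \<alpha> / 2)"
    proof -
      have *: "\<bar>a - b\<bar> \<le> p + q" if "\<bar>a - g - d\<bar> \<le> p" "\<bar>b - g - d\<bar> \<le> q" for a b g d p q :: real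
        using that by linarith
      show ?thesis
        using *[OF gauss_step[OF v, of z] N.gauss_step[OF v, of z]] by (simp add: distrib_left add_divide_distrib)
    qed
    then have "\<bar>(\<integral>t. ?E t \<partial>M) - (\<integral>t. ?E t \<partial>?N)\<bar> / sqrt (2 * pi * v) \<le> ?C / v powr (1 + \<alpha> / 2) / sqrt (2 * pi * v)"
      using v by (intro divide_right_mono) auto
    also have "\<dots> \<le> ?C / v powr (1 + \<alpha> / 2) / sqrt v"
      using v pi_gt3 moment_nonneg N.moment_nonneg by (intro divide_left_mono) auto
    also have "\<dots> = ?C / v powr ((3 + \<alpha>) / 2)"
    proof -
      have "v powr ((3 + \<alpha>) / 2) = v powr ((1 + \<alpha> / 2) + 1 / 2)"
        by (rule arg_cong[where f = "\<lambda>a. v powr a"]) (simp add: field_simps)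
      then show ?thesis using v by (simp only: powr_add powr_half_sqrt) simp
    qed
    finally show ?thesis
      using v by (simp add: normal_law_heat[OF sigma_pos v, symmetric])
        (simp add: heat_def diff_divide_distrib[symmetric])
  qed
  then show ?thesis
    using moment_nonneg N.moment_nonneg by (intro exI[of _ ?C]) auto
qed

text \<open>Odd reflection of the heat kernel makes it vanish at the boundary, so that stopping at the
  first negative position costs only the overshoot, and overshoots are at most
  \<open>r + \<bar>t\<bar> powr (2 + \<alpha>) / r powr (1 + \<alpha>)\<close> for a step \<open>t\<close>.\<close>

lemma killed_heat:
  "\<exists>C\<ge>0. \<forall>v x y r N. v > 0 \<longrightarrow> x \<ge> 0 \<longrightarrow> r > 0 \<longrightarrow> r \<le> sqrt v \<longrightarrow> real N \<le> r powr (2 + \<alpha>) \<longrightarrow>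
     \<bar>(killed_step M ^^ N) (\<lambda>z. heat v (z - y) - heat v (z + y)) x
        - (heat (v + real N * \<sigma>\<^sup>2) (x - y) - heat (v + real N * \<sigma>\<^sup>2) (x + y))\<bar> \<le> C * r / v"
proof -
  obtain C where C: "C \<ge> 0" "\<And>v z. v > 0 \<Longrightarrow> \<bar>(\<integral>t. heat v (z + t) \<partial>M) - heat (v + \<sigma>\<^sup>2) z\<bar> \<le> C / v powr ((3 + \<alpha>) / 2)"
    using heat_step by blast
  have main: "\<bar>(killed_step M ^^ N) (\<lambda>z. heat v (z - y) - heat v (z + y)) x
        - (heat (v + real N * \<sigma>\<^sup>2) (x - y) - heat (v + real N * \<sigma>\<^sup>2) (x + y))\<bar> \<le> (2 * C + 2 * moment + 2) * r / v"
    if v: "v > 0" and x: "x \<ge> 0" and r: "r > 0" "r \<le> sqrt v" and N: "real N \<le> r powr (2 + \<alpha>)" for v x y r N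
  proof -
    \<comment> \<open>\<open>u k\<close> is the reflected kernel after k exchanged steps,
      \<open>a\<close> bounds its growth away from the boundary, and \<open>L\<close> collects what
      every single step costs.\<close>
    define u where "u k z = heat (v + real k * \<sigma>\<^sup>2) (z - y) - heat (v + real k * \<sigma>\<^sup>2) (z + y)" for k z
    define a where "a = 2 / v"
    define L where "L = 2 * C / v powr ((3 + \<alpha>) / 2) + a * moment / r powr (1 + \<alpha>)"
    have a: "a > 0" using v by (simp add: a_def)
    have vk: "v + real k * \<sigma>\<^sup>2 > 0" "v + real k * \<sigma>\<^sup>2 \<ge> v" for k using v by (auto simp: add_pos_nonneg)
    have ub: "u k \<in> bdd_borel" for k
      unfolding u_def[abs_def] using heat_bdd_borel[OF vk(1)[of k], of "- y"] heat_bdd_borel[OF vk(1)[of k], of y]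
      by (auto intro!: bdd_borel_diff)
    \<comment> \<open>\<open>u k w\<close> is the difference of one kernel at w and at the mirror
      point -w, which are 2 * |w| apart.\<close>
    have u_lin: "\<bar>u k w\<bar> \<le> a * \<bar>w\<bar>" for k w
    proof -
      have "\<bar>u k w\<bar> = \<bar>heat (v + real k * \<sigma>\<^sup>2) (w - y) - heat (v + real k * \<sigma>\<^sup>2) (- w - y)\<bar>"
        using heat_uminus[of "v + real k * \<sigma>\<^sup>2" "w + y"] by (simp add: u_def)
      also have "\<dots> \<le> \<bar>(w - y) - (- w - y)\<bar> / (v + real k * \<sigma>\<^sup>2)"
        by (rule heat_Lipschitz[OF vk(1)])
      also have "\<dots> \<le> \<bar>(w - y) - (- w - y)\<bar> / v"
        using vk v by (intro divide_left_mono) auto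
      also have "\<dots> = a * \<bar>w\<bar>" by (simp add: a_def abs_mult)
      finally show ?thesis .
    qed
    have u_step: "\<bar>(\<integral>t. u k (z + t) \<partial>M) - u (Suc k) z\<bar> \<le> 2 * C / v powr ((3 + \<alpha>) / 2)" for k z
    proof -
      let ?V = "v + real k * \<sigma>\<^sup>2"
      have "(\<integral>t. u k (z + t) \<partial>M) = (\<integral>t. heat ?V ((z - y) + t) \<partial>M) - (\<integral>t. heat ?V ((z + y) + t) \<partial>M)"
        using integrable_shift[OF heat_bdd_borel[OF vk(1)[of k], of 0], of "z - y"]
          integrable_shift[OF heat_bdd_borel[OF vk(1)[of k], of 0], of "z + y"]
        by (simp add: u_def algebra_simps)
      moreover have "u (Suc k) z = heat (?V + \<sigma>\<^sup>2) (z - y) - heat (?V + \<sigma>\<^sup>2) (z + y)"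
        by (simp add: u_def algebra_simps)
      moreover have "C / ?V powr ((3 + \<alpha>) / 2) \<le> C / v powr ((3 + \<alpha>) / 2)"
      proof (rule frac_le)
        show "v powr ((3 + \<alpha>) / 2) \<le> ?V powr ((3 + \<alpha>) / 2)"
          using v vk[of k] alpha_pos by (intro powr_mono2) auto
      qed (use C(1) v in auto)
      ultimately show ?thesis
        using C(2)[OF vk(1), of k "z - y"] C(2)[OF vk(1), of k "z + y"] by linarith
    qed
    have over: "\<bar>t\<bar> \<le> r + \<bar>t\<bar> powr (2 + \<alpha>) / r powr (1 + \<alpha>)" for t :: real
    proof (cases "\<bar>t\<bar> \<le> r")
      case True then show ?thesis using r by (simp add: add_increasing2)
    next
      case False
      have "\<bar>t\<bar> * r powr (1 + \<alpha>) \<le> \<bar>t\<bar> * \<bar>t\<bar> powr (1 + \<alpha>)"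
        using False r alpha_pos by (intro mult_left_mono powr_mono2) auto
      also have "\<dots> = \<bar>t\<bar> powr (2 + \<alpha>)"
        using False r powr_add[of "\<bar>t\<bar>" 1 "1 + \<alpha>"] by simp
      finally have "\<bar>t\<bar> \<le> \<bar>t\<bar> powr (2 + \<alpha>) / r powr (1 + \<alpha>)"
        using r by (simp add: pos_le_divide_eq)
      then show ?thesis using r by linarith
    qed
    let ?T = "\<lambda>k. (killed_step M ^^ k) (u 0)"
    \<comment> \<open>The term a * r does not accumulate: a surviving path inherits it from the
      induction hypothesis, and for a path that has just left it bounds the kernel itself. Only
      \<open>L\<close> is paid in every step.\<close>
    have ind: "\<bar>?T k z - u k z\<bar> \<le> real k * L + a * r" if "z \<ge> 0" for k z
      using that
    proof (induction k arbitrary: z)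
      case 0 then show ?case using a r by simp
    next
      case (Suc k)
      have L0: "L \<ge> 0" unfolding L_def using C(1) a moment_nonneg by simp
      let ?h = "\<lambda>t. real k * L + a * r + a / r powr (1 + \<alpha>) * \<bar>t\<bar> powr (2 + \<alpha>)"
      have pt: "\<bar>indicator {0..} (z + t) * ?T k (z + t) - u k (z + t)\<bar> \<le> ?h t" for t
      proof (cases "z + t \<ge> 0")
        case True
        have "0 \<le> a / r powr (1 + \<alpha>) * \<bar>t\<bar> powr (2 + \<alpha>)" using a by simp
        then show ?thesis using Suc.IH[OF True] True by simp
      next
        case False
        then have "\<bar>z + t\<bar> \<le> \<bar>t\<bar>" using Suc.prems by auto
        have "\<bar>u k (z + t)\<bar> \<le> a * \<bar>z + t\<bar>" by (rule u_lin)
        also have "\<dots> \<le> a * (r + \<bar>t\<bar> powr (2 + \<alpha>) / r powr (1 + \<alpha>))"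
          using a over[of t] \<open>\<bar>z + t\<bar> \<le> \<bar>t\<bar>\<close> by (intro mult_left_mono) auto
        also have "\<dots> = a * r + a / r powr (1 + \<alpha>) * \<bar>t\<bar> powr (2 + \<alpha>)"
          by (simp add: algebra_simps)
        also have "\<dots> \<le> ?h t" using L0 by simp
        finally show ?thesis using False by simp
      qed
      have i1: "integrable M (\<lambda>t. indicator {0..} (z + t) * ?T k (z + t))" "integrable M (\<lambda>t. u k (z + t))"
        by (intro integrable_shift_restrict integrable_shift killed_pow_bdd_borel ub)+
      have "\<bar>\<integral>t. (indicator {0..} (z + t) * ?T k (z + t) - u k (z + t)) \<partial>M\<bar> \<le>
         (\<integral>t. \<bar>indicator {0..} (z + t) * ?T k (z + t) - u k (z + t)\<bar> \<partial>M)"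
        by (rule integral_abs_bound)
      also have "\<dots> \<le> (\<integral>t. ?h t \<partial>M)"
        using i1 moment_integrable pt by (intro integral_mono) auto
      also have "\<dots> = real k * L + a * r + a / r powr (1 + \<alpha>) * moment"
        using moment_integrable by (simp add: moment_def)
      finally have "\<bar>?T (Suc k) z - (\<integral>t. u k (z + t) \<partial>M)\<bar> \<le> real k * L + a * r + a / r powr (1 + \<alpha>) * moment"
        unfolding killed_pow_Suc free_step_def using i1 by simp
      then have "\<bar>?T (Suc k) z - u (Suc k) z\<bar> \<le> real k * L + a * r + a / r powr (1 + \<alpha>) * moment + 2 * C / v powr ((3 + \<alpha>) / 2)"
        using u_step[of k z] by linarith
      then show ?case by (simp add: L_def algebra_simps add_divide_distrib)
    qed
    \<comment> \<open>N <= r * r powr (1 + \<alpha>) together with r <= sqrt v: all N exchanges cost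
      no more than one overshoot of size r, up to constants.\<close>
    have b1: "real N * (2 * C / v powr ((3 + \<alpha>) / 2)) \<le> 2 * C * r / v"
    proof -
      define W where "W = v powr ((1 + \<alpha>) / 2)"
      have W: "W > 0" using v by (simp add: W_def)
      have "r powr (1 + \<alpha>) \<le> sqrt v powr (1 + \<alpha>)" using r alpha_pos by (intro powr_mono2) auto
      then have "r powr (1 + \<alpha>) \<le> W" using v by (simp add: W_def powr_half_sqrt[symmetric] powr_powr)
      then have "r * r powr (1 + \<alpha>) \<le> r * W" using r by (intro mult_left_mono) auto
      moreover have "r powr (2 + \<alpha>) = r * r powr (1 + \<alpha>)"
        using r powr_add[of r 1 "1 + \<alpha>"] by simp
      ultimately have "real N \<le> r * W" using N by linarith
      then have "real N * (2 * C / (v * W)) \<le> r * W * (2 * C / (v * W))"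
        using C(1) v W by (intro mult_right_mono) auto
      moreover have "r * W * (2 * C / (v * W)) = 2 * C * r / v" using W by simp
      moreover have "v powr ((3 + \<alpha>) / 2) = v * W"
      proof -
        have e: "(3 + \<alpha>) / 2 = 1 + (1 + \<alpha>) / 2" by (simp add: field_simps)
        show ?thesis unfolding e powr_add W_def using v by simp
      qed
      ultimately show ?thesis by simp
    qed
    have b2: "real N * (a * moment / r powr (1 + \<alpha>)) \<le> 2 * moment * r / v"
    proof -
      have "real N * (a * moment / r powr (1 + \<alpha>)) \<le> r powr (2 + \<alpha>) * (a * moment / r powr (1 + \<alpha>))"
        using N a moment_nonneg by (intro mult_right_mono) auto
      also have "r powr (2 + \<alpha>) = r * r powr (1 + \<alpha>)"
        using r powr_add[of r 1 "1 + \<alpha>"] by simp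
      finally show ?thesis using r by (simp add: a_def mult.commute mult.left_commute)
    qed
    have "real N * L + a * r \<le> (2 * C + 2 * moment + 2) * r / v"
      using b1 b2 by (simp add: L_def a_def distrib_left add_divide_distrib distrib_right)
    moreover have "(\<lambda>z. heat v (z - y) - heat v (z + y)) = u 0" by (simp add: u_def fun_eq_iff)
    ultimately show ?thesis using ind[OF x, of N] unfolding u_def[of N x] by simp
  qed
  show ?thesis
    using main C(1) moment_nonneg by (intro exI[of _ "2 * C + 2 * moment + 2"]) auto
qed

end

section \<open>Fourier analysis and the local limit theorem\<close>

lemma exp_neg_square_integrable:
  assumes "c > 0" shows "integrable lborel (\<lambda>s::real. exp (- (c * s\<^sup>2)))"
proof -
  have "integrable lborel (\<lambda>s::real. exp (- s\<^sup>2 / 2))"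
    using integrable_mult_right[OF integrable_normal_density[of 1 0], of "sqrt (2 * pi)"]
    by (simp add: std_normal_density_def)
  from lborel_integrable_real_affine[OF this, of "sqrt (2 * c)" 0]
  show ?thesis using assms by (simp add: power_mult_distrib)
qed

text \<open>The characteristic function of the standard normal law, read as Fourier inversion after
  the substitution x = sqrt v * s.\<close>

lemma heat_eq_Fourier:
  assumes v: "v > 0"
  shows "(\<integral>s. exp (- (v * s\<^sup>2 / 2)) * cos (s * z) \<partial>lborel) = 2 * pi * heat v z"
proof -
  define \<tau> where "\<tau> = sqrt v"
  have \<tau>: "\<tau> > 0" "v = \<tau>\<^sup>2" using v by (auto simp: \<tau>_def)
  define t where "t = z / \<tau>"
  have "Re (char std_normal_distribution t) = (\<integral>x. std_normal_density x * cos (t * x) \<partial>lborel)"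
  proof -
    have "integrable std_normal_distribution (\<lambda>x. iexp (t * x))"
      using real_dist_normal_dist by (intro prob_space.integrable_iexp) (auto simp: real_distribution_def)
    then have "Re (char std_normal_distribution t) = (\<integral>x. Re (iexp (t * x)) \<partial>std_normal_distribution)"
      unfolding char_def by simp
    also have "\<dots> = (\<integral>x. std_normal_density x * cos (t * x) \<partial>lborel)"
      by (subst integral_density) (auto simp: Re_exp)
    finally show ?thesis .
  qed
  then have "exp (- t\<^sup>2 / 2) = (\<integral>x. std_normal_density x * cos (t * x) \<partial>lborel)"
    by (simp add: char_std_normal_distribution)
  also have "\<dots> = \<tau> * (\<integral>s. std_normal_density (\<tau> * s) * cos (t * (\<tau> * s)) \<partial>lborel)"
    using lborel_integral_real_affine[of \<tau> "\<lambda>x. std_normal_density x * cos (t * x)" 0] \<tau> by simp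
  also have "(\<lambda>s. std_normal_density (\<tau> * s) * cos (t * (\<tau> * s))) = (\<lambda>s. (exp (- (v * s\<^sup>2 / 2)) * cos (s * z)) / sqrt (2 * pi))"
    using \<tau> by (simp add: fun_eq_iff std_normal_density_def t_def power_mult_distrib mult.commute)
  finally have "(\<integral>s. exp (- (v * s\<^sup>2 / 2)) * cos (s * z) \<partial>lborel) = exp (- t\<^sup>2 / 2) * sqrt (2 * pi) / \<tau>"
    using \<tau> by (simp add: field_simps)
  also have "\<dots> = 2 * pi * heat v z"
  proof -
    have e: "- t\<^sup>2 / 2 = - z\<^sup>2 / (2 * v)" using \<tau> by (simp add: t_def power_divide)
    have s: "sqrt (2 * pi * v) = sqrt (2 * pi) * \<tau>" using \<tau>(1) by (simp add: \<tau>(2) real_sqrt_mult)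
    have "sqrt (2 * pi) * sqrt (2 * pi) = 2 * pi" by simp
    then show ?thesis unfolding heat_def e s using \<tau>(1)
      by (simp add: field_simps)
  qed
  finally show ?thesis .
qed

section \<open>The triangle function and the Fejer kernel\<close>

definition tri :: "real \<Rightarrow> real \<Rightarrow> real" where
  "tri T t = max 0 (1 - \<bar>t\<bar> / T)"

text \<open>Defined by its Fourier integral; the closed form is \<open>fejer_eq\<close>. Since
  \<open>tri T\<close> has compact support, the characteristic function of the walk has to be
  estimated on bounded frequencies only.\<close>

definition fejer :: "real \<Rightarrow> real \<Rightarrow> real" where
  "fejer T z = 1 / (2 * pi) * (\<integral>t. tri T t * cos (t * z) \<partial>lborel)"

lemma tri_measurable [measurable]: "tri T \<in> borel_measurable borel"
  unfolding tri_def[abs_def] by measurable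

lemma tri_nonneg [simp]: "0 \<le> tri T t"
  by (simp add: tri_def)

lemma tri_le_1: "T > 0 \<Longrightarrow> tri T t \<le> 1"
  by (simp add: tri_def)

lemma tri_eq_0: "T > 0 \<Longrightarrow> \<bar>t\<bar> \<ge> T \<Longrightarrow> tri T t = 0"
  by (simp add: tri_def)

lemma tri_integrable: assumes "T > 0" shows "integrable lborel (tri T)"
proof (rule Bochner_Integration.integrable_bound)
  show "integrable lborel (indicator {-T..T} :: real \<Rightarrow> real)"
    by (rule integrable_real_indicator) (use assms in auto)
  show "AE t in lborel. norm (tri T t) \<le> norm (indicator {-T..T} t :: real)"
    using assms by (intro AE_I2) (auto simp: indicator_def tri_le_1 abs_of_nonneg tri_eq_0)
qed simp

context real_distribution
begin

lemma Fubini_dominated: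
  fixes F :: "real \<Rightarrow> real \<Rightarrow> real" and w :: "real \<Rightarrow> real"
  assumes F: "case_prod F \<in> borel_measurable (borel \<Otimes>\<^sub>M borel)"
    and w: "integrable lborel w" and le: "\<And>t s. \<bar>F t s\<bar> \<le> w t"
  shows "(\<integral>s. (\<integral>t. F t s \<partial>lborel) \<partial>M) = (\<integral>t. (\<integral>s. F t s \<partial>M) \<partial>lborel)"
proof -
  interpret pair_sigma_finite lborel M by unfold_locales
  have [measurable]: "case_prod F \<in> borel_measurable (lborel \<Otimes>\<^sub>M M)"
    using F by (simp cong: measurable_cong_sets)
  have i: "integrable M (\<lambda>s. F t s)" for t
    using le[of t] by (intro integrable_const_bound[of _ "w t"]) auto
  have "integrable (lborel \<Otimes>\<^sub>M M) (case_prod F)"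
  proof (rule Fubini_integrable)
    show "integrable lborel (\<lambda>t. \<integral>s. norm (case_prod F (t, s)) \<partial>M)"
    proof (rule Bochner_Integration.integrable_bound[OF w])
      show "AE t in lborel. norm (\<integral>s. norm (case_prod F (t, s)) \<partial>M) \<le> norm (w t)"
      proof (intro AE_I2)
        fix t
        have "(\<integral>s. \<bar>F t s\<bar> \<partial>M) \<le> (\<integral>s. w t \<partial>M)"
          using i[of t] le[of t] by (intro integral_mono) auto
        then show "norm (\<integral>s. norm (case_prod F (t, s)) \<partial>M) \<le> norm (w t)"
          by (simp add: abs_of_nonneg)
      qed
    qed measurable
  qed (use i in auto)
  then show ?thesis by (rule Fubini_integral)
qed

text \<open>Each free step multiplies the Fourier transform by \<open>char M t\<close>; Fubini
  applies with \<open>tri T\<close> as dominating function. The walk is added to z, so no complex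
  conjugate appears.\<close>

lemma free_pow_fejer:
  assumes T: "T > 0"
  shows "(free_step M ^^ m) (fejer T) z =
    1 / (2 * pi) * (\<integral>t. tri T t * Re (char M t ^ m * iexp (t * z)) \<partial>lborel)"
proof (induction m arbitrary: z)
  case 0
  show ?case by (simp add: fejer_def Re_exp)
next
  case (Suc m)
  let ?F = "\<lambda>t s. tri T t * Re (char M t ^ m * iexp (t * (z + s)))"
  have b: "\<bar>?F t s\<bar> \<le> tri T t" for t s
  proof -
    have "\<bar>Re (char M t ^ m * iexp (t * (z + s)))\<bar> \<le> norm (char M t ^ m * iexp (t * (z + s)))"
      by (rule abs_Re_le_cmod)
    also have "\<dots> \<le> 1"
      using cmod_char_le_1[of t] by (simp add: norm_mult norm_power power_le_one)
    finally show ?thesis by (simp add: abs_mult mult_left_le)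
  qed
  have inner: "(\<integral>s. ?F t s \<partial>M) = tri T t * Re (char M t ^ Suc m * iexp (t * z))" for t
  proof -
    have ii: "integrable M (\<lambda>s. iexp (t * s))"
      by (intro integrable_iexp) auto
    have e: "iexp (t * (z + s)) = iexp (t * z) * iexp (t * s)" for s
      by (simp add: distrib_left exp_add)
    have "(\<integral>s. ?F t s \<partial>M) = tri T t * (\<integral>s. Re (char M t ^ m * iexp (t * z) * iexp (t * s)) \<partial>M)"
      unfolding e mult.assoc by (rule integral_mult_right_zero)
    also have "(\<integral>s. Re (char M t ^ m * iexp (t * z) * iexp (t * s)) \<partial>M) =
        Re (\<integral>s. char M t ^ m * iexp (t * z) * iexp (t * s) \<partial>M)"
      by (rule integral_Re) (use ii in auto)
    also have "(\<integral>s. char M t ^ m * iexp (t * z) * iexp (t * s) \<partial>M) = char M t ^ m * iexp (t * z) * char M t"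
      unfolding char_def by simp
    finally show ?thesis by (simp only: power_Suc2 ac_simps)
  qed
  have "(free_step M ^^ Suc m) (fejer T) z = 1 / (2 * pi) * (\<integral>s. (\<integral>t. ?F t s \<partial>lborel) \<partial>M)"
    unfolding free_pow_Suc Suc by simp
  also have "(\<integral>s. (\<integral>t. ?F t s \<partial>lborel) \<partial>M) = (\<integral>t. (\<integral>s. ?F t s \<partial>M) \<partial>lborel)"
    by (rule Fubini_dominated[OF _ tri_integrable[OF T] b]) (simp add: split_beta', measurable)
  finally show ?case unfolding inner .
qed

end

section \<open>The characteristic function of a nonlattice law\<close>

locale nonlattice_law = centred_law +
  assumes nonlattice: "\<And>h a. h > 0 \<Longrightarrow> a \<in> {0..<h} \<Longrightarrow> prob {x. \<exists>k::int. x = h * of_int k + a} \<noteq> 1"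
begin

text \<open>If the modulus were 1, the nonnegative function 1 - cos (t * x - \<theta>), with
  \<theta> the argument of the characteristic function, would have mean 0. The law would then live
  on a translate of the lattice of span 2 * pi / |t|.\<close>

lemma norm_char_less_1:
  assumes t: "t \<noteq> 0" shows "norm (char M t) < 1"
proof (rule ccontr)
  assume "\<not> ?thesis"
  then have n1: "norm (char M t) = 1" using cmod_char_le_1[of t] by simp
  then obtain \<theta> where \<theta>: "char M t = cis \<theta>"
    using complex_norm_eq_1_exp[of "char M t"] by (metis cis_conv_exp cis_Arg_unique rcis_cmod_Arg rcis_def mult_1 of_real_1)
  have ii: "integrable M (\<lambda>s. iexp (t * s))"
    by (intro integrable_iexp) auto
  have ic: "integrable M (\<lambda>x. cos (t * x - \<theta>))"
    by (intro integrable_const_bound[of _ 1]) auto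
  have "(\<integral>x. cos (t * x - \<theta>) \<partial>M) = (\<integral>x. Re (cis (- \<theta>) * iexp (t * x)) \<partial>M)"
    by (simp add: cos_diff Re_exp Im_exp algebra_simps)
  also have "\<dots> = Re (\<integral>x. cis (- \<theta>) * iexp (t * x) \<partial>M)"
    by (rule integral_Re) (use ii in auto)
  also have "(\<integral>x. cis (- \<theta>) * iexp (t * x) \<partial>M) = cis (- \<theta>) * char M t"
    unfolding char_def by simp
  also have "Re \<dots> = 1" unfolding \<theta> by (simp add: cis_mult)
  finally have "(\<integral>x. 1 - cos (t * x - \<theta>) \<partial>M) = 0" using ic by simp
  then have "AE x in M. 1 - cos (t * x - \<theta>) = 0"
    using ic by (subst (asm) integral_nonneg_eq_0_iff_AE) auto
  moreover define h where "h = 2 * pi / \<bar>t\<bar>"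
  moreover define b where "b = \<theta> / t"
  \<comment> \<open>\<open>nonlattice\<close> speaks of offsets in [0, h), so \<theta> / t is
    reduced modulo h.\<close>
  moreover define a where "a = b - h * of_int \<lfloor>b / h\<rfloor>"
  ultimately have ae: "AE x in M. cos (t * x - \<theta>) = 1" by auto
  have h: "h > 0" using t by (simp add: h_def)
  have "h * of_int \<lfloor>b / h\<rfloor> \<le> h * (b / h)" "h * (b / h) < h * (of_int \<lfloor>b / h\<rfloor> + 1)"
    using h by (intro mult_left_mono mult_strict_left_mono; linarith)+
  then have a: "a \<in> {0..<h}" using h by (simp add: a_def distrib_left)
  have ex: "\<exists>k::int. x = h * of_int k + a" if "cos (t * x - \<theta>) = 1" for x
  proof -
    obtain n :: int where n: "t * x - \<theta> = of_int n * 2 * pi"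
      using \<open>cos (t * x - \<theta>) = 1\<close> by (auto simp: cos_one_2pi_int)
    \<comment> \<open>The span h is built from |t|, so the integer changes sign with t.\<close>
    define n' where "n' = (if t > 0 then n else - n)"
    have "x = of_int n * 2 * pi / t + b" using n t by (simp add: b_def field_simps)
    also have "of_int n * 2 * pi / t = h * of_int n'" using t by (simp add: h_def n'_def)
    finally have "x = h * of_int (n' + \<lfloor>b / h\<rfloor>) + a" by (simp add: a_def algebra_simps)
    then show ?thesis by blast
  qed
  have "AE x in M. \<exists>k::int. x = h * of_int k + a" using ae ex by auto
  then have "prob {x \<in> space M. \<exists>k::int. x = h * of_int k + a} = 1"
    by (subst prob_Collect_eq_1) simp_all
  then show False using nonlattice[OF h a] by simp
qed

text \<open>The remainder in \<open>char_approx3\<close> is a mean of min (6 x^2) (|t| |x|^3);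
  interpolating between the two entries brings in the moment of order 2 + \<alpha>.\<close>

lemma char_near_0: "norm (char M t - complex_of_real (1 - t\<^sup>2 * \<sigma>\<^sup>2 / 2)) \<le> moment * \<bar>t\<bar> powr (2 + \<alpha>)"
proof -
  have var: "variance (\<lambda>x. x) = \<sigma>\<^sup>2" using mean_zero sq_mean by simp
  have le: "min (6 * x\<^sup>2) (\<bar>t\<bar> * \<bar>x\<bar> ^ 3) \<le> 6 * \<bar>t\<bar> powr \<alpha> * \<bar>x\<bar> powr (2 + \<alpha>)" for x :: real
  proof (cases "t * x = 0")
    case True then show ?thesis by auto
  next
    case False
    then have tx: "\<bar>t * x\<bar> > 0" "x \<noteq> 0" "t \<noteq> 0" by auto
    have eq: "6 * \<bar>t\<bar> powr \<alpha> * \<bar>x\<bar> powr (2 + \<alpha>) = 6 * x\<^sup>2 * \<bar>t * x\<bar> powr \<alpha>"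
      using tx by (simp add: powr_add powr_numeral abs_mult powr_mult)
    show ?thesis
    proof (cases "\<bar>t * x\<bar> \<le> 1")
      case True
      have "\<bar>t\<bar> * \<bar>x\<bar> ^ 3 = x\<^sup>2 * \<bar>t * x\<bar> powr 1"
        using tx by (simp add: abs_mult power2_eq_square power3_eq_cube)
      also have "\<dots> \<le> 6 * x\<^sup>2 * \<bar>t * x\<bar> powr \<alpha>"
        using True tx alpha_le by (intro mult_mono powr_mono') auto
      finally show ?thesis unfolding eq by simp
    next
      case False
      then have "1 \<le> \<bar>t * x\<bar> powr \<alpha>" using alpha_pos by (intro ge_one_powr_ge_zero) auto
      then have "6 * x\<^sup>2 * 1 \<le> 6 * x\<^sup>2 * \<bar>t * x\<bar> powr \<alpha>" by (intro mult_left_mono) auto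
      then show ?thesis unfolding eq by simp
    qed
  qed
  have mi: "integrable M (\<lambda>x. min (6 * x\<^sup>2) (\<bar>t\<bar> * \<bar>x\<bar> ^ 3))"
    by (rule Bochner_Integration.integrable_bound[of _ "\<lambda>x. 6 * x\<^sup>2"]) (use sq_integrable in auto)
  have "norm (char M t - complex_of_real (1 - t\<^sup>2 * \<sigma>\<^sup>2 / 2)) \<le> t\<^sup>2 / 6 * expectation (\<lambda>x. min (6 * x\<^sup>2) (\<bar>t\<bar> * \<bar>x\<bar> ^ 3))"
    using char_approx3[OF mean_integrable mean_zero sq_integrable var, of t] by simp
  also have "\<dots> \<le> t\<^sup>2 / 6 * expectation (\<lambda>x. 6 * \<bar>t\<bar> powr \<alpha> * \<bar>x\<bar> powr (2 + \<alpha>))"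
    using mi moment_integrable le by (intro mult_left_mono integral_mono) auto
  also have "\<dots> = moment * (t\<^sup>2 * \<bar>t\<bar> powr \<alpha>)"
    by (simp add: moment_def)
  also have "t\<^sup>2 * \<bar>t\<bar> powr \<alpha> = \<bar>t\<bar> powr (2 + \<alpha>)"
    by (cases "t = 0") (auto simp: powr_add powr_numeral)
  finally show ?thesis .
qed

text \<open>Near 0 the quadratic term dominates; on the compact rest the modulus is continuous and
  below 1. The Gaussian form is chosen because its m-th power at t / sqrt m no longer depends on m
  and serves as a dominating function.\<close>

lemma norm_char_le_exp:
  assumes T: "T > 0"
  shows "\<exists>c>0. \<forall>t. \<bar>t\<bar> \<le> T \<longrightarrow> norm (char M t) \<le> exp (- (c * t\<^sup>2))"
proof -
  \<comment> \<open>For |t| powr \<alpha> <= e the remainder uses up at most half of the decrease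
    \<open>t\<^sup>2 * \<sigma>\<^sup>2 / 2\<close>. The entry 1 / \<sigma> of \<open>t0\<close>
    keeps the main term nonnegative.\<close>
  define e where "e = \<sigma>\<^sup>2 / (4 * (moment + 1))"
  have e: "e > 0" using sigma_pos moment_nonneg by (simp add: e_def)
  define t0 where "t0 = min (e powr (1 / \<alpha>)) (1 / \<sigma>)"
  have t0: "t0 > 0" using e sigma_pos by (simp add: t0_def)
  have near: "norm (char M t) \<le> exp (- (\<sigma>\<^sup>2 / 4 * t\<^sup>2))" if t: "\<bar>t\<bar> \<le> t0" for t
  proof -
    have "\<bar>t\<bar> powr \<alpha> \<le> (e powr (1 / \<alpha>)) powr \<alpha>"
      using t alpha_pos by (intro powr_mono2) (auto simp: t0_def)
    then have "\<bar>t\<bar> powr \<alpha> \<le> e" using alpha_pos e by (simp add: powr_powr)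
    then have "moment * \<bar>t\<bar> powr \<alpha> \<le> moment * e" using moment_nonneg by (intro mult_left_mono) auto
    also have "\<dots> \<le> \<sigma>\<^sup>2 / 4"
      using moment_nonneg by (simp add: e_def divide_simps) (simp add: distrib_left)
    finally have m: "moment * \<bar>t\<bar> powr \<alpha> \<le> \<sigma>\<^sup>2 / 4" .
    have "moment * \<bar>t\<bar> powr (2 + \<alpha>) = t\<^sup>2 * (moment * \<bar>t\<bar> powr \<alpha>)"
      by (cases "t = 0") (auto simp: powr_add powr_numeral)
    also have "\<dots> \<le> t\<^sup>2 * (\<sigma>\<^sup>2 / 4)" using m by (intro mult_left_mono) auto
    finally have m2: "moment * \<bar>t\<bar> powr (2 + \<alpha>) \<le> t\<^sup>2 * (\<sigma>\<^sup>2 / 4)" .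
    have "\<bar>t\<bar> \<le> 1 / \<sigma>" using t by (simp add: t0_def)
    then have "\<bar>t * \<sigma>\<bar> \<le> 1" using sigma_pos by (simp add: abs_mult field_simps)
    then have "(t * \<sigma>)\<^sup>2 \<le> 1" by (simp add: abs_square_le_1)
    then have "\<bar>1 - t\<^sup>2 * \<sigma>\<^sup>2 / 2\<bar> = 1 - t\<^sup>2 * \<sigma>\<^sup>2 / 2" by (simp add: power_mult_distrib)
    then have "norm (complex_of_real (1 - t\<^sup>2 * \<sigma>\<^sup>2 / 2)) = 1 - t\<^sup>2 * \<sigma>\<^sup>2 / 2"
      by (simp only: norm_of_real)
    then have "norm (char M t) \<le> 1 - t\<^sup>2 * \<sigma>\<^sup>2 / 2 + t\<^sup>2 * (\<sigma>\<^sup>2 / 4)"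
      using char_near_0[of t] m2 norm_triangle_sub[of "char M t" "complex_of_real (1 - t\<^sup>2 * \<sigma>\<^sup>2 / 2)"]
      by linarith
    also have "\<dots> = 1 + - (\<sigma>\<^sup>2 / 4 * t\<^sup>2)" by (simp add: algebra_simps)
    also have "\<dots> \<le> exp (- (\<sigma>\<^sup>2 / 4 * t\<^sup>2))" by (rule exp_ge_add_one_self)
    finally show ?thesis .
  qed
  define K where "K = {t. t0 \<le> \<bar>t\<bar> \<and> \<bar>t\<bar> \<le> T}"
  have "\<exists>c>0. \<forall>t\<in>K. norm (char M t) \<le> exp (- (c * t\<^sup>2))"
  proof (cases "K = {}")
    case True then show ?thesis by (auto intro!: exI[of _ 1])
  next
    case False
    have "closed K" unfolding K_def by (intro closed_Collect_conj closed_Collect_le continuous_intros)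
    moreover have "K \<subseteq> cball 0 T" by (auto simp: K_def)
    ultimately have "compact K" by (meson bounded_cball bounded_subset compact_eq_bounded_closed)
    moreover have "continuous_on K (\<lambda>t. norm (char M t))"
      using isCont_char by (intro continuous_on_norm continuous_at_imp_continuous_on) auto
    ultimately obtain s where s: "s \<in> K" "\<And>t. t \<in> K \<Longrightarrow> norm (char M t) \<le> norm (char M s)"
      using continuous_attains_sup[of K "\<lambda>t. norm (char M t)"] False by blast
    \<comment> \<open>The maximum with 1/2 keeps \<open>ln r\<close> meaningful should the
      characteristic function vanish on all of \<open>K\<close>.\<close>
    define r where "r = max (norm (char M s)) (1 / 2)"
    have r: "0 < r" "r < 1" using norm_char_less_1[of s] s(1) t0 by (auto simp: r_def K_def)
    have "norm (char M t) \<le> exp (- ((- ln r / T\<^sup>2) * t\<^sup>2))" if t: "t \<in> K" for t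
    proof -
      have "t\<^sup>2 \<le> T\<^sup>2" using t T by (simp add: K_def abs_le_square_iff[symmetric])
      then have "- ln r * (t\<^sup>2 / T\<^sup>2) \<le> - ln r * 1" using r T by (intro mult_left_mono) auto
      then have "ln r \<le> - ((- ln r / T\<^sup>2) * t\<^sup>2)" by simp
      then have "r \<le> exp (- ((- ln r / T\<^sup>2) * t\<^sup>2))" using r by (metis exp_le_cancel_iff exp_ln)
      then show ?thesis using s(2)[OF t] by (simp add: r_def)
    qed
    moreover have "- ln r / T\<^sup>2 > 0" using r T by (simp add: divide_neg_pos)
    ultimately show ?thesis by blast
  qed
  then obtain c where c: "c > 0" "\<And>t. t \<in> K \<Longrightarrow> norm (char M t) \<le> exp (- (c * t\<^sup>2))" by blast
  define d where "d = min c (\<sigma>\<^sup>2 / 4)"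
  have "norm (char M t) \<le> exp (- (d * t\<^sup>2))" if t: "\<bar>t\<bar> \<le> T" for t
  proof -
    have "d * t\<^sup>2 \<le> c * t\<^sup>2" "d * t\<^sup>2 \<le> \<sigma>\<^sup>2 / 4 * t\<^sup>2" unfolding d_def by (intro mult_right_mono; simp)+
    then have "exp (- (c * t\<^sup>2)) \<le> exp (- (d * t\<^sup>2))" "exp (- (\<sigma>\<^sup>2 / 4 * t\<^sup>2)) \<le> exp (- (d * t\<^sup>2))" by auto
    moreover have "norm (char M t) \<le> exp (- (\<sigma>\<^sup>2 / 4 * t\<^sup>2)) \<or> norm (char M t) \<le> exp (- (c * t\<^sup>2))"
      using near[of t] c(2)[of t] t by (cases "\<bar>t\<bar> \<le> t0") (auto simp: K_def)
    ultimately show ?thesis by linarith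
  qed
  then show ?thesis using c(1) sigma_pos by (intro exI[of _ d]) (auto simp: d_def)
qed

text \<open>Powers of numbers in the unit disc differ by at most m times the difference of the
  bases, which is of order m powr (-1 - \<alpha> / 2) here.\<close>

lemma char_pow_tendsto:
  "(\<lambda>m. char M (s / sqrt (real m)) ^ m) \<longlonglongrightarrow> complex_of_real (exp (- (\<sigma>\<^sup>2 * s\<^sup>2 / 2)))"
proof -
  let ?a = "\<lambda>m. 1 + (- (\<sigma>\<^sup>2 * s\<^sup>2 / 2)) / real m"
  have "(\<lambda>m. complex_of_real (?a m ^ m)) \<longlonglongrightarrow> complex_of_real (exp (- (\<sigma>\<^sup>2 * s\<^sup>2 / 2)))"
    by (rule isCont_tendsto_compose [OF _ tendsto_exp_limit_sequentially]) auto
  moreover have "(\<lambda>m. char M (s / sqrt (real m)) ^ m - complex_of_real (?a m ^ m)) \<longlonglongrightarrow> 0"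
  proof (rule Lim_null_comparison)
    show "\<forall>\<^sub>F m in sequentially. norm (char M (s / sqrt (real m)) ^ m - complex_of_real (?a m ^ m))
        \<le> moment * \<bar>s\<bar> powr (2 + \<alpha>) * real m powr (- (\<alpha> / 2))"
    proof (rule eventually_sequentiallyI)
      fix m :: nat assume m: "m \<ge> max 1 (nat \<lceil>\<sigma>\<^sup>2 * s\<^sup>2\<rceil>)"
      then have m1: "m \<ge> 1" "real m \<ge> \<sigma>\<^sup>2 * s\<^sup>2" by (auto simp: nat_ceiling_le_eq)
      let ?t = "s / sqrt (real m)"
      have eq: "1 - ?t\<^sup>2 * \<sigma>\<^sup>2 / 2 = ?a m" using m1 by (simp add: power_divide mult.commute)
      have "0 \<le> \<sigma>\<^sup>2 * s\<^sup>2 / 2 / real m" "\<sigma>\<^sup>2 * s\<^sup>2 / 2 / real m \<le> 1"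
        using m1 by (auto simp: pos_divide_le_eq)
      then have "\<bar>?a m\<bar> \<le> 1" by simp
      then have "norm (char M ?t ^ m - complex_of_real (?a m) ^ m) \<le> m * norm (char M ?t - complex_of_real (?a m))"
        by (intro norm_power_diff cmod_char_le_1) (simp only: norm_of_real)
      also have "\<dots> \<le> m * (moment * \<bar>?t\<bar> powr (2 + \<alpha>))"
        using char_near_0[of ?t] unfolding eq by (intro mult_left_mono) auto
      also have "\<bar>?t\<bar> powr (2 + \<alpha>) = \<bar>s\<bar> powr (2 + \<alpha>) / (real m * real m powr (\<alpha> / 2))"
      proof -
        have "sqrt (real m) powr (2 + \<alpha>) = real m powr (1 + \<alpha> / 2)"
          using m1 by (simp add: powr_half_sqrt[symmetric] powr_powr distrib_left add_divide_distrib)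
        also have "\<dots> = real m * real m powr (\<alpha> / 2)" using m1 by (simp add: powr_add)
        finally show ?thesis using m1 by (simp add: powr_divide)
      qed
      also have "m * (moment * (\<bar>s\<bar> powr (2 + \<alpha>) / (real m * real m powr (\<alpha> / 2))))
          = moment * \<bar>s\<bar> powr (2 + \<alpha>) * real m powr (- (\<alpha> / 2))"
        using m1 by (simp add: powr_minus_divide)
      finally show "norm (char M ?t ^ m - complex_of_real (?a m ^ m))
        \<le> moment * \<bar>s\<bar> powr (2 + \<alpha>) * real m powr (- (\<alpha> / 2))"
        by (simp only: of_real_power)
    qed
    show "(\<lambda>m. moment * \<bar>s\<bar> powr (2 + \<alpha>) * real m powr (- (\<alpha> / 2))) \<longlonglongrightarrow> 0"
      using alpha_pos by (intro tendsto_mult_right_zero tendsto_neg_powr filterlim_real_sequentially) auto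
  qed
  ultimately show ?thesis by (rule Lim_transform)
qed

text \<open>Substitute t = s / sqrt m in \<open>free_pow_fejer\<close> and compare with
  \<open>heat_eq_Fourier\<close>. The point z enters through a factor of modulus 1 only, so the L1
  distance \<open>E m\<close> of the integrands controls all z at once.\<close>

lemma fejer_local_limit:
  assumes T: "T > 0" and \<kappa>: "\<kappa> > 0"
  shows "\<forall>\<^sub>F m in sequentially. \<forall>z. \<bar>sqrt (real m) * (free_step M ^^ m) (fejer T) z - heat (\<sigma>\<^sup>2) (z / sqrt (real m))\<bar> \<le> \<kappa>"
proof -
  define g where "g s = exp (- (\<sigma>\<^sup>2 * s\<^sup>2 / 2))" for s :: real
  define f where "f m s = complex_of_real (tri T (s / sqrt (real m))) * char M (s / sqrt (real m)) ^ m" for m s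
  define E where "E m = (\<integral>s. norm (f m s - complex_of_real (g s)) \<partial>lborel)" for m
  obtain c where c: "c > 0" "\<And>t. \<bar>t\<bar> \<le> T \<Longrightarrow> norm (char M t) \<le> exp (- (c * t\<^sup>2))"
    using norm_char_le_exp[OF T] by blast
  have [measurable]: "f m \<in> borel_measurable borel" for m unfolding f_def[abs_def] by measurable
  have [measurable]: "g \<in> borel_measurable borel" unfolding g_def[abs_def] by measurable
  have gi: "integrable lborel g"
    unfolding g_def using exp_neg_square_integrable[of "\<sigma>\<^sup>2 / 2"] sigma_pos by simp
  have f_le: "norm (f m s) \<le> exp (- (c * s\<^sup>2))" if m: "m \<ge> 1" for m s
  proof (cases "\<bar>s / sqrt (real m)\<bar> \<le> T")
    case True
    have "norm (f m s) \<le> 1 * norm (char M (s / sqrt (real m))) ^ m"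
      unfolding f_def norm_mult norm_power using T by (intro mult_right_mono) (auto simp: tri_le_1)
    also have "\<dots> \<le> exp (- (c * (s / sqrt (real m))\<^sup>2)) ^ m"
      using c(2)[OF True] by (simp add: power_mono)
    also have "\<dots> = exp (- (c * s\<^sup>2))"
      using m by (simp add: exp_of_nat_mult[symmetric] power_divide)
    finally show ?thesis .
  next
    case False
    then show ?thesis using T by (simp add: f_def tri_eq_0)
  qed
  have ci: "integrable lborel (\<lambda>s. exp (- (c * s\<^sup>2)) + g s)"
    using exp_neg_square_integrable[OF c(1)] gi by simp
  have le: "norm (f m s - complex_of_real (g s)) \<le> exp (- (c * s\<^sup>2)) + g s" if "m \<ge> 1" for m s
    using f_le[OF that, of s] norm_triangle_ineq4[of "f m s" "complex_of_real (g s)"] by (simp add: g_def)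
  have fgi: "integrable lborel (\<lambda>s. f m s - complex_of_real (g s))" if "m \<ge> 1" for m
    by (rule Bochner_Integration.integrable_bound[OF ci]) (use le[OF that] in \<open>auto intro!: AE_I2 intro: order_trans[OF _ abs_ge_self]\<close>)
  have fi: "integrable lborel (f m)" if "m \<ge> 1" for m
    using Bochner_Integration.integrable_add[OF fgi[OF that], of "\<lambda>s. complex_of_real (g s)"] gi by simp
  \<comment> \<open>Shifted by one because the dominating function is available for m >= 1
    only.\<close>
  have "(\<lambda>m. E (Suc m)) \<longlonglongrightarrow> (\<integral>s. 0 \<partial>(lborel :: real measure))"
    unfolding E_def
  proof (rule integral_dominated_convergence[OF _ _ ci])
    show "AE s in lborel. (\<lambda>m. norm (f (Suc m) s - complex_of_real (g s))) \<longlonglongrightarrow> 0"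
    proof (intro AE_I2)
      fix s :: real
      have "(\<lambda>m. s / sqrt (real m)) \<longlonglongrightarrow> 0" by real_asymp
      then have "(\<lambda>m. tri T (s / sqrt (real m))) \<longlonglongrightarrow> max 0 (1 - \<bar>0\<bar> / T)"
        unfolding tri_def using T by (intro tendsto_intros) auto
      then have "(\<lambda>m. complex_of_real (tri T (s / sqrt (real m)))) \<longlonglongrightarrow> complex_of_real 1"
        by (intro tendsto_of_real) simp
      then have "(\<lambda>m. f m s) \<longlonglongrightarrow> complex_of_real 1 * complex_of_real (g s)"
        unfolding f_def g_def by (intro tendsto_mult char_pow_tendsto)
      then have "(\<lambda>m. norm (f m s - complex_of_real (g s))) \<longlonglongrightarrow> 0"
        by (simp add: LIM_zero tendsto_norm_zero)
      then show "(\<lambda>m. norm (f (Suc m) s - complex_of_real (g s))) \<longlonglongrightarrow> 0"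
        by (rule LIMSEQ_Suc)
    qed
    show "AE s in lborel. norm (norm (f (Suc m) s - complex_of_real (g s))) \<le> exp (- (c * s\<^sup>2)) + g s" for m
      using le[of "Suc m"] by auto
  qed auto
  then have E0: "E \<longlonglongrightarrow> 0" by (simp add: LIMSEQ_imp_Suc)
  have key: "\<bar>sqrt (real m) * (free_step M ^^ m) (fejer T) z - heat (\<sigma>\<^sup>2) (z / sqrt (real m))\<bar> \<le> E m / (2 * pi)"
    if m: "m \<ge> 1" for m z
  proof -
    let ?\<zeta> = "z / sqrt (real m)"
    have sm: "sqrt (real m) > 0" using m by simp
    have ie: "integrable lborel (\<lambda>s. f m s * iexp (s * ?\<zeta>))"
      by (rule Bochner_Integration.integrable_bound[OF fi[OF m]]) (auto simp: norm_mult)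
    have ig: "integrable lborel (\<lambda>s. complex_of_real (g s) * iexp (s * ?\<zeta>))"
      by (rule Bochner_Integration.integrable_bound[OF gi]) (auto simp: norm_mult)
    have "(\<integral>t. tri T t * Re (char M t ^ m * iexp (t * z)) \<partial>lborel) =
        1 / sqrt (real m) * (\<integral>s. tri T (s / sqrt (real m)) * Re (char M (s / sqrt (real m)) ^ m * iexp (s / sqrt (real m) * z)) \<partial>lborel)"
      using lborel_integral_real_affine[of "1 / sqrt (real m)" "\<lambda>t. tri T t * Re (char M t ^ m * iexp (t * z))" 0] sm by simp
    also have "(\<lambda>s. tri T (s / sqrt (real m)) * Re (char M (s / sqrt (real m)) ^ m * iexp (s / sqrt (real m) * z))) =
        (\<lambda>s. Re (f m s * iexp (s * ?\<zeta>)))"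
      by (simp add: f_def fun_eq_iff mult.assoc)
    finally have 1: "sqrt (real m) * (free_step M ^^ m) (fejer T) z = 1 / (2 * pi) * (\<integral>s. Re (f m s * iexp (s * ?\<zeta>)) \<partial>lborel)"
      unfolding free_pow_fejer[OF T] using sm by simp
    have "(\<integral>s. Re (complex_of_real (g s) * iexp (s * ?\<zeta>)) \<partial>lborel) = 2 * pi * heat (\<sigma>\<^sup>2) ?\<zeta>"
      using heat_eq_Fourier[of "\<sigma>\<^sup>2" ?\<zeta>] sigma_pos by (simp add: g_def Re_exp)
    then have 2: "heat (\<sigma>\<^sup>2) ?\<zeta> = 1 / (2 * pi) * (\<integral>s. Re (complex_of_real (g s) * iexp (s * ?\<zeta>)) \<partial>lborel)"
      by simp
    let ?A = "\<lambda>s. Re (f m s * iexp (s * ?\<zeta>))" and ?B = "\<lambda>s. Re (complex_of_real (g s) * iexp (s * ?\<zeta>))"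
    have iA: "integrable lborel ?A" using ie by (rule integrable_Re)
    have iB: "integrable lborel ?B" using ig by (rule integrable_Re)
    have "\<bar>\<integral>s. ?A s - ?B s \<partial>lborel\<bar> \<le> (\<integral>s. \<bar>?A s - ?B s\<bar> \<partial>lborel)"
      by (rule integral_abs_bound)
    also have "\<dots> \<le> E m"
      unfolding E_def
    proof (rule integral_mono)
      show "integrable lborel (\<lambda>s. \<bar>?A s - ?B s\<bar>)"
        by (intro integrable_abs Bochner_Integration.integrable_diff iA iB)
      show "integrable lborel (\<lambda>s. norm (f m s - complex_of_real (g s)))"
        by (intro integrable_norm fgi m)
      fix s
      have "\<bar>Re ((f m s - complex_of_real (g s)) * iexp (s * ?\<zeta>))\<bar> \<le> norm ((f m s - complex_of_real (g s)) * iexp (s * ?\<zeta>))"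
        by (rule abs_Re_le_cmod)
      also have "\<dots> = norm (f m s - complex_of_real (g s))" by (simp add: norm_mult)
      finally show "\<bar>Re (f m s * iexp (s * ?\<zeta>)) - Re (complex_of_real (g s) * iexp (s * ?\<zeta>))\<bar> \<le> norm (f m s - complex_of_real (g s))"
        by (simp only: left_diff_distrib minus_complex.simps)
    qed
    finally have "\<bar>\<integral>s. ?A s - ?B s \<partial>lborel\<bar> / (2 * pi) \<le> E m / (2 * pi)"
      by (intro divide_right_mono) auto
    moreover have "\<bar>(\<integral>s. ?A s - ?B s \<partial>lborel)\<bar> / (2 * pi) = \<bar>1 / (2 * pi) * integral\<^sup>L lborel ?A - 1 / (2 * pi) * integral\<^sup>L lborel ?B\<bar>"
      unfolding Bochner_Integration.integral_diff[OF iA iB] right_diff_distrib[symmetric] abs_mult by simp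
    ultimately show ?thesis unfolding 1 2 by linarith
  qed
  have "\<forall>\<^sub>F m in sequentially. \<bar>E m\<bar> < 2 * pi * \<kappa>"
    using order_tendstoD(2)[OF tendsto_rabs_zero[OF E0], of "2 * pi * \<kappa>"] \<kappa> by simp
  then show ?thesis
    using eventually_ge_at_top[of 1]
  proof eventually_elim
    case (elim m)
    then have "E m / (2 * pi) \<le> \<kappa>" by (simp add: field_simps)
    then show ?case using key[OF elim(2)] by (meson order_trans)
  qed
qed

end

section \<open>Closed form, positivity and mass of the Fejer kernel\<close>

lemma integrable_indicator_Icc: "integrable lborel (indicator {a..b::real} :: real \<Rightarrow> real)"
  by (rule integrable_real_indicator) (simp_all add: emeasure_lborel_Icc_eq)

lemma fejer_eq:
  assumes T: "T > 0" and z: "z \<noteq> 0"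
  shows "fejer T z = (1 - cos (T * z)) / (pi * T * z\<^sup>2)"
proof -
  let ?f1 = "\<lambda>t. (1 - t / T) * cos (t * z)" and ?f2 = "\<lambda>t. (1 + t / T) * cos (t * z)"
  \<comment> \<open>Antiderivatives found by parts, one for each slope of the triangle.\<close>
  let ?F1 = "\<lambda>t. (1 - t / T) * sin (t * z) / z - cos (t * z) / (T * z\<^sup>2)"
  let ?F2 = "\<lambda>t. (1 + t / T) * sin (t * z) / z + cos (t * z) / (T * z\<^sup>2)"
  have 1: "has_bochner_integral lborel (\<lambda>t. ?f1 t * indicator {0..T} t) (?F1 T - ?F1 0)"
    using T z by (intro has_bochner_integral_FTC_Icc_real)
      (auto intro!: derivative_eq_intros continuous_intros simp: field_simps power2_eq_square)
  have 2: "has_bochner_integral lborel (\<lambda>t. ?f2 t * indicator {-T..0} t) (?F2 0 - ?F2 (-T))"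
    using T z by (intro has_bochner_integral_FTC_Icc_real)
      (auto intro!: derivative_eq_intros continuous_intros simp: field_simps power2_eq_square)
  have "has_bochner_integral lborel (\<lambda>t. ?f1 t * indicator {0..T} t + ?f2 t * indicator {-T..0} t)
      ((?F1 T - ?F1 0) + (?F2 0 - ?F2 (-T)))"
    by (rule has_bochner_integral_add[OF 1 2])
  then have "(\<integral>t. ?f1 t * indicator {0..T} t + ?f2 t * indicator {-T..0} t \<partial>lborel) = (?F1 T - ?F1 0) + (?F2 0 - ?F2 (-T))"
    by (rule has_bochner_integral_integral_eq)
  also have "\<dots> = 2 * (1 - cos (T * z)) / (T * z\<^sup>2)"
    using T by (simp add: diff_divide_distrib add_divide_distrib)
  also have "(\<integral>t. ?f1 t * indicator {0..T} t + ?f2 t * indicator {-T..0} t \<partial>lborel) = (\<integral>t. tri T t * cos (t * z) \<partial>lborel)"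
  proof (rule integral_cong_AE)
    have "AE t in lborel. t \<noteq> (0::real)" by (rule AE_lborel_singleton)
    then show "AE t in lborel. ?f1 t * indicator {0..T} t + ?f2 t * indicator {-T..0} t = tri T t * cos (t * z)"
    proof (rule AE_mp, intro AE_I2 impI)
      fix t :: real assume "t \<noteq> 0"
      then show "?f1 t * indicator {0..T} t + ?f2 t * indicator {-T..0} t = tri T t * cos (t * z)"
        using T by (auto simp: tri_def indicator_def max_def field_simps)
    qed
  qed measurable
  finally have e: "(\<integral>t. tri T t * cos (t * z) \<partial>lborel) = 2 * (1 - cos (T * z)) / (T * z\<^sup>2)" .
  show ?thesis unfolding fejer_def e using T z by (simp add: field_simps)
qed

lemma fejer_measurable [measurable]: "fejer T \<in> borel_measurable borel"
proof -
  have "(\<lambda>z. \<integral>t. tri T t * cos (t * z) \<partial>lborel) \<in> borel_measurable borel"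
    by (rule sigma_finite_measure.borel_measurable_lebesgue_integral[OF sigma_finite_lborel]) measurable
  then show ?thesis unfolding fejer_def[abs_def] by measurable
qed

lemma fejer_le_tri: assumes "T > 0" shows "\<bar>fejer T z\<bar> \<le> fejer T 0"
proof -
  have "\<bar>\<integral>t. tri T t * cos (t * z) \<partial>lborel\<bar> \<le> (\<integral>t. \<bar>tri T t * cos (t * z)\<bar> \<partial>lborel)"
    by (rule integral_abs_bound)
  also have "\<dots> \<le> (\<integral>t. tri T t \<partial>lborel)"
  proof (rule integral_mono)
    have "integrable lborel (\<lambda>t. tri T t * cos (t * z))"
      by (rule Bochner_Integration.integrable_bound[OF tri_integrable[OF assms]]) (auto simp: abs_mult mult_left_le)
    then show "integrable lborel (\<lambda>t. \<bar>tri T t * cos (t * z)\<bar>)" by simp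
  qed (auto simp: tri_integrable[OF assms] abs_mult mult_left_le)
  finally show ?thesis by (simp add: fejer_def abs_mult divide_right_mono)
qed

lemma fejer_bdd_borel: "T > 0 \<Longrightarrow> fejer T \<in> bdd_borel"
  by (rule bdd_borelI[OF fejer_measurable fejer_le_tri])

lemma fejer_nonneg: assumes "T > 0" shows "0 \<le> fejer T z"
proof (cases "z = 0")
  case True then show ?thesis using fejer_le_tri[OF assms, of 0] by auto
next
  case False then show ?thesis using assms by (simp add: fejer_eq)
qed

lemma fejer_le: assumes "T > 0" "z \<noteq> 0" shows "fejer T z \<le> 2 / (pi * T * z\<^sup>2)"
proof -
  have "1 - cos (T * z) \<le> 2" using cos_ge_minus_one[of "T * z"] by linarith
  then show ?thesis using assms by (simp add: fejer_eq divide_right_mono)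
qed

lemma fejer_uminus: "fejer T (- z) = fejer T z"
  by (simp add: fejer_def)

text \<open>The zeros of the two translates do not meet, so their sum dominates a multiple of
  \<open>1 / (1 + z\<^sup>2)\<close> while its Fourier transform still has compact support.\<close>

lemma fejer_sum_ge: "1 / (pi ^ 3 * (1 + z\<^sup>2)) \<le> fejer 1 z + fejer 1 (z + pi)"
proof -
  have pp: "pi * pi \<ge> 1" using pi_ge_two mult_mono[of 1 pi 1 pi] by auto
  have bz: "z\<^sup>2 \<le> 2 * (pi * pi) * (1 + z\<^sup>2)" "(z + pi)\<^sup>2 \<le> 2 * (pi * pi) * (1 + z\<^sup>2)"
  proof -
    have m: "z\<^sup>2 * 1 \<le> z\<^sup>2 * (pi * pi)" using pp by (intro mult_left_mono) auto
    have "(z + pi)\<^sup>2 \<le> 2 * z\<^sup>2 + 2 * (pi * pi)"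
      using zero_le_power2[of "z - pi"] by (simp add: power2_eq_square algebra_simps)
    moreover have "2 * (pi * pi) * (1 + z\<^sup>2) = 2 * (pi * pi) + 2 * (z\<^sup>2 * (pi * pi))"
      by (simp add: algebra_simps)
    moreover have "0 \<le> z\<^sup>2 * (pi * pi)" by simp
    ultimately show "(z + pi)\<^sup>2 \<le> 2 * (pi * pi) * (1 + z\<^sup>2)" "z\<^sup>2 \<le> 2 * (pi * pi) * (1 + z\<^sup>2)"
      using m pp by linarith+
  qed
  have zp: "1 + z\<^sup>2 > 0" by (simp add: add_pos_nonneg)
  then have pos: "2 * (pi * pi) * (1 + z\<^sup>2) > 0" by (simp add: add_pos_nonneg)
  have one: "1 / (pi ^ 3 * (1 + z\<^sup>2)) = 2 / (pi * (2 * (pi * pi) * (1 + z\<^sup>2)))"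
  proof -
    have "pi * (2 * (pi * pi) * (1 + z\<^sup>2)) = 2 * (pi ^ 3 * (1 + z\<^sup>2))"
      by (simp add: power3_eq_cube)
    then show ?thesis by (simp only: mult_divide_mult_cancel_left_if) simp
  qed
  show ?thesis
  proof (cases "z = 0 \<or> z + pi = 0")
    case True
    then consider "z = 0" | "z = - pi" by (auto simp: add_eq_0_iff)
    then show ?thesis
    proof cases
      case 1
      have "1 / (pi ^ 3 * (1 + z\<^sup>2)) \<le> 2 / pi ^ 3" using 1 by (simp add: divide_right_mono)
      also have "2 / pi ^ 3 = fejer 1 (z + pi)"
        using fejer_eq[of 1 "z + pi"] 1 by (simp add: power2_eq_square power3_eq_cube)
      finally show ?thesis using fejer_nonneg[of 1 z] by linarith
    next
      case 2
      have "1 / (pi ^ 3 * (1 + z\<^sup>2)) \<le> 1 / (pi ^ 3 * 1)" by (intro divide_left_mono mult_left_mono) (auto simp: add_pos_nonneg)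
      also have "\<dots> \<le> 2 / pi ^ 3" by (simp add: divide_right_mono)
      also have "2 / pi ^ 3 = fejer 1 z"
        using fejer_eq[of 1 z] 2 by (simp add: power2_eq_square power3_eq_cube)
      finally show ?thesis using fejer_nonneg[of 1 "z + pi"] by linarith
    qed
  next
    case False
    then have nz: "z \<noteq> 0" "z + pi \<noteq> 0" by auto
    let ?D = "pi * (2 * (pi * pi) * (1 + z\<^sup>2))"
    have "(1 - cos z) / ?D \<le> (1 - cos z) / (pi * z\<^sup>2)"
      using nz bz(1) pos zp by (intro divide_left_mono mult_left_mono mult_pos_pos) auto
    also have "\<dots> = fejer 1 z" using nz by (simp add: fejer_eq)
    finally have f1: "(1 - cos z) / ?D \<le> fejer 1 z" .
    have "(1 + cos z) / ?D \<le> (1 + cos z) / (pi * (z + pi)\<^sup>2)"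
      using nz bz(2) pos zp cos_ge_minus_one[of z] by (intro divide_left_mono mult_left_mono mult_pos_pos) (auto simp del: cos_ge_minus_one)
    also have "\<dots> = fejer 1 (z + pi)" using nz by (simp add: fejer_eq)
    finally have f2: "(1 + cos z) / ?D \<le> fejer 1 (z + pi)" .
    \<comment> \<open>Translation by pi reverses the sign of the cosine, so the two numerators add
      up to 2.\<close>
    have "2 / ?D = (1 - cos z) / ?D + (1 + cos z) / ?D" by (simp add: add_divide_distrib[symmetric])
    then show ?thesis unfolding one using f1 f2 by linarith
  qed
qed

text \<open>The mass that \<open>fejer T\<close> puts on [-\<rho>, \<rho>], as a function of x = T *
  \<rho>; integration by parts expresses it by the sine integral, see
  \<open>integral_fejer_symmetric\<close>.\<close>

definition fejer_mass :: "real \<Rightarrow> real" where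
  "fejer_mass x = 2 / pi * (Si x - (1 - cos x) / x)"

lemma one_minus_cos_le: "\<bar>1 - cos x\<bar> \<le> x\<^sup>2 / (2::real)"
proof -
  have "1 - cos x = 2 * (sin (x / 2))\<^sup>2"
    using cos_double_sin[of "x / 2"] by simp
  moreover have "(sin (x / 2))\<^sup>2 \<le> (x / 2)\<^sup>2"
    using abs_sin_x_le_abs_x[of "x / 2"] by (simp only: abs_le_square_iff)
  ultimately show ?thesis by (simp add: power_divide)
qed

lemma integral_fejer_half:
  assumes T: "T > 0" and \<rho>: "\<rho> > 0"
  shows "(\<integral>u. indicator {0..\<rho>} u * fejer T u \<partial>lborel) = fejer_mass (T * \<rho>) / 2"
proof -
  let ?k = "\<lambda>z. (1 - cos (T * z)) / (pi * T * z\<^sup>2)"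
  let ?F = "\<lambda>z. 1 / pi * (Si (T * z) - (1 - cos (T * z)) / (T * z))"
  have c0: "((\<lambda>x. (1 - cos x) / x) \<longlongrightarrow> 0) (at (0::real))"
  proof (rule Lim_null_comparison)
    show "\<forall>\<^sub>F x in at 0. norm ((1 - cos x) / x) \<le> \<bar>x\<bar> / 2"
    proof (rule eventuallyI)
      fix x :: real
      show "norm ((1 - cos x) / x) \<le> \<bar>x\<bar> / 2"
      proof (cases "x = 0")
        case False
        then have "\<bar>1 - cos x\<bar> / \<bar>x\<bar> \<le> (x\<^sup>2 / 2) / \<bar>x\<bar>" by (intro divide_right_mono one_minus_cos_le) auto
        also have "\<dots> = \<bar>x\<bar> / 2" using False by (simp add: power2_eq_square) (metis abs_mult_self_eq nonzero_mult_div_cancel_left abs_eq_0 mult.assoc times_divide_eq_right)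
        finally show ?thesis by (simp add: abs_divide)
      qed simp
    qed
    show "((\<lambda>x::real. \<bar>x\<bar> / 2) \<longlongrightarrow> 0) (at 0)" by (auto intro!: tendsto_eq_intros)
  qed
  \<comment> \<open>By x / 0 = 0 the quotient takes its limiting value at 0, so the antiderivative
    is continuous on the closed interval.\<close>
  then have c1: "isCont (\<lambda>x. (1 - cos x) / x) (x::real)" for x
    by (cases "x = 0") (auto simp: isCont_def intro!: tendsto_intros)
  have cF: "continuous_on {0..\<rho>} ?F"
  proof (intro continuous_at_imp_continuous_on ballI)
    fix z
    have "isCont (\<lambda>z. Si (T * z)) z"
      by (rule isCont_o2[of _ "\<lambda>z. T * z" Si]) (auto intro: isCont_Si)
    moreover have "isCont (\<lambda>z. (1 - cos (T * z)) / (T * z)) z"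
      by (rule isCont_o2[of z "\<lambda>z. T * z" "\<lambda>x. (1 - cos x) / x"]) (auto intro: c1)
    ultimately show "isCont ?F z"
      by (intro continuous_mult continuous_diff continuous_const)
  qed
  have der: "(?F has_vector_derivative ?k z) (at z)" if z: "z \<in> {0<..<\<rho>}" for z
  proof -
    have "((\<lambda>z. Si (T * z)) has_real_derivative (sinc (T * z) * T)) (at z)"
      by (rule DERIV_chain2[OF DERIV_Si]) (auto intro!: derivative_eq_intros)
    moreover have "sinc (T * z) * T = sin (T * z) / z" using z T by simp
    ultimately have dSi: "((\<lambda>z. Si (T * z)) has_real_derivative (sin (T * z) / z)) (at z)" by (simp only:)
    have dq: "((\<lambda>z. (1 - cos (T * z)) / (T * z)) has_real_derivative
        (sin (T * z) / z - (1 - cos (T * z)) / (T * z\<^sup>2))) (at z)"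
      using z T by (auto intro!: derivative_eq_intros simp: field_simps power2_eq_square)
    have "1 / pi * (sin (T * z) / z - (sin (T * z) / z - (1 - cos (T * z)) / (T * z\<^sup>2))) = ?k z"
      by simp
    then have "(?F has_real_derivative ?k z) (at z)"
      using DERIV_cmult[OF DERIV_diff[OF dSi dq], of "1 / pi"] by (simp only:)
    then show ?thesis
      by (simp add: has_real_derivative_iff_has_vector_derivative)
  qed
  have "(?k has_integral (?F \<rho> - ?F 0)) {0..\<rho>}"
    using fundamental_theorem_of_calculus_interior[where f = "?F" and f' = "?k" and a = 0 and b = \<rho>, OF _ cF der] \<rho>
    by simp
  then have "(fejer T has_integral (?F \<rho> - ?F 0)) {0..\<rho>}"
    by (rule has_integral_spike[of "{0}", rotated 2]) (auto simp: fejer_eq[OF T])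
  moreover have si: "set_integrable lborel {0..\<rho>} (fejer T)"
  proof -
    have "integrable lborel (indicator {0..\<rho>} :: real \<Rightarrow> real)"
      by (rule integrable_indicator_Icc)
    then have "integrable lborel (\<lambda>u. fejer T 0 * indicator {0..\<rho>} u)" by simp
    then show ?thesis unfolding set_integrable_def
      by (rule Bochner_Integration.integrable_bound)
        (use fejer_le_tri[OF T] fejer_nonneg[OF T, of 0] in \<open>auto simp: indicator_def\<close>)
  qed
  ultimately have li: "(LINT u:{0..\<rho>}|lborel. fejer T u) = ?F \<rho> - ?F 0"
    using set_borel_integral_eq_integral(2)[OF si] by (simp add: integral_unique)
  have "Si 0 = 0" using Si_neg[of 0] by simp
  then have F0: "?F 0 = 0" by simp
  have fm: "fejer_mass (T * \<rho>) / 2 = 1 / pi * (Si (T * \<rho>) - (1 - cos (T * \<rho>)) / (T * \<rho>))"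
  proof -
    have "2 / pi * X / 2 = 1 / pi * X" for X :: real by simp
    then show ?thesis unfolding fejer_mass_def .
  qed
  show ?thesis using li unfolding F0 fm set_lebesgue_integral_def real_scaleR_def diff_zero .
qed

lemma integrable_fejer_Icc:
  assumes T: "T > 0" shows "integrable lborel (\<lambda>u. indicator {a..b} u * fejer T u)"
proof -
  have "integrable lborel (indicator {a..b} :: real \<Rightarrow> real)"
    by (rule integrable_indicator_Icc)
  then have "integrable lborel (\<lambda>u. fejer T 0 * indicator {a..b} u)" by simp
  then show ?thesis
    by (rule Bochner_Integration.integrable_bound)
      (use fejer_le_tri[OF T] fejer_nonneg[OF T, of 0] in \<open>auto simp: indicator_def\<close>)
qed

lemma integral_fejer_symmetric:
  assumes T: "T > 0" and \<rho>: "\<rho> > 0"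
  shows "(\<integral>u. indicator {-\<rho>..\<rho>} u * fejer T u \<partial>lborel) = fejer_mass (T * \<rho>)"
proof -
  have "(\<integral>u. indicator {-\<rho>..\<rho>} u * fejer T u \<partial>lborel)
      = (\<integral>u. indicator {0..\<rho>} u * fejer T u + indicator {-\<rho>..0} u * fejer T u \<partial>lborel)"
  proof (rule integral_cong_AE)
    have "AE t in lborel. t \<noteq> (0::real)" by (rule AE_lborel_singleton)
    then show "AE u in lborel. indicator {-\<rho>..\<rho>} u * fejer T u = indicator {0..\<rho>} u * fejer T u + indicator {-\<rho>..0} u * fejer T u"
      using \<rho> by (auto simp: indicator_def)
  qed measurable
  also have "\<dots> = (\<integral>u. indicator {0..\<rho>} u * fejer T u \<partial>lborel) + (\<integral>u. indicator {-\<rho>..0} u * fejer T u \<partial>lborel)"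
    by (rule Bochner_Integration.integral_add; rule integrable_fejer_Icc[OF T])
  also have "(\<integral>u. indicator {-\<rho>..0} u * fejer T u \<partial>lborel) = (\<integral>u. indicator {-\<rho>..0} (-u) * fejer T (-u) \<partial>lborel)"
    using lborel_integral_real_affine[of "-1" "\<lambda>u. indicator {-\<rho>..0} u * fejer T u" 0] by simp
  also have "(\<lambda>u. indicator {-\<rho>..0} (-u) * fejer T (-u)) = (\<lambda>u. indicator {0..\<rho>} u * fejer T u)"
    by (auto simp: fun_eq_iff indicator_def fejer_uminus)
  finally show ?thesis using integral_fejer_half[OF assms] by simp
qed

lemma fejer_mass_tendsto: "(fejer_mass \<longlongrightarrow> 1) at_top"
proof -
  have "((\<lambda>x::real. (1 - cos x) / x) \<longlongrightarrow> 0) at_top" by real_asymp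
  then have "((\<lambda>x. 2 / pi * (Si x - (1 - cos x) / x)) \<longlongrightarrow> 2 / pi * (pi / 2 - 0)) at_top"
    by (intro tendsto_intros Si_at_top)
  then show ?thesis by (simp add: fejer_mass_def[abs_def])
qed

text \<open>By positivity of the kernel the mass grows with the interval, and its limit is
  1.\<close>

lemma fejer_mass_le_1: assumes x: "x > 0" shows "fejer_mass x \<le> 1"
proof (rule tendsto_lowerbound[OF fejer_mass_tendsto])
  show "\<forall>\<^sub>F y in at_top. fejer_mass x \<le> fejer_mass y"
    using eventually_ge_at_top[of x]
  proof eventually_elim
    case (elim y)
    have "(\<integral>u. indicator {-x..x} u * fejer 1 u \<partial>lborel) \<le> (\<integral>u. indicator {-y..y} u * fejer 1 u \<partial>lborel)"
      using elim fejer_nonneg[of 1] by (intro integral_mono integrable_fejer_Icc) (auto simp: indicator_def)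
    then show ?case using integral_fejer_symmetric[of 1 x] integral_fejer_symmetric[of 1 y] x elim by simp
  qed
qed simp

section \<open>Indicators of intervals smoothed by the Fejer kernel\<close>

definition fejer_conv :: "real \<Rightarrow> real \<Rightarrow> real \<Rightarrow> real \<Rightarrow> real" where
  "fejer_conv T a b z = (\<integral>u. indicator {a..b} u * fejer T (z - u) \<partial>lborel)"

lemma fejer_conv_eq: "fejer_conv T a b z = (\<integral>u. indicator {z - b..z - a} u * fejer T u \<partial>lborel)"
proof -
  have "(\<integral>u. indicator {z - b..z - a} u * fejer T u \<partial>lborel) = (\<integral>u. indicator {z - b..z - a} (z - u) * fejer T (z - u) \<partial>lborel)"
    using lborel_integral_real_affine[of "-1" "\<lambda>u. indicator {z - b..z - a} u * fejer T u" z] by simp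
  also have "(\<lambda>u. indicator {z - b..z - a} (z - u) * fejer T (z - u)) = (\<lambda>u. indicator {a..b} u * fejer T (z - u))"
    by (auto simp: fun_eq_iff indicator_def)
  finally show ?thesis by (simp add: fejer_conv_def)
qed

lemma fejer_conv_nonneg: "T > 0 \<Longrightarrow> 0 \<le> fejer_conv T a b z"
  unfolding fejer_conv_def using fejer_nonneg by (intro integral_nonneg_AE) auto

lemma fejer_conv_le_1: assumes T: "T > 0" shows "fejer_conv T a b z \<le> 1"
proof -
  define R where "R = \<bar>z - a\<bar> + \<bar>z - b\<bar> + 1"
  have "fejer_conv T a b z \<le> (\<integral>u. indicator {-R..R} u * fejer T u \<partial>lborel)"
    unfolding fejer_conv_eq using fejer_nonneg[OF T]
    by (intro integral_mono integrable_fejer_Icc T) (auto simp: indicator_def R_def)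
  also have "\<dots> = fejer_mass (T * R)" by (rule integral_fejer_symmetric) (auto simp: T R_def)
  also have "\<dots> \<le> 1" using T by (intro fejer_mass_le_1) (auto simp: R_def)
  finally show ?thesis .
qed

lemma fejer_conv_ge:
  assumes T: "T > 0" and \<rho>: "\<rho> > 0" and z: "a + \<rho> \<le> z" "z \<le> b - \<rho>"
  shows "fejer_mass (T * \<rho>) \<le> fejer_conv T a b z"
  unfolding fejer_conv_eq integral_fejer_symmetric[OF T \<rho>, symmetric] using fejer_nonneg[OF T] z
  by (intro integral_mono integrable_fejer_Icc T) (auto simp: indicator_def)

lemma fejer_conv_measurable [measurable]: "fejer_conv T a b \<in> borel_measurable borel"
proof -
  have "(\<lambda>z. \<integral>u. indicator {a..b} u * fejer T (z - u) \<partial>lborel) \<in> borel_measurable borel"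
    by (rule sigma_finite_measure.borel_measurable_lebesgue_integral[OF sigma_finite_lborel]) measurable
  then show ?thesis unfolding fejer_conv_def[abs_def] .
qed

lemma fejer_conv_bdd_borel: "T > 0 \<Longrightarrow> fejer_conv T a b \<in> bdd_borel"
  using fejer_conv_nonneg[of T a b] fejer_conv_le_1[of T a b]
  by (intro bdd_borelI[of _ 1]) (auto simp: abs_of_nonneg)

text \<open>Outside [0, d) the distance to the smoothed interval is at least \<rho>, so the kernel
  is O(1 / (T * (1 + z^2))). The bound is phrased with \<open>fejer 1\<close> so that the leak is
  dominated by functions whose Fourier transform has compact support as well; the factor 1 / T makes
  it small.\<close>

lemma fejer_conv_outside:
  assumes T: "T > 0" and \<rho>: "0 < \<rho>" "2 * \<rho> < d" and z: "z \<notin> {0..<d}"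
  shows "fejer_conv T \<rho> (d - \<rho>) z \<le> d * (2 * (2 + (1 + 2 * d\<^sup>2) / \<rho>\<^sup>2) * pi\<^sup>2 / T) * (fejer 1 z + fejer 1 (z + pi))"
proof -
  \<comment> \<open>Chosen for 1 + z^2 <= K * (z - u)^2: z^2 <= 2 * (z - u)^2 + 2 * u^2, and (z -
    u)^2 >= \<rho>^2 absorbs the constant 1 + 2 * d^2.\<close>
  define K where "K = 2 + (1 + 2 * d\<^sup>2) / \<rho>\<^sup>2"
  have K: "K > 0" unfolding K_def using \<rho> by (intro add_pos_nonneg) auto
  let ?E = "fejer 1 z + fejer 1 (z + pi)"
  let ?B = "2 * K * pi\<^sup>2 / T * ?E"
  have pt: "indicator {\<rho>..d - \<rho>} u * fejer T (z - u) \<le> ?B * indicator {\<rho>..d - \<rho>} u" for u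
  proof (cases "u \<in> {\<rho>..d - \<rho>}")
    case True
    then have "\<rho> \<le> \<bar>z - u\<bar>" "\<bar>u\<bar> \<le> d" using z \<rho> by auto
    then have s1: "\<rho>\<^sup>2 \<le> (z - u)\<^sup>2" and s2: "u\<^sup>2 \<le> d\<^sup>2" using \<rho> by (auto simp: abs_le_square_iff[symmetric])
    have nz: "z - u \<noteq> 0" using \<open>\<rho> \<le> \<bar>z - u\<bar>\<close> \<rho> by auto
    have "1 + z\<^sup>2 \<le> (1 + 2 * d\<^sup>2) + 2 * (z - u)\<^sup>2"
      using s2 zero_le_power2[of "z - 2 * u"] by (simp add: power2_eq_square algebra_simps)
    also have "1 + 2 * d\<^sup>2 \<le> (1 + 2 * d\<^sup>2) / \<rho>\<^sup>2 * (z - u)\<^sup>2"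
    proof -
      have "(1 + 2 * d\<^sup>2) / \<rho>\<^sup>2 * \<rho>\<^sup>2 \<le> (1 + 2 * d\<^sup>2) / \<rho>\<^sup>2 * (z - u)\<^sup>2"
        using s1 by (intro mult_left_mono) auto
      then show ?thesis using \<rho> by simp
    qed
    finally have zK: "1 + z\<^sup>2 \<le> K * (z - u)\<^sup>2" by (simp add: K_def algebra_simps)
    have "fejer T (z - u) \<le> 2 / (pi * T * (z - u)\<^sup>2)" by (rule fejer_le[OF T nz])
    also have "\<dots> \<le> 2 * K / (pi * T * (1 + z\<^sup>2))"
    proof -
      have "2 / (pi * T * (z - u)\<^sup>2) = 2 * K / (pi * T * (K * (z - u)\<^sup>2))" using K by simp
      also have "\<dots> \<le> 2 * K / (pi * T * (1 + z\<^sup>2))"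
        using zK K T nz by (intro divide_left_mono mult_left_mono mult_pos_pos) (auto simp: add_pos_nonneg)
      finally show ?thesis .
    qed
    also have "\<dots> = 2 * K * pi\<^sup>2 / T * (1 / (pi ^ 3 * (1 + z\<^sup>2)))"
      by (simp add: power2_eq_square power3_eq_cube)
    also have "\<dots> \<le> ?B"
      using fejer_sum_ge[of z] K T by (intro mult_left_mono) auto
    finally show ?thesis using True by simp
  qed simp
  have B: "?B \<ge> 0" using fejer_nonneg[of 1 z] fejer_nonneg[of 1 "z + pi"] K T by simp
  have "fejer_conv T \<rho> (d - \<rho>) z \<le> (\<integral>u. ?B * indicator {\<rho>..d - \<rho>} u \<partial>lborel)"
    unfolding fejer_conv_def
  proof (rule integral_mono)
    have "integrable lborel (indicator {\<rho>..d - \<rho>} :: real \<Rightarrow> real)"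
      by (rule integrable_indicator_Icc)
    then show i: "integrable lborel (\<lambda>u. ?B * indicator {\<rho>..d - \<rho>} u)" by (rule integrable_mult_right)
    show "integrable lborel (\<lambda>u. indicator {\<rho>..d - \<rho>} u * fejer T (z - u))"
    proof (rule Bochner_Integration.integrable_bound[OF i])
      show "AE u in lborel. norm (indicator {\<rho>..d - \<rho>} u * fejer T (z - u)) \<le> norm (?B * indicator {\<rho>..d - \<rho>} u)"
      proof (intro AE_I2)
        fix u
        have "norm (indicator {\<rho>..d - \<rho>} u * fejer T (z - u)) = indicator {\<rho>..d - \<rho>} u * fejer T (z - u)"
          using fejer_nonneg[OF T] by simp
        also have "\<dots> \<le> ?B * indicator {\<rho>..d - \<rho>} u" by (rule pt)
        also have "\<dots> \<le> norm (?B * indicator {\<rho>..d - \<rho>} u)" by (simp only: real_norm_def abs_ge_self)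
        finally show "norm (indicator {\<rho>..d - \<rho>} u * fejer T (z - u)) \<le> norm (?B * indicator {\<rho>..d - \<rho>} u)" .
      qed
    qed measurable
  qed (rule pt)
  also have "\<dots> = ?B * (d - 2 * \<rho>)" using \<rho> by simp
  also have "\<dots> \<le> ?B * d" using B \<rho> by (intro mult_left_mono) auto
  finally show ?thesis by (simp add: K_def algebra_simps)
qed

context real_distribution
begin

lemma free_pow_fejer_conv:
  assumes T: "T > 0"
  shows "(free_step M ^^ m) (fejer_conv T a b) z = (\<integral>u. indicator {a..b} u * (free_step M ^^ m) (fejer T) (z - u) \<partial>lborel)"
proof (induction m arbitrary: z)
  case 0 then show ?case by (simp add: fejer_conv_def)
next
  case (Suc m)
  let ?P = "(free_step M ^^ m) (fejer T)"
  have Pb: "?P \<in> bdd_borel" by (intro free_pow_bdd_borel fejer_bdd_borel T)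
  then obtain B where B: "\<And>z. \<bar>?P z\<bar> \<le> B" "B \<ge> 0" by (rule bdd_borelE) auto
  have [measurable]: "?P \<in> borel_measurable borel" using Pb by (rule bdd_borel_measurable)
  have "integrable lborel (indicator {a..b} :: real \<Rightarrow> real)"
    by (rule integrable_indicator_Icc)
  then have w: "integrable lborel (\<lambda>u. B * indicator {a..b} u)" by simp
  have "(free_step M ^^ Suc m) (fejer_conv T a b) z = (\<integral>s. (\<integral>u. indicator {a..b} u * ?P (z + s - u) \<partial>lborel) \<partial>M)"
    unfolding free_pow_Suc Suc ..
  also have "\<dots> = (\<integral>u. (\<integral>s. indicator {a..b} u * ?P (z + s - u) \<partial>M) \<partial>lborel)"
    by (rule Fubini_dominated[OF _ w]) (use B in \<open>auto simp: indicator_def\<close>)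
  also have "(\<lambda>u. \<integral>s. indicator {a..b} u * ?P (z + s - u) \<partial>M) = (\<lambda>u. indicator {a..b} u * (free_step M ^^ Suc m) (fejer T) (z - u))"
    unfolding free_pow_Suc by (simp add: algebra_simps)
  finally show ?case .
qed

text \<open>Turns an iterate back into a distribution, so that \<open>interval_tail\<close> can put
  two independent parts of the walk on a product space and treat them differently.\<close>

lemma ex_pow_law:
  "\<exists>\<nu>. real_distribution \<nu> \<and> (\<forall>g\<in>bdd_borel. \<forall>z. (free_step M ^^ m) g z = (\<integral>s. g (z + s) \<partial>\<nu>))"
proof (induction m)
  case 0
  have "real_distribution (return borel (0::real))"
    by (simp add: real_distribution_def real_distribution_axioms_def prob_space_return)
  moreover have "(\<integral>s. g (z + s) \<partial>return borel 0) = g z" if "g \<in> bdd_borel" for g :: "real \<Rightarrow> real" and z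
    using bdd_borel_measurable[OF that] by (subst integral_return) auto
  ultimately show ?case by auto
next
  case (Suc m)
  then obtain \<nu> where \<nu>: "real_distribution \<nu>" "\<And>g z. g \<in> bdd_borel \<Longrightarrow> (free_step M ^^ m) g z = (\<integral>s. g (z + s) \<partial>\<nu>)"
    by blast
  interpret N: real_distribution \<nu> by fact
  interpret MN: pair_prob_space M \<nu> ..
  let ?\<nu> = "distr (M \<Otimes>\<^sub>M \<nu>) borel (\<lambda>(s, t). s + t)"
  have mm: "(\<lambda>(s, t). s + t) \<in> borel_measurable (M \<Otimes>\<^sub>M \<nu>)" by measurable
  have "real_distribution ?\<nu>" using mm by (rule MN.real_distribution_distr)
  moreover have "(free_step M ^^ Suc m) g z = (\<integral>s. g (z + s) \<partial>?\<nu>)" if g: "g \<in> bdd_borel" for g z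
  proof -
    obtain B where B: "\<And>z. \<bar>g z\<bar> \<le> B" "B \<ge> 0" using g by (rule bdd_borelE) auto
    have [measurable]: "g \<in> borel_measurable borel" using g by (rule bdd_borel_measurable)
    have "(\<integral>s. g (z + s) \<partial>?\<nu>) = (\<integral>p. g (z + (fst p + snd p)) \<partial>(M \<Otimes>\<^sub>M \<nu>))"
      using mm by (subst integral_distr) (auto simp: split_beta')
    also have "\<dots> = (\<integral>s. (\<integral>t. g (z + (s + t)) \<partial>\<nu>) \<partial>M)"
      using B by (subst MN.integral_fst'[symmetric]) (auto intro!: MN.integrable_const_bound[of _ B])
    finally show ?thesis unfolding free_pow_Suc \<nu>(2)[OF g] by (simp add: algebra_simps)
  qed
  ultimately show ?case by blast
qed

end

context centred_law
begin

text \<open>The quadratic majorant propagates exactly: a centred step adds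
  \<open>\<sigma>\<^sup>2\<close> to the second moment.\<close>

lemma free_pow_Chebyshev:
  assumes "g \<in> bdd_borel" "r > 0" "\<And>w. g w \<le> w\<^sup>2 / r\<^sup>2"
  shows "(free_step M ^^ m) g z \<le> (z\<^sup>2 + real m * \<sigma>\<^sup>2) / r\<^sup>2"
proof (induction m arbitrary: z)
  case (Suc m)
  have si: "integrable M (\<lambda>t. (z + t)\<^sup>2)"
    using mean_integrable sq_integrable by (simp add: power2_sum)
  have "(\<integral>t. (free_step M ^^ m) g (z + t) \<partial>M) \<le> (\<integral>t. ((z + t)\<^sup>2 + real m * \<sigma>\<^sup>2) / r\<^sup>2 \<partial>M)"
  proof (rule integral_mono)
    show "integrable M (\<lambda>t. (free_step M ^^ m) g (z + t))"
      by (intro integrable_shift free_pow_bdd_borel assms)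
    show "integrable M (\<lambda>t. ((z + t)\<^sup>2 + real m * \<sigma>\<^sup>2) / r\<^sup>2)" using si by simp
  qed (rule Suc.IH)
  also have "\<dots> = ((\<integral>t. (z + t)\<^sup>2 \<partial>M) + real m * \<sigma>\<^sup>2) / r\<^sup>2"
    using si by simp
  also have "(\<integral>t. (z + t)\<^sup>2 \<partial>M) = z\<^sup>2 + \<sigma>\<^sup>2"
    using mean_integrable sq_integrable mean_zero sq_mean by (simp add: power2_sum)
  finally show ?case unfolding free_pow_Suc by (simp add: algebra_simps)
qed (use assms in auto)

end

section \<open>Stone's local limit theorem for intervals, with concentration and decay
  bounds\<close>

context nonlattice_law
begin

lemma heat_sigma_le: "heat (\<sigma>\<^sup>2) z \<le> 1 / \<sigma>"
  using heat_le[of "\<sigma>\<^sup>2" z] sigma_pos by simp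

lemma heat_sigma_nonneg: "0 \<le> heat (\<sigma>\<^sup>2) z"
  by simp

text \<open>\<open>fejer_local_limit\<close> integrated over shifts u in [a, b]; on the scale sqrt m
  such shifts move the heat kernel by O(1 / sqrt m).\<close>

lemma fejer_conv_local_limit:
  assumes T: "T > 0" and ab: "a \<le> b" and \<kappa>: "\<kappa> > 0"
  shows "\<forall>\<^sub>F m in sequentially. \<forall>z. \<bar>sqrt (real m) * (free_step M ^^ m) (fejer_conv T a b) z
            - (b - a) * heat (\<sigma>\<^sup>2) (z / sqrt (real m))\<bar> \<le> \<kappa>"
proof -
  define \<epsilon> where "\<epsilon> = \<kappa> / (2 * (b - a + 1))"
  have \<epsilon>: "\<epsilon> > 0" "2 * (b - a) * \<epsilon> \<le> \<kappa>" using ab \<kappa> by (auto simp: \<epsilon>_def divide_simps mult_left_mono)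
  define c where "c = \<bar>a\<bar> + \<bar>b\<bar>"
  have "((\<lambda>m. c / \<sigma>\<^sup>2 * (1 / sqrt (real m))) \<longlongrightarrow> 0) sequentially"
    by (intro tendsto_mult_right_zero) real_asymp
  then have "((\<lambda>m. c / sqrt (real m) / \<sigma>\<^sup>2) \<longlongrightarrow> 0) sequentially" by (simp add: mult.commute)
  then have ev: "\<forall>\<^sub>F m in sequentially. c / sqrt (real m) / \<sigma>\<^sup>2 < \<epsilon>" using \<epsilon>(1) by (rule order_tendstoD(2))
  show ?thesis
    using ev fejer_local_limit[OF T \<epsilon>(1)] eventually_gt_at_top[of 0]
  proof eventually_elim
    case (elim m)
    show ?case
    proof
      fix z
      let ?P = "\<lambda>z. sqrt (real m) * (free_step M ^^ m) (fejer T) z" and ?h = "heat (\<sigma>\<^sup>2) (z / sqrt (real m))"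
      have sm: "sqrt (real m) > 0" using elim by simp
      have Pb: "?P \<in> bdd_borel" by (intro bdd_borel_cmult free_pow_bdd_borel fejer_bdd_borel T)
      have [measurable]: "(free_step M ^^ m) (fejer T) \<in> borel_measurable borel"
        by (intro bdd_borel_measurable free_pow_bdd_borel fejer_bdd_borel T)
      obtain B where B: "\<And>z. \<bar>?P z\<bar> \<le> B" "B \<ge> 0" using Pb by (rule bdd_borelE) auto
      have ind: "integrable lborel (indicator {a..b} :: real \<Rightarrow> real)"
        by (rule integrable_indicator_Icc)
      then have "integrable lborel (\<lambda>u. B * indicator {a..b} u)" by simp
      then have i1: "integrable lborel (\<lambda>u. indicator {a..b} u * ?P (z - u))"
        by (rule Bochner_Integration.integrable_bound) (use B in \<open>auto simp: indicator_def\<close>)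
      have i2: "integrable lborel (\<lambda>u. ?h * indicator {a..b} u)" using ind by simp
      have i3: "integrable lborel (\<lambda>u. 2 * \<epsilon> * indicator {a..b} u)" using ind by simp
      have pt: "\<bar>indicator {a..b} u * ?P (z - u) - ?h * indicator {a..b} u\<bar> \<le> 2 * \<epsilon> * indicator {a..b} u" for u
      proof (cases "u \<in> {a..b}")
        case True
        have "\<bar>heat (\<sigma>\<^sup>2) ((z - u) / sqrt (real m)) - ?h\<bar> \<le> \<bar>(z - u) / sqrt (real m) - z / sqrt (real m)\<bar> / \<sigma>\<^sup>2"
          using sigma_pos by (intro heat_Lipschitz) auto
        also have "\<dots> = \<bar>u\<bar> / sqrt (real m) / \<sigma>\<^sup>2"
          by (simp add: diff_divide_distrib[symmetric])
        also have "\<dots> \<le> c / sqrt (real m) / \<sigma>\<^sup>2"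
          using True by (intro divide_right_mono) (auto simp: c_def)
        finally have "\<bar>heat (\<sigma>\<^sup>2) ((z - u) / sqrt (real m)) - ?h\<bar> \<le> \<epsilon>" using elim by linarith
        moreover have "\<bar>?P (z - u) - heat (\<sigma>\<^sup>2) ((z - u) / sqrt (real m))\<bar> \<le> \<epsilon>" using elim by blast
        ultimately show ?thesis using True by simp
      qed simp
      have e1: "sqrt (real m) * (free_step M ^^ m) (fejer_conv T a b) z = (\<integral>u. indicator {a..b} u * ?P (z - u) \<partial>lborel)"
        unfolding free_pow_fejer_conv[OF T] by (simp add: mult.left_commute)
      have e2: "(\<integral>u. ?h * indicator {a..b} u \<partial>lborel) = (b - a) * ?h" using ab by simp
      have e3: "\<bar>(\<integral>u. indicator {a..b} u * ?P (z - u) - ?h * indicator {a..b} u \<partial>lborel)\<bar> \<le> (\<integral>u. 2 * \<epsilon> * indicator {a..b} u \<partial>lborel)"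
        using pt i1 i2 i3 by (intro order_trans[OF integral_abs_bound] integral_mono integrable_abs Bochner_Integration.integrable_diff) auto
      have e4: "(\<integral>u. 2 * \<epsilon> * indicator {a..b} u \<partial>lborel) = 2 * (b - a) * \<epsilon>" using ab by simp
      show "\<bar>sqrt (real m) * (free_step M ^^ m) (fejer_conv T a b) z - (b - a) * ?h\<bar> \<le> \<kappa>"
        using e3 \<epsilon>(2) unfolding Bochner_Integration.integral_diff[OF i1 i2] e1 e2 e4 by (rule order_trans)
    qed
  qed
qed

text \<open>The indicator is sandwiched between functions with compactly supported Fourier
  transform. Above, the smoothed enlarged interval divided by \<open>G\<close> serves. Below, the
  smoothed shrunken interval leaks out of [0, d); a small multiple of two Fejer kernels absorbs the
  leak, and their own means are O(1 / sqrt m) by \<open>fejer_local_limit\<close>.\<close>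

lemma interval_local_limit:
  assumes d: "d > 0" and \<epsilon>: "\<epsilon> > 0"
  shows "\<forall>\<^sub>F m in sequentially. \<forall>z. \<bar>sqrt (real m) * (free_step M ^^ m) (indicator {0..<d}) z
            - d * heat (\<sigma>\<^sup>2) (z / sqrt (real m))\<bar> \<le> \<epsilon>"
proof -
  \<comment> \<open>Enlarging or shrinking and normalising change the length by at most 4 * \<rho>,
    which costs at most \<epsilon> / 4 because the heat kernel is at most 1 / \<sigma>.\<close>
  define \<rho> where "\<rho> = min (d / 4) (\<epsilon> * \<sigma> / 16)"
  have \<rho>: "\<rho> > 0" "2 * \<rho> < d" "4 * \<rho> / \<sigma> \<le> \<epsilon> / 4" using d \<epsilon> sigma_pos by (auto simp: \<rho>_def field_simps)
  define C where "C = d * (2 * (2 + (1 + 2 * d\<^sup>2) / \<rho>\<^sup>2) * pi\<^sup>2)"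
  have C: "C > 0" unfolding C_def using d \<rho> by (intro mult_pos_pos add_pos_nonneg) auto
  define \<kappa> where "\<kappa> = \<epsilon> / 8"
  have \<kappa>: "\<kappa> > 0" using \<epsilon> by (simp add: \<kappa>_def)
  \<comment> \<open>The threshold lies below 1, the limit of the mass, and is what (d + 2 * \<rho>)
    / G <= d + 4 * \<rho> asks for.\<close>
  have "\<forall>\<^sub>F T in at_top. fejer_mass (T * \<rho>) > (d + 2 * \<rho>) / (d + 4 * \<rho>)"
  proof -
    have "filterlim (\<lambda>T. T * \<rho>) at_top at_top" using \<rho> by (intro filterlim_at_top_mult_tendsto_pos[OF tendsto_const]) (auto simp: filterlim_ident)
    then have "((\<lambda>T. fejer_mass (T * \<rho>)) \<longlongrightarrow> 1) at_top" by (rule filterlim_compose[OF fejer_mass_tendsto])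
    then show ?thesis using \<rho> d by (rule_tac order_tendstoD(1)) auto
  qed
  moreover have "\<forall>\<^sub>F T in at_top. C / T * (2 * (1 / \<sigma> + \<kappa>)) < \<epsilon> / 2"
  proof -
    have "((\<lambda>T. C / T * (2 * (1 / \<sigma> + \<kappa>))) \<longlongrightarrow> 0) at_top" by real_asymp
    then show ?thesis using \<epsilon> by (rule_tac order_tendstoD(2)) auto
  qed
  ultimately have "\<forall>\<^sub>F T in at_top. fejer_mass (T * \<rho>) > (d + 2 * \<rho>) / (d + 4 * \<rho>) \<and> C / T * (2 * (1 / \<sigma> + \<kappa>)) < \<epsilon> / 2 \<and> T > 0"
    using eventually_gt_at_top[of 0] by eventually_elim auto
  then obtain T where T: "fejer_mass (T * \<rho>) > (d + 2 * \<rho>) / (d + 4 * \<rho>)" "C / T * (2 * (1 / \<sigma> + \<kappa>)) < \<epsilon> / 2" "T > 0"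
    by (auto simp: eventually_at_top_linorder)
  define G where "G = fejer_mass (T * \<rho>)"
  have G: "G > 0" "(d + 2 * \<rho>) / G \<le> d + 4 * \<rho>" "1 / G \<le> 2"
  proof -
    have p: "(d + 2 * \<rho>) / (d + 4 * \<rho>) > 0" using d \<rho> by simp
    show G0: "G > 0" using T(1) p by (simp add: G_def)
    show "(d + 2 * \<rho>) / G \<le> d + 4 * \<rho>" using T(1) G0 d \<rho> by (simp add: G_def[symmetric] field_simps)
    have "1 / 2 \<le> (d + 2 * \<rho>) / (d + 4 * \<rho>)" using d \<rho> by (simp add: field_simps)
    then have "1 / 2 \<le> G" using T(1) unfolding G_def by linarith
    then show "1 / G \<le> 2" using G0 by (simp add: field_simps)
  qed
  let ?I = "indicator {0..<d} :: real \<Rightarrow> real"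
  let ?U = "fejer_conv T (- \<rho>) (d + \<rho>)" and ?L = "fejer_conv T \<rho> (d - \<rho>)"
  have Ib: "?I \<in> bdd_borel" by auto
  have up: "?I z \<le> 1 / G * ?U z" for z
  proof (cases "z \<in> {0..<d}")
    case True
    then have "G \<le> ?U z" unfolding G_def using \<rho> T by (intro fejer_conv_ge) auto
    then show ?thesis using True G by (simp add: field_simps)
  next
    case False
    then show ?thesis using fejer_conv_nonneg[of T "- \<rho>" "d + \<rho>" z] G T by simp
  qed
  have low: "?L z \<le> ?I z + C / T * (fejer 1 z + fejer 1 (z + pi))" for z
  proof (cases "z \<in> {0..<d}")
    case True
    have "0 \<le> C / T * (fejer 1 z + fejer 1 (z + pi))" using fejer_nonneg C T by simp
    then show ?thesis using fejer_conv_le_1[OF T(3), of \<rho> "d - \<rho>" z] True by simp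
  next
    case False
    then show ?thesis using fejer_conv_outside[OF T(3) \<rho>(1,2) False] by (simp add: C_def)
  qed
  have f1b: "fejer 1 \<in> bdd_borel" "(\<lambda>z. fejer 1 (z + pi)) \<in> bdd_borel"
    using fejer_bdd_borel[of 1] bdd_borel_shift by auto
  have ab: "- \<rho> \<le> d + \<rho>" "\<rho> \<le> d - \<rho>" using \<rho> d by auto
  show ?thesis
    using fejer_conv_local_limit[OF T(3) ab(1) \<kappa>] fejer_conv_local_limit[OF T(3) ab(2) \<kappa>]
      fejer_local_limit[OF zero_less_one \<kappa>] eventually_gt_at_top[of 0]
  proof eventually_elim
    case (elim m)
    show ?case
    proof
      fix z
      let ?P = "\<lambda>g z. (free_step M ^^ m) g z" and ?s = "sqrt (real m)" and ?h = "heat (\<sigma>\<^sup>2) (z / sqrt (real m))"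
      have s: "?s > 0" using elim by simp
      have h: "0 \<le> ?h" "?h \<le> 1 / \<sigma>" using heat_sigma_nonneg heat_sigma_le by auto
      have rh: "4 * \<rho> * ?h \<le> \<epsilon> / 4"
      proof -
        have "4 * \<rho> * ?h \<le> 4 * \<rho> * (1 / \<sigma>)" using h \<rho> by (intro mult_left_mono) auto
        then show ?thesis using \<rho>(3) by simp
      qed
      have "?P ?I z \<le> ?P (\<lambda>z. 1 / G * ?U z) z"
        by (intro free_pow_mono Ib bdd_borel_cmult fejer_conv_bdd_borel T up)
      also have "\<dots> = 1 / G * ?P ?U z"
        by (intro free_pow_cmult fejer_conv_bdd_borel T)
      finally have "?s * ?P ?I z \<le> ?s * (1 / G * ?P ?U z)" using s by (intro mult_left_mono) auto
      also have "\<dots> = 1 / G * (?s * ?P ?U z)" by simp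
      also have "\<dots> \<le> 1 / G * ((d + \<rho> - - \<rho>) * ?h + \<kappa>)"
        using elim(1)[rule_format, of z] G by (intro mult_left_mono) auto
      also have "\<dots> = (d + 2 * \<rho>) / G * ?h + 1 / G * \<kappa>" by (simp add: field_simps add_divide_distrib)
      also have "\<dots> \<le> (d + 4 * \<rho>) * ?h + 2 * \<kappa>"
        using G h \<kappa> by (intro add_mono mult_right_mono) auto
      finally have U: "?s * ?P ?I z \<le> d * ?h + \<epsilon>"
        using rh \<epsilon> by (simp add: \<kappa>_def distrib_right)
      have "?P ?L z \<le> ?P (\<lambda>z. 1 * ?I z + C / T * (1 * fejer 1 z + 1 * fejer 1 (z + pi))) z"
        using low by (intro free_pow_mono bdd_borel_add bdd_borel_cmult fejer_conv_bdd_borel Ib f1b T) simp_all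
      also have "\<dots> = 1 * ?P ?I z + C / T * ?P (\<lambda>z. 1 * fejer 1 z + 1 * fejer 1 (z + pi)) z"
        by (intro free_pow_linear bdd_borel_add bdd_borel_cmult Ib f1b)
      also have "?P (\<lambda>z. 1 * fejer 1 z + 1 * fejer 1 (z + pi)) z = 1 * ?P (fejer 1) z + 1 * ?P (\<lambda>z. fejer 1 (z + pi)) z"
        by (intro free_pow_linear f1b)
      also have "?P (\<lambda>z. fejer 1 (z + pi)) z = ?P (fejer 1) (z + pi)" by (rule free_pow_shift)
      finally have "?s * ?P ?L z \<le> ?s * (?P ?I z + C / T * (?P (fejer 1) z + ?P (fejer 1) (z + pi)))"
        using s by (intro mult_left_mono) auto
      also have "\<dots> = ?s * ?P ?I z + C / T * (?s * ?P (fejer 1) z + ?s * ?P (fejer 1) (z + pi))"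
        by (simp add: algebra_simps)
      also have "\<dots> \<le> ?s * ?P ?I z + C / T * ((1 / \<sigma> + \<kappa>) + (1 / \<sigma> + \<kappa>))"
      proof -
        have "?s * ?P (fejer 1) w \<le> 1 / \<sigma> + \<kappa>" for w
          using elim(3)[rule_format, of w] heat_sigma_le[of "w / ?s"] by linarith
        then show ?thesis using C T by (intro add_left_mono mult_left_mono add_mono) auto
      qed
      finally have "?s * ?P ?L z \<le> ?s * ?P ?I z + \<epsilon> / 2" using T(2) unfolding mult_2 by linarith
      then have "(d - \<rho> - \<rho>) * ?h - \<kappa> \<le> ?s * ?P ?I z + \<epsilon> / 2"
        using elim(2)[rule_format, of z] by linarith
      moreover have "(d - \<rho> - \<rho>) * ?h = d * ?h - 2 * \<rho> * ?h" by (simp add: algebra_simps)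
      ultimately have L: "d * ?h - \<epsilon> \<le> ?s * ?P ?I z"
        using rh \<epsilon> by (simp add: \<kappa>_def)
      show "\<bar>?s * ?P ?I z - d * ?h\<bar> \<le> \<epsilon>" using U L by (simp add: abs_le_iff)
    qed
  qed
qed

text \<open>The limit theorem for large m, the trivial bound 1 for the finitely many others.\<close>

lemma interval_concentration:
  assumes d: "d > 0"
  shows "\<exists>C\<ge>0. \<forall>m z. (free_step M ^^ m) (indicator {0..<d}) z \<le> C / sqrt (real m + 1)"
proof -
  let ?I = "indicator {0..<d} :: real \<Rightarrow> real"
  obtain m0 where m0: "\<And>m z. m \<ge> m0 \<Longrightarrow> \<bar>sqrt (real m) * (free_step M ^^ m) ?I z - d * heat (\<sigma>\<^sup>2) (z / sqrt (real m))\<bar> \<le> 1"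
    using interval_local_limit[OF d zero_less_one] by (auto simp: eventually_sequentially)
  define C where "C = 2 * (d / \<sigma> + 1) + sqrt (real m0 + 2)"
  have C0: "C \<ge> 0" using d sigma_pos by (simp add: C_def)
  have "(free_step M ^^ m) ?I z \<le> C / sqrt (real m + 1)" for m z
  proof (cases "m \<ge> m0 \<and> m \<ge> 1")
    case True
    have s: "sqrt (real m) > 0" using True by simp
    have "d * heat (\<sigma>\<^sup>2) (z / sqrt (real m)) \<le> d * (1 / \<sigma>)" using d heat_sigma_le by (intro mult_left_mono) auto
    then have "sqrt (real m) * (free_step M ^^ m) ?I z \<le> d / \<sigma> + 1"
      using m0[of m z] True by (simp add: abs_le_iff)
    then have "(free_step M ^^ m) ?I z \<le> (d / \<sigma> + 1) / sqrt (real m)"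
      using s by (simp add: field_simps)
    also have "\<dots> \<le> 2 * (d / \<sigma> + 1) / sqrt (real m + 1)"
    proof -
      have "sqrt (real m + 1) \<le> sqrt (4 * real m)" using True by (intro real_sqrt_le_mono) auto
      also have "\<dots> = 2 * sqrt (real m)" by (simp add: real_sqrt_mult)
      finally have *: "2 * (d / \<sigma> + 1) / (2 * sqrt (real m)) \<le> 2 * (d / \<sigma> + 1) / sqrt (real m + 1)"
        using d sigma_pos by (intro divide_left_mono) (auto intro!: mult_pos_pos s simp: True)
      have "(d / \<sigma> + 1) / sqrt (real m) = 2 * (d / \<sigma> + 1) / (2 * sqrt (real m))"
        by (rule mult_divide_mult_cancel_left[symmetric]) simp
      then show ?thesis using * by (simp only:)
    qed
    also have "\<dots> \<le> C / sqrt (real m + 1)" unfolding C_def by (intro divide_right_mono) auto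
    finally show ?thesis .
  next
    case False
    have "(free_step M ^^ m) ?I z \<le> 1" by (rule free_pow_le_const) (auto simp: indicator_def)
    also have "1 \<le> sqrt (real m0 + 2) / sqrt (real m + 1)" using False by (auto simp: le_divide_eq)
    also have "\<dots> \<le> C / sqrt (real m + 1)" unfolding C_def using d sigma_pos by (intro divide_right_mono) auto
    finally show ?thesis .
  qed
  then show ?thesis using C0 by blast
qed

text \<open>Splitting the walk into halves combines Chebyshev's inequality for one half with the
  concentration bound for the other.\<close>

lemma interval_tail:
  assumes d: "d > 0"
  shows "\<exists>C\<ge>0. \<forall>m v. v\<^sup>2 * (free_step M ^^ m) (indicator {0..<d}) v \<le> C * sqrt (real m + 1)"
proof -
  let ?I = "indicator {0..<d} :: real \<Rightarrow> real"
  obtain C where C: "C \<ge> 0" "\<And>m z. (free_step M ^^ m) ?I z \<le> C / sqrt (real m + 1)"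
    using interval_concentration[OF d] by blast
  define D where "D = 64 * C * \<sigma>\<^sup>2 + 4 * d\<^sup>2"
  have D: "D \<ge> 0" using C by (simp add: D_def)
  have Ib: "?I \<in> bdd_borel" by auto
  have "v\<^sup>2 * (free_step M ^^ m) ?I v \<le> D * sqrt (real m + 1)" for m v
  proof (cases "\<bar>v\<bar> < 2 * d")
    case True
    have "v\<^sup>2 \<le> (2 * d)\<^sup>2" using True d abs_le_square_iff[of v "2 * d"] by simp
    then have "v\<^sup>2 * (free_step M ^^ m) ?I v \<le> (2 * d)\<^sup>2 * 1"
      by (intro mult_mono free_pow_le_const free_pow_nonneg Ib) (auto simp: indicator_def)
    also have "\<dots> \<le> D" using C by (simp add: D_def power_mult_distrib)
    also have "\<dots> \<le> D * sqrt (real m + 1)" using D mult_left_mono[of 1 "sqrt (real m + 1)" D] by simp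
    finally show ?thesis .
  next
    case False
    \<comment> \<open>If v + s + t lies in [0, d) and |v| >= 2 * d, then |s + t| >= |v| / 2, so one
      of the two halves moves by at least |v| / 4.\<close>
    define r where "r = \<bar>v\<bar> / 4"
    have r: "r > 0" using False d by (simp add: r_def)
    define A where "A = {w. r \<le> \<bar>w\<bar>}"
    have Am: "A \<in> sets borel" unfolding A_def by measurable
    have [measurable]: "A \<in> sets borel" by fact
    have Ab: "(indicator A :: real \<Rightarrow> real) \<in> bdd_borel" using Am by auto
    define a b where "a = m div 2" and "b = m - a"
    have abm: "m = a + b" "real m + 1 \<le> 2 * (real a + 1)" "real m + 1 \<le> 2 * (real b + 1)" "a \<le> m" "b \<le> m"
      by (auto simp: a_def b_def)
    obtain \<nu>a where na: "real_distribution \<nu>a" "\<And>g z. g \<in> bdd_borel \<Longrightarrow> (free_step M ^^ a) g z = (\<integral>s. g (z + s) \<partial>\<nu>a)"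
      using ex_pow_law[of a] by blast
    obtain \<nu>b where nb: "real_distribution \<nu>b" "\<And>g z. g \<in> bdd_borel \<Longrightarrow> (free_step M ^^ b) g z = (\<integral>s. g (z + s) \<partial>\<nu>b)"
      using ex_pow_law[of b] by blast
    interpret Na: real_distribution \<nu>a by fact
    interpret Nb: real_distribution \<nu>b by fact
    interpret NN: pair_prob_space \<nu>a \<nu>b ..
    have cheb: "(free_step M ^^ k) (indicator A) 0 \<le> real k * \<sigma>\<^sup>2 / r\<^sup>2" for k
    proof -
      have "(indicator A :: real \<Rightarrow> real) w \<le> w\<^sup>2 / r\<^sup>2" for w
        using r by (auto simp: indicator_def A_def le_divide_eq abs_le_square_iff[symmetric])
      then show ?thesis using free_pow_Chebyshev[OF Ab r, of k 0] by simp
    qed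
    \<comment> \<open>\<open>k\<close> is the length of the half used for concentration,
      \<open>l\<close> that of the half making the large displacement.\<close>
    have conc: "C / sqrt (real k + 1) * (real l * \<sigma>\<^sup>2 / r\<^sup>2) \<le> 32 * C * \<sigma>\<^sup>2 * sqrt (real m + 1) / v\<^sup>2"
      if k: "real m + 1 \<le> 2 * (real k + 1)" and l: "l \<le> m" for k l
    proof -
      have s1: "sqrt (real m + 1) \<le> 2 * sqrt (real k + 1)"
      proof -
        have "sqrt (real m + 1) \<le> sqrt (4 * (real k + 1))" using k by (intro real_sqrt_le_mono) linarith
        then show ?thesis by (simp only: real_sqrt_mult real_sqrt_four)
      qed
      have "real l / sqrt (real k + 1) \<le> (real m + 1) / sqrt (real k + 1)"
        using l by (intro divide_right_mono) auto
      also have "\<dots> = sqrt (real m + 1) * (sqrt (real m + 1) / sqrt (real k + 1))" by simp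
      also have "\<dots> \<le> sqrt (real m + 1) * 2"
        using s1 by (intro mult_left_mono) (auto simp: divide_le_eq)
      finally have "C * \<sigma>\<^sup>2 * 16 / v\<^sup>2 * (real l / sqrt (real k + 1)) \<le> C * \<sigma>\<^sup>2 * 16 / v\<^sup>2 * (sqrt (real m + 1) * 2)"
        using C by (intro mult_left_mono) auto
      then show ?thesis by (simp add: r_def power_divide mult_ac)
    qed
    have pt: "?I (v + s + t) \<le> indicator A s * ?I (v + s + t) + indicator A t * ?I (v + s + t)" for s t
    proof (cases "v + s + t \<in> {0..<d}")
      case True
      then have "r \<le> \<bar>s\<bar> \<or> r \<le> \<bar>t\<bar>" using False unfolding r_def by auto
      then show ?thesis using True by (auto simp: A_def indicator_def)
    qed simp
    have ib: "integrable (\<nu>a \<Otimes>\<^sub>M \<nu>b) (\<lambda>p. indicator A (fst p) * ?I (v + fst p + snd p))"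
      "integrable (\<nu>a \<Otimes>\<^sub>M \<nu>b) (\<lambda>p. indicator A (snd p) * ?I (v + fst p + snd p))"
      "integrable (\<nu>a \<Otimes>\<^sub>M \<nu>b) (\<lambda>p. ?I (v + fst p + snd p))"
      by (rule NN.integrable_const_bound[of _ 1]; (simp add: indicator_def | measurable))+
    have "(free_step M ^^ m) ?I v = (free_step M ^^ a) ((free_step M ^^ b) ?I) v"
      unfolding abm(1) funpow_add by simp
    also have "\<dots> = (\<integral>s. (\<integral>t. ?I (v + s + t) \<partial>\<nu>b) \<partial>\<nu>a)"
      by (simp add: na(2)[OF free_pow_bdd_borel[OF Ib]] nb(2)[OF Ib])
    also have "\<dots> = (\<integral>p. ?I (v + fst p + snd p) \<partial>(\<nu>a \<Otimes>\<^sub>M \<nu>b))"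
      using NN.integral_fst'[OF ib(3)] by simp
    also have "\<dots> \<le> (\<integral>p. indicator A (fst p) * ?I (v + fst p + snd p) + indicator A (snd p) * ?I (v + fst p + snd p) \<partial>(\<nu>a \<Otimes>\<^sub>M \<nu>b))"
      using pt ib by (intro integral_mono Bochner_Integration.integrable_add) auto
    also have "\<dots> = (\<integral>p. indicator A (fst p) * ?I (v + fst p + snd p) \<partial>(\<nu>a \<Otimes>\<^sub>M \<nu>b))
        + (\<integral>p. indicator A (snd p) * ?I (v + fst p + snd p) \<partial>(\<nu>a \<Otimes>\<^sub>M \<nu>b))"
      by (intro Bochner_Integration.integral_add ib)
    also have "(\<integral>p. indicator A (fst p) * ?I (v + fst p + snd p) \<partial>(\<nu>a \<Otimes>\<^sub>M \<nu>b)) \<le> 32 * C * \<sigma>\<^sup>2 * sqrt (real m + 1) / v\<^sup>2"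
    proof -
      have "(\<integral>p. indicator A (fst p) * ?I (v + fst p + snd p) \<partial>(\<nu>a \<Otimes>\<^sub>M \<nu>b)) = (\<integral>s. (\<integral>t. indicator A s * ?I (v + s + t) \<partial>\<nu>b) \<partial>\<nu>a)"
        using NN.integral_fst'[OF ib(1)] by simp
      also have "\<dots> = (\<integral>s. indicator A s * (free_step M ^^ b) ?I (v + s) \<partial>\<nu>a)"
        by (simp add: nb(2)[OF Ib])
      also have "\<dots> \<le> (\<integral>s. C / sqrt (real b + 1) * indicator A s \<partial>\<nu>a)"
      proof (rule integral_mono)
        show "integrable \<nu>a (\<lambda>s. indicator A s * (free_step M ^^ b) ?I (v + s))"
          using bdd_borel_measurable[OF free_pow_bdd_borel[OF Ib, of b]] free_pow_nonneg[OF Ib, of b] free_pow_le_const[OF Ib, of 1 b]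
          by (intro Na.integrable_const_bound[of _ 1]) (auto simp: indicator_def)
        show "integrable \<nu>a (\<lambda>s. C / sqrt (real b + 1) * indicator A s)"
          by (intro integrable_mult_right Na.integrable_const_bound[of _ 1]) (auto simp: indicator_def)
      qed (use C(2)[of b] in \<open>auto simp: indicator_def\<close>)
      also have "\<dots> = C / sqrt (real b + 1) * (free_step M ^^ a) (indicator A) 0"
        by (simp add: na(2)[OF Ab])
      also have "\<dots> \<le> C / sqrt (real b + 1) * (real a * \<sigma>\<^sup>2 / r\<^sup>2)"
        using C cheb by (intro mult_left_mono) auto
      also have "\<dots> \<le> 32 * C * \<sigma>\<^sup>2 * sqrt (real m + 1) / v\<^sup>2" by (rule conc[OF abm(3,4)])
      finally show ?thesis .
    qed
    also have "(\<integral>p. indicator A (snd p) * ?I (v + fst p + snd p) \<partial>(\<nu>a \<Otimes>\<^sub>M \<nu>b)) \<le> 32 * C * \<sigma>\<^sup>2 * sqrt (real m + 1) / v\<^sup>2"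
    proof -
      have "(\<integral>p. indicator A (snd p) * ?I (v + fst p + snd p) \<partial>(\<nu>a \<Otimes>\<^sub>M \<nu>b)) = (\<integral>t. (\<integral>s. indicator A t * ?I (v + s + t) \<partial>\<nu>a) \<partial>\<nu>b)"
        using NN.integral_snd[of "\<lambda>s t. indicator A t * ?I (v + s + t)"] ib(2) by (simp add: split_beta')
      also have "\<dots> = (\<integral>t. indicator A t * (free_step M ^^ a) ?I (v + t) \<partial>\<nu>b)"
        by (simp add: na(2)[OF Ib] add_ac)
      also have "\<dots> \<le> (\<integral>t. C / sqrt (real a + 1) * indicator A t \<partial>\<nu>b)"
      proof (rule integral_mono)
        show "integrable \<nu>b (\<lambda>s. indicator A s * (free_step M ^^ a) ?I (v + s))"
          using bdd_borel_measurable[OF free_pow_bdd_borel[OF Ib, of a]] free_pow_nonneg[OF Ib, of a] free_pow_le_const[OF Ib, of 1 a]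
          by (intro Nb.integrable_const_bound[of _ 1]) (auto simp: indicator_def)
        show "integrable \<nu>b (\<lambda>s. C / sqrt (real a + 1) * indicator A s)"
          by (intro integrable_mult_right Nb.integrable_const_bound[of _ 1]) (auto simp: indicator_def)
      qed (use C(2)[of a] in \<open>auto simp: indicator_def\<close>)
      also have "\<dots> = C / sqrt (real a + 1) * (free_step M ^^ b) (indicator A) 0"
        by (simp add: nb(2)[OF Ab])
      also have "\<dots> \<le> C / sqrt (real a + 1) * (real b * \<sigma>\<^sup>2 / r\<^sup>2)"
        using C cheb by (intro mult_left_mono) auto
      also have "\<dots> \<le> 32 * C * \<sigma>\<^sup>2 * sqrt (real m + 1) / v\<^sup>2" by (rule conc[OF abm(2,5)])
      finally show ?thesis .
    qed
    finally have "(free_step M ^^ m) ?I v \<le> 64 * C * \<sigma>\<^sup>2 * sqrt (real m + 1) / v\<^sup>2" by (simp add: ac_simps)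
    then have "v\<^sup>2 * (free_step M ^^ m) ?I v \<le> v\<^sup>2 * (64 * C * \<sigma>\<^sup>2 * sqrt (real m + 1) / v\<^sup>2)"
      by (intro mult_left_mono) auto
    also have "\<dots> = 64 * C * \<sigma>\<^sup>2 * sqrt (real m + 1)" using r by (simp add: r_def)
    also have "\<dots> \<le> D * sqrt (real m + 1)" unfolding D_def by (intro mult_right_mono) auto
    finally show ?thesis .
  qed
  then show ?thesis using D by blast
qed

end

section \<open>The killed local limit theorem for intervals\<close>

lemma half_le_exp_minus_half: "1 / 2 \<le> exp (- (1 / 2 :: real))"
  using exp_ge_add_one_self[of "- (1 / 2 :: real)"] by simp

text \<open>In the shell between \<open>A\<^sup>2 * 4 ^ j\<close> and
  \<open>A\<^sup>2 * 4 ^ Suc j\<close> the quadratic decay gives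
  \<open>K / (A\<^sup>2 * 4 ^ j)\<close>, and the Gaussian whose variance is the outer edge is still
  at least 1/2 there. The core uses the flat bound \<open>e\<close>; the last constant covers
  everything past the cutoff \<open>J\<close>. Enlarging \<open>A\<close> shrinks the tail terms at
  the price of a wider core.\<close>

lemma dyadic_gauss_bound:
  fixes D s e K A :: real
  assumes A: "A > 0" and e: "e \<ge> 0" and K: "K \<ge> 0" and De: "D \<le> e" and DK: "D * s\<^sup>2 \<le> K"
  shows "D \<le> 2 * e * exp (- s\<^sup>2 / (2 * A\<^sup>2))
     + (\<Sum>j<J. 2 * K / (A\<^sup>2 * 4 ^ j) * exp (- s\<^sup>2 / (2 * (A\<^sup>2 * 4 ^ Suc j)))) + K / (A\<^sup>2 * 4 ^ J)"
proof (cases "s\<^sup>2 \<le> A\<^sup>2")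
  case True
  have "exp (- (1/2)) \<le> exp (- s\<^sup>2 / (2 * A\<^sup>2))"
    using True A by (simp add: field_simps)
  then have "1 / 2 \<le> exp (- s\<^sup>2 / (2 * A\<^sup>2))" using half_le_exp_minus_half by linarith
  then have "2 * e * (1 / 2) \<le> 2 * e * exp (- s\<^sup>2 / (2 * A\<^sup>2))" using e by (intro mult_left_mono) auto
  moreover have "0 \<le> (\<Sum>j<J. 2 * K / (A\<^sup>2 * 4 ^ j) * exp (- s\<^sup>2 / (2 * (A\<^sup>2 * 4 ^ Suc j))))"
    using K by (intro sum_nonneg) auto
  moreover have "0 \<le> K / (A\<^sup>2 * 4 ^ J)" using K by simp
  ultimately show ?thesis using De by linarith
next
  case False
  have far: "D \<le> K / B" if "B \<le> s\<^sup>2" "B > 0" for B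
  proof -
    have "s\<^sup>2 > 0" using that by linarith
    then have "D \<le> K / s\<^sup>2" using DK by (simp add: le_divide_eq)
    also have "\<dots> \<le> K / B" using that K \<open>s\<^sup>2 > 0\<close> by (intro divide_left_mono mult_pos_pos)
    finally show ?thesis .
  qed
  have "D \<le> (\<Sum>j<J. 2 * K / (A\<^sup>2 * 4 ^ j) * exp (- s\<^sup>2 / (2 * (A\<^sup>2 * 4 ^ Suc j)))) + K / (A\<^sup>2 * 4 ^ J)"
  proof (induction J)
    case 0
    then show ?case using far[of "A\<^sup>2"] False A by simp
  next
    case (Suc J)
    let ?S = "\<Sum>j<J. 2 * K / (A\<^sup>2 * 4 ^ j) * exp (- s\<^sup>2 / (2 * (A\<^sup>2 * 4 ^ Suc j)))"
    let ?t = "2 * K / (A\<^sup>2 * 4 ^ J) * exp (- s\<^sup>2 / (2 * (A\<^sup>2 * 4 ^ Suc J)))"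
    have S0: "0 \<le> ?S" using K by (intro sum_nonneg) auto
    show ?case
    proof (cases "s\<^sup>2 \<le> A\<^sup>2 * 4 ^ Suc J")
      case True
      have "exp (- (1/2)) \<le> exp (- s\<^sup>2 / (2 * (A\<^sup>2 * 4 ^ Suc J)))"
        using True A by (simp add: field_simps)
      then have "1 / 2 \<le> exp (- s\<^sup>2 / (2 * (A\<^sup>2 * 4 ^ Suc J)))" using half_le_exp_minus_half by linarith
      then have "2 * K / (A\<^sup>2 * 4 ^ J) * (1 / 2) \<le> ?t" using K by (intro mult_left_mono) auto
      then have "K / (A\<^sup>2 * 4 ^ J) \<le> ?t" by simp
      moreover have "0 \<le> K / (A\<^sup>2 * 4 ^ Suc J)" using K by simp
      ultimately show ?thesis using Suc.IH unfolding sum.lessThan_Suc by linarith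
    next
      case False
      have "D \<le> K / (A\<^sup>2 * 4 ^ Suc J)" using False A by (intro far) auto
      moreover have "0 \<le> ?t" using K by simp
      ultimately show ?thesis using S0 unfolding sum.lessThan_Suc by linarith
    qed
  qed
  moreover have "0 \<le> 2 * e * exp (- s\<^sup>2 / (2 * A\<^sup>2))" using e by simp
  ultimately show ?thesis by linarith
qed

lemma sqrt_2pi_le_3: "sqrt (2 * pi) \<le> 3"
  using pi_less_4 real_sqrt_le_mono[of "2 * pi" "3\<^sup>2"] by simp

lemma exp_eq_heat: "v > 0 \<Longrightarrow> exp (- z\<^sup>2 / (2 * v)) = sqrt (2 * pi * v) * heat v z"
  by (simp add: heat_def)

lemma exp_le_heat:
  assumes v: "v > 0" shows "exp (- z\<^sup>2 / (2 * v)) \<le> 3 * sqrt v * heat v z"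
proof -
  have "sqrt (2 * pi * v) * heat v z \<le> 3 * sqrt v * heat v z"
    using sqrt_2pi_le_3 v by (intro mult_right_mono) (auto simp: real_sqrt_mult)
  then show ?thesis using exp_eq_heat[OF v] by simp
qed

lemma heat_tail: assumes v: "v > 0" shows "z\<^sup>2 * heat v z \<le> 2 * sqrt v"
proof -
  have "u * exp (- u) \<le> 1" for u :: real
  proof -
    have "u \<le> exp u" using exp_ge_add_one_self[of u] by linarith
    then have "u * exp (- u) \<le> exp u * exp (- u)" by (intro mult_right_mono) auto
    then show ?thesis by (simp add: exp_minus)
  qed
  from this[of "z\<^sup>2 / (2 * v)"] have "z\<^sup>2 / (2 * v) * exp (- z\<^sup>2 / (2 * v)) \<le> 1" by simp
  then have z: "z\<^sup>2 * exp (- z\<^sup>2 / (2 * v)) \<le> 2 * v" using v by (simp add: field_simps)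
  have "z\<^sup>2 * heat v z = z\<^sup>2 * exp (- z\<^sup>2 / (2 * v)) / sqrt (2 * pi * v)" by (simp add: heat_def)
  also have "\<dots> \<le> 2 * v / sqrt (2 * pi * v)" using z v by (intro divide_right_mono) auto
  also have "\<dots> \<le> 2 * v / sqrt v" using v pi_gt3 by (intro divide_left_mono) auto
  also have "\<dots> = 2 * sqrt v" by (simp only: times_divide_eq_right[symmetric] real_div_sqrt[OF less_imp_le[OF v]])
  finally show ?thesis .
qed

lemma heat_antimono: assumes "v > 0" "0 \<le> a" "a \<le> b" shows "heat v b \<le> heat v a"
proof -
  have "a\<^sup>2 \<le> b\<^sup>2" using assms by (intro power_mono) auto
  then show ?thesis using assms unfolding heat_def by (intro divide_right_mono) (auto simp: divide_right_mono)
qed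

lemma heat_scale: assumes "m > 0" shows "heat (v * m) z = heat v (z / sqrt m) / sqrt m"
  using assms by (simp add: heat_def real_sqrt_mult power_divide) (simp add: field_simps)

context real_distribution
begin

lemma killed_pow_sum:
  assumes "finite S" "\<And>j. j \<in> S \<Longrightarrow> g j \<in> bdd_borel"
  shows "(killed_step M ^^ n) (\<lambda>z. \<Sum>j\<in>S. c j * g j z) x = (\<Sum>j\<in>S. c j * (killed_step M ^^ n) (g j) x)"
  using assms
proof (induction S)
  case empty
  show ?case using killed_pow_linear[of "\<lambda>_. 0" "\<lambda>_. 0" n 0 0 x] by simp
next
  case (insert j S)
  have "(killed_step M ^^ n) (\<lambda>z. \<Sum>j\<in>insert j S. c j * g j z) x
      = (killed_step M ^^ n) (\<lambda>z. c j * g j z + 1 * (\<Sum>j\<in>S. c j * g j z)) x"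
    using insert by simp
  also have "\<dots> = c j * (killed_step M ^^ n) (g j) x + 1 * (killed_step M ^^ n) (\<lambda>z. \<Sum>j\<in>S. c j * g j z) x"
    using insert by (intro killed_pow_linear bdd_borel_sum bdd_borel_cmult) auto
  finally show ?case using insert by simp
qed

end

context centred_law
begin

text \<open>Undoes the reflection: the mirror kernel is centred at -y and on the half-line never
  exceeds its boundary value.\<close>

lemma killed_heat_upper:
  assumes C: "\<bar>(killed_step M ^^ N) (\<lambda>z. heat v (z - y) - heat v (z + y)) x
        - (heat (v + real N * \<sigma>\<^sup>2) (x - y) - heat (v + real N * \<sigma>\<^sup>2) (x + y))\<bar> \<le> E"
    and v: "v > 0" and x: "x \<ge> 0" and y: "y \<ge> 0"
  shows "(killed_step M ^^ N) (\<lambda>z. heat v (z - y)) x \<le> heat (v + real N * \<sigma>\<^sup>2) (x - y) + E + heat v y"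
proof -
  let ?K = "\<lambda>g. (killed_step M ^^ N) g x"
  have b: "(\<lambda>z. heat v (z - y)) \<in> bdd_borel" "(\<lambda>z. heat v (z + y)) \<in> bdd_borel"
    using heat_bdd_borel[OF v, of "- y"] heat_bdd_borel[OF v, of y] by auto
  have "?K (\<lambda>z. 1 * heat v (z - y) + (-1) * heat v (z + y)) = 1 * ?K (\<lambda>z. heat v (z - y)) + (-1) * ?K (\<lambda>z. heat v (z + y))"
    by (rule killed_pow_linear[OF b])
  moreover have "?K (\<lambda>z. heat v (z + y)) \<le> heat v y"
    using v x y by (intro killed_pow_le_const b heat_antimono) auto
  moreover have "0 \<le> heat (v + real N * \<sigma>\<^sup>2) (x + y)"
    using v by simp
  ultimately show ?thesis using C by (simp add: abs_le_iff)
qed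

text \<open>\<open>B\<close> is the mass killed during the last \<open>m\<close> steps, \<open>e\<close> the error of the local limit theorem for these
  steps, \<open>E\<close> the Lindeberg error over the first \<open>N\<close> steps, and \<open>Q\<close> bounds the killed density smoothed at
  any variance between \<open>m\<close> and \<open>Vmax\<close>.\<close>

lemma killed_local_core:
  fixes h g :: "real \<Rightarrow> real"
  assumes m: "m > 0" and x: "x \<ge> 0" and y: "y > 0" and d: "d \<ge> 0"
    and g: "g \<in> bdd_borel" and h: "h \<in> bdd_borel"
    and gh: "\<And>z. \<bar>(killed_step M ^^ m) g z - h (z - y)\<bar> \<le> B"
    and llt: "\<And>z. \<bar>sqrt (real m) * h z - d * heat (\<sigma>\<^sup>2) (z / sqrt (real m))\<bar> \<le> e"
    and h0: "\<And>z. h z \<ge> 0" and tail: "\<And>z. z\<^sup>2 * h z \<le> C2 * sqrt (real m)"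
    and kh: "\<And>v. min 1 (\<sigma>\<^sup>2) * real m \<le> v \<Longrightarrow>
      \<bar>(killed_step M ^^ N) (\<lambda>z. heat v (z - y) - heat v (z + y)) x
        - (heat (v + real N * \<sigma>\<^sup>2) (x - y) - heat (v + real N * \<sigma>\<^sup>2) (x + y))\<bar> \<le> E"
    and Q: "\<And>V. real m \<le> V \<Longrightarrow> V \<le> Vmax \<Longrightarrow> heat (V + real N * \<sigma>\<^sup>2) (x - y) + E + heat V y \<le> Q"
    and A: "A \<ge> 1" and J: "A\<^sup>2 * real m * 4 ^ J \<le> Vmax"
  defines "K \<equiv> C2 + 2 * d * \<sigma>"
  shows "\<bar>(killed_step M ^^ (N + m)) g x - d * (heat (real (N + m) * \<sigma>\<^sup>2) (x - y) - heat (real (N + m) * \<sigma>\<^sup>2) (x + y))\<bar>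
     \<le> d * E + B + d * heat (\<sigma>\<^sup>2 * real m) y + (6 * e * A + 24 * K / A) * Q + K * sqrt (real m) / (A\<^sup>2 * real m * 4 ^ J)"
proof -
  let ?v = "\<sigma>\<^sup>2 * real m"
  have mp: "real m > 0" using m by simp
  have vp: "?v > 0" using mp sigma_pos by simp
  let ?u = "\<lambda>z. heat ?v (z - y) - heat ?v (z + y)"
  have hb: "(\<lambda>z. heat v (z - y)) \<in> bdd_borel" "(\<lambda>z. heat v (z + y)) \<in> bdd_borel" if "v > 0" for v
    using heat_bdd_borel[OF that, of "- y"] heat_bdd_borel[OF that, of y] by auto
  have ub: "?u \<in> bdd_borel" by (intro bdd_borel_diff hb vp)
  define V where "V j = A\<^sup>2 * real m * 4 ^ j" for j :: nat
  have Vp: "V j > 0" for j using A mp by (simp add: V_def)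
  have Vm: "real m \<le> V j" for j
  proof -
    have "1 * 1 \<le> A\<^sup>2 * 4 ^ j" using A by (intro mult_mono) (auto simp: one_le_power)
    then have "real m * 1 \<le> real m * (A\<^sup>2 * 4 ^ j)" using mp by (intro mult_left_mono) auto
    then show ?thesis by (simp add: V_def ac_simps)
  qed
  have VJ: "V j \<le> Vmax" if "j \<le> J" for j
  proof -
    have "V j \<le> V J" unfolding V_def using that A by (intro mult_left_mono power_increasing) auto
    then show ?thesis using J by (simp add: V_def)
  qed
  have e0: "e \<ge> 0" using llt[of 0] by linarith
  have C2: "C2 \<ge> 0"
  proof -
    have "0 \<le> C2 * sqrt (real m)" using tail[of 0] by simp
    then show ?thesis using mp by (simp add: zero_le_mult_iff)
  qed
  have K0: "K \<ge> 0" using C2 d sigma_pos by (simp add: K_def)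
  \<comment> \<open>Coefficients of \<open>dyadic_gauss_bound\<close> once each exponential is
    replaced by 3 * sqrt (V j) times a heat kernel. Re-indexing by one turns 12 into 24, and a
    geometric series in j remains.\<close>
  define w where "w j = (if j = 0 then 6 * e * A else 24 * K / (A * 2 ^ j))" for j :: nat
  have w0: "w j \<ge> 0" for j using e0 A K0 by (simp add: w_def)
  \<comment> \<open>Dominates on the half-line the error of replacing
    \<open>(killed_step M ^^ m) g\<close> by \<open>d\<close> times the reflected kernel: local
    limit error, killed mass and mirror term.\<close>
  define Dom where "Dom z = (\<Sum>j\<le>J. w j * heat (V j) (z - y)) + (K * sqrt (real m) / V J + B + d * heat ?v y)" for z
  have Domb: "Dom \<in> bdd_borel" unfolding Dom_def[abs_def]
    by (intro bdd_borel_add bdd_borel_sum bdd_borel_cmult hb Vp bdd_borel_const)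
  have hD: "\<bar>h z - d * heat ?v z\<bar> \<le> (\<Sum>j\<le>J. w j * heat (V j) z) + K * sqrt (real m) / V J" for z
  proof -
    \<comment> \<open>The limit theorem bounds \<open>D\<close> by e / sqrt m, the decay of both
      densities bounds it by K * sqrt m / z^2; these are the two inputs of
      \<open>dyadic_gauss_bound\<close>.\<close>
    define D where "D = \<bar>h z - d * heat ?v z\<bar>"
    have sm: "sqrt (real m) > 0" using mp by simp
    have "sqrt (real m) * D = \<bar>sqrt (real m) * h z - d * heat (\<sigma>\<^sup>2) (z / sqrt (real m))\<bar>"
      unfolding D_def heat_scale[OF mp] using sm by (subst abs_of_pos[OF sm, symmetric], subst abs_mult[symmetric]) (simp add: algebra_simps)
    then have "sqrt (real m) * D \<le> e" using llt[of z] by simp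
    then have D1: "D \<le> e / sqrt (real m)" using sm by (simp add: field_simps)
    have "D \<le> h z + d * heat ?v z" using h0[of z] d vp unfolding D_def by (simp add: abs_le_iff add_increasing2)
    then have "D * z\<^sup>2 \<le> (h z + d * heat ?v z) * z\<^sup>2" by (intro mult_right_mono) auto
    also have "\<dots> = z\<^sup>2 * h z + d * (z\<^sup>2 * heat ?v z)" by (simp add: algebra_simps)
    also have "\<dots> \<le> C2 * sqrt (real m) + d * (2 * sqrt ?v)"
      using d by (intro add_mono tail mult_left_mono heat_tail vp) auto
    also have "\<dots> = K * sqrt (real m)" using sigma_pos by (simp add: K_def real_sqrt_mult algebra_simps)
    finally have D2: "D * z\<^sup>2 \<le> K * sqrt (real m)" .
    have Vj: "(A * sqrt (real m))\<^sup>2 * 4 ^ j = V j" for j by (simp add: V_def power_mult_distrib)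
    have "D \<le> 2 * (e / sqrt (real m)) * exp (- z\<^sup>2 / (2 * V 0))
        + (\<Sum>j<J. 2 * (K * sqrt (real m)) / V j * exp (- z\<^sup>2 / (2 * V (Suc j)))) + K * sqrt (real m) / V J"
      using dyadic_gauss_bound[of "A * sqrt (real m)" "e / sqrt (real m)" "K * sqrt (real m)" D z J] A sm e0 K0 D1 D2
      unfolding Vj using Vj[of 0] by simp
    also have "2 * (e / sqrt (real m)) * exp (- z\<^sup>2 / (2 * V 0)) \<le> w 0 * heat (V 0) z"
    proof -
      have "2 * (e / sqrt (real m)) * exp (- z\<^sup>2 / (2 * V 0)) \<le> 2 * (e / sqrt (real m)) * (3 * sqrt (V 0) * heat (V 0) z)"
        using e0 sm by (intro mult_left_mono exp_le_heat Vp) auto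
      also have "sqrt (V 0) = A * sqrt (real m)" using A by (simp add: V_def real_sqrt_mult)
      finally show ?thesis using sm by (simp add: w_def)
    qed
    also have "(\<Sum>j<J. 2 * (K * sqrt (real m)) / V j * exp (- z\<^sup>2 / (2 * V (Suc j)))) \<le> (\<Sum>j<J. w (Suc j) * heat (V (Suc j)) z)"
    proof (rule sum_mono)
      fix j
      have "2 * (K * sqrt (real m)) / V j * exp (- z\<^sup>2 / (2 * V (Suc j))) \<le> 2 * (K * sqrt (real m)) / V j * (3 * sqrt (V (Suc j)) * heat (V (Suc j)) z)"
        using K0 sm Vp[of j] by (intro mult_left_mono exp_le_heat Vp) auto
      also have "2 * (K * sqrt (real m)) / V j * (3 * sqrt (V (Suc j)) * heat (V (Suc j)) z) = w (Suc j) * heat (V (Suc j)) z"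
      proof -
        have "(4::real) ^ j = 2 ^ j * 2 ^ j" by (simp add: power_mult_distrib[symmetric])
        then have "sqrt (4 ^ j) = (2::real) ^ j" using real_sqrt_abs[of "2 ^ j :: real"] by (simp add: power2_eq_square)
        then have "sqrt (V (Suc j)) = A * sqrt (real m) * (2 * 2 ^ j)" using A by (simp add: V_def real_sqrt_mult)
        moreover have "V j = A * sqrt (real m) * (2 ^ j) * (A * sqrt (real m) * 2 ^ j)"
          using \<open>(4::real) ^ j = 2 ^ j * 2 ^ j\<close> by (simp add: V_def power2_eq_square)
        ultimately show ?thesis using A sm by (simp add: w_def field_simps)
      qed
      finally show "2 * (K * sqrt (real m)) / V j * exp (- z\<^sup>2 / (2 * V (Suc j))) \<le> w (Suc j) * heat (V (Suc j)) z" .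
    qed
    also have "w 0 * heat (V 0) z + (\<Sum>j<J. w (Suc j) * heat (V (Suc j)) z) = (\<Sum>j\<le>J. w j * heat (V j) z)"
      by (rule sum.atMost_shift[symmetric])
    finally show ?thesis by (simp add: D_def)
  qed
  have pt: "\<bar>(killed_step M ^^ m) g z - d * ?u z\<bar> \<le> Dom z" if z: "z \<ge> 0" for z
  proof -
    have "0 \<le> heat ?v (z + y)" "heat ?v (z + y) \<le> heat ?v y" using vp z y by (auto intro!: heat_antimono)
    then have "0 \<le> d * heat ?v (z + y)" "d * heat ?v (z + y) \<le> d * heat ?v y" using d by (auto intro: mult_left_mono)
    then show ?thesis using gh[of z] hD[of "z - y"] unfolding Dom_def by (simp add: right_diff_distrib abs_le_iff)
  qed
  have wsum: "(\<Sum>j\<le>J. w j) \<le> 6 * e * A + 24 * K / A"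
  proof -
    have "(\<Sum>j\<le>J. w j) = w 0 + (\<Sum>j<J. w (Suc j))" by (rule sum.atMost_shift)
    also have "(\<Sum>j<J. w (Suc j)) = 24 * K / A * (\<Sum>j<J. (1/2) ^ Suc j)"
      unfolding sum_distrib_left by (intro sum.cong) (auto simp: w_def power_one_over)
    also have "(\<Sum>j<J. (1/2 :: real) ^ Suc j) = 1 - (1/2) ^ J"
      by (induction J) auto
    also have "24 * K / A * (1 - (1/2) ^ J) \<le> 24 * K / A * 1" using K0 A by (intro mult_left_mono) auto
    finally show ?thesis by (simp add: w_def)
  qed
  have Q0: "Q \<ge> 0"
  proof -
    have "min 1 (\<sigma>\<^sup>2) * real m \<le> 1 * real m" using mp by (intro mult_right_mono) auto
    then have "0 \<le> E" using order_trans[OF abs_ge_zero kh[of "real m"]] by simp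
    moreover have "0 \<le> V J + real N * \<sigma>\<^sup>2" using Vp[of J] by simp
    ultimately show ?thesis
      using Q[of "V J"] Vm[of J] VJ[of J] Vp[of J] heat_nonneg[of "V J" y]
        heat_nonneg[of "V J + real N * \<sigma>\<^sup>2" "x - y"] by linarith
  qed
  have KDom: "(killed_step M ^^ N) Dom x \<le> (6 * e * A + 24 * K / A) * Q + (K * sqrt (real m) / V J + B + d * heat ?v y)"
  proof -
    have B0: "B \<ge> 0" using gh[of 0] by linarith
    let ?S = "\<lambda>z. \<Sum>j\<le>J. w j * heat (V j) (z - y)" and ?c = "K * sqrt (real m) / V J + B + d * heat ?v y"
    have c0: "?c \<ge> 0" using K0 Vp[of J] B0 d vp by simp
    have "(killed_step M ^^ N) (\<lambda>z. 1 * ?S z + 1 * ?c) x = 1 * (killed_step M ^^ N) ?S x + 1 * (killed_step M ^^ N) (\<lambda>_. ?c) x"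
      by (intro killed_pow_linear bdd_borel_sum bdd_borel_cmult hb Vp bdd_borel_const)
    moreover have "(killed_step M ^^ N) (\<lambda>_. ?c) x \<le> ?c" using c0 x by (intro killed_pow_le_const) auto
    moreover have "(killed_step M ^^ N) ?S x \<le> (6 * e * A + 24 * K / A) * Q"
    proof -
      have "(killed_step M ^^ N) ?S x = (\<Sum>j\<le>J. w j * (killed_step M ^^ N) (\<lambda>z. heat (V j) (z - y)) x)"
        by (intro killed_pow_sum hb Vp) auto
      also have "\<dots> \<le> (\<Sum>j\<le>J. w j * Q)"
      proof (intro sum_mono mult_left_mono w0)
        fix j assume "j \<in> {..J}"
        then have Vj: "real m \<le> V j" "V j \<le> Vmax" using Vm VJ by auto
        have "min 1 (\<sigma>\<^sup>2) * real m \<le> 1 * real m" using mp by (intro mult_right_mono) auto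
        then have "min 1 (\<sigma>\<^sup>2) * real m \<le> V j" using Vj by linarith
        then have "(killed_step M ^^ N) (\<lambda>z. heat (V j) (z - y)) x \<le> heat (V j + real N * \<sigma>\<^sup>2) (x - y) + E + heat (V j) y"
          using x y by (intro killed_heat_upper kh Vp) auto
        then show "(killed_step M ^^ N) (\<lambda>z. heat (V j) (z - y)) x \<le> Q" using Q[OF Vj] by linarith
      qed
      also have "\<dots> = (\<Sum>j\<le>J. w j) * Q" by (simp add: sum_distrib_right)
      also have "\<dots> \<le> (6 * e * A + 24 * K / A) * Q" using wsum Q0 by (intro mult_right_mono) auto
      finally show ?thesis .
    qed
    ultimately show ?thesis unfolding Dom_def by simp
  qed
  have pt': "(killed_step M ^^ m) g z - d * ?u z \<le> Dom z" "- Dom z \<le> (killed_step M ^^ m) g z - d * ?u z" if "z \<ge> 0" for z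
    using pt[OF that] by linarith+
  let ?KN = "\<lambda>g. (killed_step M ^^ N) g x" and ?T = "(killed_step M ^^ m) g"
  have Tb: "?T \<in> bdd_borel" by (intro killed_pow_bdd_borel g)
  have "?KN ?T = (killed_step M ^^ (N + m)) g x" by (simp add: funpow_add)
  moreover have "?KN (\<lambda>z. 1 * ?T z + (-d) * ?u z) = 1 * ?KN ?T + (-d) * ?KN ?u"
    by (rule killed_pow_linear[OF Tb ub])
  moreover have "?KN (\<lambda>z. 1 * ?T z + (-d) * ?u z) \<le> ?KN Dom"
    using pt' x by (intro killed_pow_mono_on bdd_borel_add bdd_borel_cmult Tb ub Domb) simp_all
  \<comment> \<open>The summand 0 * Dom z only brings - Dom into the shape of
    \<open>killed_pow_linear\<close>.\<close>
  moreover have "?KN (\<lambda>z. (-1) * Dom z + 0 * Dom z) \<le> ?KN (\<lambda>z. 1 * ?T z + (-d) * ?u z)"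
    using pt' x by (intro killed_pow_mono_on bdd_borel_add bdd_borel_cmult Tb ub Domb) simp_all
  moreover have "?KN (\<lambda>z. (-1) * Dom z + 0 * Dom z) = (-1) * ?KN Dom + 0 * ?KN Dom"
    by (rule killed_pow_linear[OF Domb Domb])
  ultimately have 1: "\<bar>(killed_step M ^^ (N + m)) g x - d * ?KN ?u\<bar> \<le> ?KN Dom"
    by (simp add: abs_le_iff)
  have "\<bar>?KN ?u - (heat (?v + real N * \<sigma>\<^sup>2) (x - y) - heat (?v + real N * \<sigma>\<^sup>2) (x + y))\<bar> \<le> E"
    by (rule kh) (use mp in \<open>auto intro!: mult_right_mono\<close>)
  moreover have "?v + real N * \<sigma>\<^sup>2 = real (N + m) * \<sigma>\<^sup>2" by (simp add: algebra_simps)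
  ultimately have "\<bar>?KN ?u - (heat (real (N + m) * \<sigma>\<^sup>2) (x - y) - heat (real (N + m) * \<sigma>\<^sup>2) (x + y))\<bar> \<le> E" by simp
  then have "d * \<bar>?KN ?u - (heat (real (N + m) * \<sigma>\<^sup>2) (x - y) - heat (real (N + m) * \<sigma>\<^sup>2) (x + y))\<bar> \<le> d * E"
    using d by (rule mult_left_mono)
  then have 2: "\<bar>d * ?KN ?u - d * (heat (real (N + m) * \<sigma>\<^sup>2) (x - y) - heat (real (N + m) * \<sigma>\<^sup>2) (x + y))\<bar> \<le> d * E"
    using d by (simp add: abs_mult right_diff_distrib[symmetric])
  show ?thesis using 1 2 KDom unfolding V_def by linarith
qed

end

section \<open>Powers of n, choice of scales, and heat kernels of neighbouring variance\<close>

lemma eventually_powr_le: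
  assumes "a < b" "c > 0"
  shows "\<forall>\<^sub>F n in sequentially. C * real n powr a \<le> c * real n powr b"
proof -
  have "((\<lambda>n. C * real n powr (a - b)) \<longlongrightarrow> 0) sequentially"
    using assms by (intro tendsto_mult_right_zero tendsto_neg_powr filterlim_real_sequentially) auto
  then have "\<forall>\<^sub>F n in sequentially. C * real n powr (a - b) < c" using assms by (intro order_tendstoD(2))
  then show ?thesis
    using eventually_gt_at_top[of 0]
  proof eventually_elim
    case (elim n)
    then have "C * real n powr (a - b) * real n powr b \<le> c * real n powr b"
      by (intro mult_right_mono) auto
    then show ?case using elim by (simp add: powr_add[symmetric] mult.assoc)
  qed
qed

lemma ex_power4_between:
  fixes r :: real
  assumes "r \<ge> 1"
  shows "\<exists>J::nat. 4 ^ J \<le> r \<and> r < 4 ^ Suc J"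
proof -
  obtain n where n: "r < 4 ^ n" using real_arch_pow[of 4 r] by auto
  define k where "k = (LEAST n. r < (4::real) ^ n)"
  have k: "r < 4 ^ k" unfolding k_def by (rule LeastI, rule n)
  then have "k \<noteq> 0" using assms by (intro notI) simp
  then obtain J where J: "k = Suc J" by (cases k) auto
  have "\<not> r < 4 ^ J" using not_less_Least[of J "\<lambda>n. r < (4::real) ^ n"] J by (simp add: k_def)
  then show ?thesis using k J by (intro exI[of _ J]) auto
qed

text \<open>For \<open>w\<^sup>2 \<le> 4 * \<sigma>\<^sup>2 * n * ln n\<close>, widening the
  variance by n powr (1 - s) changes the exponent by O(n powr (-s) * ln n), less than ln 2. Beyond
  that range the kernel itself is O(n powr (-3/2)). The factor 4 is 2 from the exponent times 2 from
  the normalisation.\<close>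

lemma heat_comparison:
  assumes \<sigma>: "\<sigma> > (0::real)" and s: "s > 0" and c: "c < 1"
  shows "\<forall>\<^sub>F n in sequentially. \<forall>V w. \<sigma>\<^sup>2 * real n / 2 \<le> V \<longrightarrow> V \<le> \<sigma>\<^sup>2 * real n + real n powr (1 - s) \<longrightarrow>
     heat V w \<le> 4 * heat (\<sigma>\<^sup>2 * real n) w + real n powr (- 1/2 - c)"
proof -
  have "\<forall>\<^sub>F n in sequentially. 1 * real n powr (1 - s) \<le> \<sigma>\<^sup>2 * real n powr 1"
    using s \<sigma> by (intro eventually_powr_le) auto
  moreover have "\<forall>\<^sub>F n in sequentially. 2 / \<sigma> * real n powr (- 3/2) \<le> 1 * real n powr (- 1/2 - c)"
    using c by (intro eventually_powr_le) auto
  moreover have "\<forall>\<^sub>F n in sequentially. 2 / \<sigma>\<^sup>2 * (ln (real n) * real n powr (- s)) < ln 2"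
  proof -
    have "((\<lambda>n. 2 / \<sigma>\<^sup>2 * (ln (real n) * real n powr (- s))) \<longlongrightarrow> 0) sequentially"
      using s by real_asymp
    then show ?thesis by (rule order_tendstoD) simp
  qed
  ultimately show ?thesis
    using eventually_gt_at_top[of 1]
  proof eventually_elim
    case (elim n)
    have n: "real n > 1" using elim by simp
    show ?case
    proof (intro allI impI)
      fix V w :: real
      assume V: "\<sigma>\<^sup>2 * real n / 2 \<le> V" "V \<le> \<sigma>\<^sup>2 * real n + real n powr (1 - s)"
      define S where "S = \<sigma>\<^sup>2 * real n"
      have S: "S > 0" using \<sigma> n by (simp add: S_def)
      have Vp: "V > 0" "V \<le> 2 * S" "S \<le> 2 * V" "V \<le> S + real n powr (1 - s)" using V S elim n by (auto simp: S_def)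
      have sq: "sqrt (2 * pi * S) \<le> 2 * sqrt (2 * pi * V)"
      proof -
        have "sqrt (2 * pi * S) \<le> sqrt (4 * (2 * pi * V))" using Vp by (intro real_sqrt_le_mono) (simp add: mult_left_mono)
        also have "\<dots> = 2 * sqrt (2 * pi * V)" by (simp only: real_sqrt_mult[of 4] real_sqrt_four)
        finally show ?thesis .
      qed
      show "heat V w \<le> 4 * heat (\<sigma>\<^sup>2 * real n) w + real n powr (- 1/2 - c)"
      proof (cases "w\<^sup>2 \<le> 4 * S * ln (real n)")
        case True
        have "w\<^sup>2 / (2 * S) - w\<^sup>2 / (2 * V) \<le> ln 2"
        proof (cases "V \<le> S")
          case True
          then have "w\<^sup>2 / (2 * S) \<le> w\<^sup>2 / (2 * V)" using Vp by (intro divide_left_mono) auto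
          moreover have "0 \<le> ln (2::real)" by simp
          ultimately show ?thesis by linarith
        next
          case False
          have "w\<^sup>2 / (2 * S) - w\<^sup>2 / (2 * V) = w\<^sup>2 * (V - S) / (2 * S * V)"
            using S Vp by (simp add: field_simps)
          also have "\<dots> \<le> (4 * S * ln (real n)) * real n powr (1 - s) / (2 * S * S)"
            using True False S Vp n by (intro frac_le mult_mono) (auto simp: mult_nonneg_nonneg)
          also have "\<dots> = 2 / \<sigma>\<^sup>2 * (ln (real n) * real n powr (- s))"
          proof -
            have "real n powr (1 - s) = real n * real n powr (- s)"
              using n powr_add[of "real n" 1 "- s"] by simp
            then show ?thesis using S \<sigma> n by (simp add: S_def field_simps)
          qed
          finally show ?thesis using elim by linarith
        qed
        then have "exp (- w\<^sup>2 / (2 * V)) \<le> exp (ln 2 + - w\<^sup>2 / (2 * S))" by simp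
        also have "\<dots> = 2 * exp (- w\<^sup>2 / (2 * S))" by (subst exp_add) simp
        finally have "heat V w \<le> 2 * exp (- w\<^sup>2 / (2 * S)) / sqrt (2 * pi * V)"
          unfolding heat_def using Vp by (intro divide_right_mono) auto
        also have "\<dots> \<le> 2 * exp (- w\<^sup>2 / (2 * S)) / (sqrt (2 * pi * S) / 2)"
          using sq S Vp by (intro divide_left_mono) auto
        also have "\<dots> = 4 * heat S w" by (simp add: heat_def)
        finally show ?thesis by (simp add: S_def add_increasing2)
      next
        case False
        have "4 * S * ln (real n) / (4 * S) \<le> w\<^sup>2 / (4 * S)" using False S by (intro divide_right_mono) auto
        also have "\<dots> \<le> w\<^sup>2 / (2 * V)" using Vp by (intro divide_left_mono) auto
        finally have "- w\<^sup>2 / (2 * V) \<le> - ln (real n)" using S by simp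
        then have "exp (- w\<^sup>2 / (2 * V)) \<le> exp (- ln (real n))" by simp
        then have e: "exp (- w\<^sup>2 / (2 * V)) \<le> 1 / real n" using n by (simp add: exp_minus inverse_eq_divide)
        have "sqrt S \<le> sqrt (2 * pi * S)" using S pi_gt3 by simp
        then have q: "sqrt S / 2 \<le> sqrt (2 * pi * V)" using sq by linarith
        have "heat V w \<le> (1 / real n) / (sqrt S / 2)"
          unfolding heat_def using e q S n by (intro frac_le) auto
        also have "\<dots> = 2 / \<sigma> * real n powr (- 3/2)"
        proof -
          have "sqrt S = \<sigma> * real n powr (1/2)" using \<sigma> n by (simp add: S_def real_sqrt_mult powr_half_sqrt)
          moreover have "real n powr (- 3/2) = 1 / (real n * real n powr (1/2))"
            using n powr_add[of "real n" 1 "1/2"] powr_minus_divide[of "real n" "3/2"] by simp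
          ultimately show ?thesis by simp
        qed
        also have "\<dots> \<le> real n powr (- 1/2 - c)" using elim by simp
        also have "\<dots> \<le> 4 * heat (\<sigma>\<^sup>2 * real n) w + real n powr (- 1/2 - c)" by simp
        finally show ?thesis .
      qed
    qed
  qed
qed

context nonlattice_law
begin

text \<open>The largest of the first \<open>n\<close> steps is of order at most \<open>n powr (1 / (2 + \<alpha>)) = n powr (1/2 - \<theta>)\<close>. With
  \<open>m\<close> about \<open>n powr (1 - \<theta> / 2)\<close> and Gaussian widths up to variance \<open>n powr (1 - \<theta> / 8)\<close> every error term
  below is at most a multiple of \<open>n powr (- 1/2 - \<theta> / 16)\<close>; \<open>rate\<close> is a number below \<open>\<theta> / 16\<close>.\<close>

definition \<theta> :: real where "\<theta> = \<alpha> / (2 * (2 + \<alpha>))"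
definition rate :: real where "rate = \<theta> / 20"

lemma theta_pos: "\<theta> > 0" using alpha_pos by (simp add: \<theta>_def)

lemma theta_le: "\<theta> \<le> 1 / 2" using alpha_pos by (simp add: \<theta>_def field_simps)

lemma rate_pos: "rate > 0" using theta_pos by (simp add: rate_def)

text \<open>\<open>killed_local_core\<close> with all scales set to powers of n; the power on the
  right absorbs every error that is not proportional to the heat kernel. There is no upper limit on
  \<open>y\<close>, which is what allows \<open>killed_nonneg_limit\<close> to treat arbitrarily
  many grid cells at the same n.\<close>

lemma killed_interval_limit:
  assumes d: "d > 0" and \<eta>: "\<eta> > 0" and \<kappa>: "\<kappa> > 0"
  shows "\<forall>\<^sub>F n in sequentially. \<forall>x y. x \<ge> 0 \<longrightarrow> sqrt (real n) / \<eta> \<le> y \<longrightarrow>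
     \<bar>(killed_step M ^^ n) (\<lambda>z. indicator {0..<d} (z - y)) x
        - d * (heat (\<sigma>\<^sup>2 * real n) (x - y) - heat (\<sigma>\<^sup>2 * real n) (x + y))\<bar>
     \<le> \<kappa> * (heat (\<sigma>\<^sup>2 * real n) (x - y) + real n powr (- 1/2 - rate))"
proof -
  let ?I = "indicator {0..<d} :: real \<Rightarrow> real"
  have Ib: "?I \<in> bdd_borel" by auto
  obtain C1 where C1: "C1 \<ge> 0" "\<And>v x y r N. v > 0 \<Longrightarrow> x \<ge> 0 \<Longrightarrow> r > 0 \<Longrightarrow> r \<le> sqrt v \<Longrightarrow> real N \<le> r powr (2 + \<alpha>) \<Longrightarrow>
     \<bar>(killed_step M ^^ N) (\<lambda>z. heat v (z - y) - heat v (z + y)) x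
        - (heat (v + real N * \<sigma>\<^sup>2) (x - y) - heat (v + real N * \<sigma>\<^sup>2) (x + y))\<bar> \<le> C1 * r / v"
    using killed_heat by blast
  obtain C2 where C2: "C2 \<ge> 0" "\<And>m v. v\<^sup>2 * (free_step M ^^ m) ?I v \<le> C2 * sqrt (real m + 1)"
    using interval_tail[OF d] by blast
  define K where "K = 2 * C2 + 2 * d * \<sigma>"
  have K: "K \<ge> 0" using C2 d sigma_pos by (simp add: K_def)
  \<comment> \<open>Order of choice: \<open>A\<close> makes the dyadic tail weight 24 * K / A small
    (384 = 24 * 16), then \<open>e\<close> makes the core weight 6 * e * A small, and only then is n
    taken large enough for the limit theorem to reach \<open>e\<close>.\<close>
  define A where "A = 1 + 384 * K / \<kappa>"
  have A: "A \<ge> 1" "24 * K / A \<le> \<kappa> / 16"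
  proof -
    show A1: "A \<ge> 1" using K \<kappa> by (simp add: A_def)
    have "384 * K \<le> \<kappa> * A" using \<kappa> by (simp add: A_def distrib_left)
    then show "24 * K / A \<le> \<kappa> / 16" using A1 by (simp add: field_simps)
  qed
  define e where "e = \<kappa> / (96 * A)"
  have e: "e > 0" "6 * e * A = \<kappa> / 16" using \<kappa> A by (auto simp: e_def)
  define \<mu> where "\<mu> = min 1 (\<sigma>\<^sup>2)"
  have \<mu>: "\<mu> > 0" "\<mu> \<le> 1" using sigma_pos by (auto simp: \<mu>_def)
  define p where "p = 1 - \<theta> / 2"
  define b where "b = - 1/2 - rate"
  \<comment> \<open>For r = n powr q this gives n = r powr (2 + \<alpha>), the largest number of
    steps that \<open>killed_heat\<close> admits.\<close>
  define q where "q = 1/2 - \<theta>"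
  have q: "q = 1 / (2 + \<alpha>)" using alpha_pos by (simp add: q_def \<theta>_def field_simps)
  note th = theta_pos theta_le
  define m where "m n = nat \<lfloor>real n powr p\<rfloor>" for n :: nat
  have "filterlim m at_top sequentially"
    unfolding filterlim_at_top
  proof
    fix Z :: nat
    have "\<forall>\<^sub>F n in sequentially. real Z * real n powr 0 \<le> 1 * real n powr p"
      using th by (intro eventually_powr_le) (auto simp: p_def)
    then show "\<forall>\<^sub>F n in sequentially. Z \<le> m n"
      using eventually_gt_at_top[of 0]
      by eventually_elim (simp add: m_def le_nat_iff le_floor_iff)
  qed
  then have "\<forall>\<^sub>F n in sequentially. \<forall>z. \<bar>sqrt (real (m n)) * (free_step M ^^ m n) ?I z
            - d * heat (\<sigma>\<^sup>2) (z / sqrt (real (m n)))\<bar> \<le> e"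
    by (rule eventually_compose_filterlim[OF interval_local_limit[OF d e(1)]])
  moreover have "\<forall>\<^sub>F n in sequentially. 2 * real n powr 0 \<le> 1 * real n powr p"
    using th by (intro eventually_powr_le) (auto simp: p_def)
  moreover have "\<forall>\<^sub>F n in sequentially. 1 * real n powr p \<le> 1/2 * real n powr 1"
    using th by (intro eventually_powr_le) (auto simp: p_def)
  moreover have "\<forall>\<^sub>F n in sequentially. 1 * real n powr (2 * q) \<le> \<mu> / 2 * real n powr p"
    using th \<mu> by (intro eventually_powr_le) (auto simp: p_def q_def)
  \<comment> \<open>q - p = -1/2 - \<theta> / 2 is the exponent of the Lindeberg error r /
    m.\<close>
  moreover have "\<forall>\<^sub>F n in sequentially. C1 * 2 / \<mu> * real n powr (q - p) \<le> min 1 (\<kappa> / 8 / d) * real n powr b"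
    using th \<kappa> d by (intro eventually_powr_le) (auto simp: p_def q_def b_def rate_def)
  \<comment> \<open>The boundary value of the widest Gaussian. Its exponent -1/2 - \<theta> / 16 is
    the largest of all and is what limits \<open>rate\<close>.\<close>
  moreover have "\<forall>\<^sub>F n in sequentially. (2 * \<eta>\<^sup>2) * real n powr ((1 - \<theta> / 8) / 2 - 1) \<le> 1 * real n powr b"
    using th by (intro eventually_powr_le) (auto simp: b_def rate_def field_simps)
  moreover have "\<forall>\<^sub>F n in sequentially. (4 * K) * real n powr (p / 2 - (1 - \<theta> / 8)) \<le> \<kappa> / 8 * real n powr b"
    using th \<kappa> by (intro eventually_powr_le) (auto simp: p_def b_def rate_def field_simps)
  moreover have "\<forall>\<^sub>F n in sequentially. (C2 * \<eta>\<^sup>2) * real n powr (p / 2 - 1) \<le> \<kappa> / 8 * real n powr b"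
    using th \<kappa> by (intro eventually_powr_le) (auto simp: p_def b_def rate_def field_simps)
  moreover have "\<forall>\<^sub>F n in sequentially. (2 * d * \<sigma> * \<eta>\<^sup>2) * real n powr (p / 2 - 1) \<le> \<kappa> / 8 * real n powr b"
    using th \<kappa> by (intro eventually_powr_le) (auto simp: p_def b_def rate_def field_simps)
  moreover have "\<forall>\<^sub>F n in sequentially. A\<^sup>2 * real n powr p \<le> 1 * real n powr (1 - \<theta> / 8)"
    using th by (intro eventually_powr_le) (auto simp: p_def)
  moreover have "\<forall>\<^sub>F n in sequentially. \<forall>V w. \<sigma>\<^sup>2 * real n / 2 \<le> V \<longrightarrow> V \<le> \<sigma>\<^sup>2 * real n + real n powr (1 - \<theta> / 8) \<longrightarrow>
     heat V w \<le> 4 * heat (\<sigma>\<^sup>2 * real n) w + real n powr (- 1/2 - rate)"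
    using th sigma_pos by (intro heat_comparison) (auto simp: rate_def)
  ultimately show ?thesis
    using eventually_gt_at_top[of 0]
  proof eventually_elim
    case (elim n)
    define m' where "m' = m n"
    define N where "N = n - m'"
    define r where "r = real n powr q"
    define E where "E = C1 * r / (\<mu> * real m')"
    define Vmax where "Vmax = real n powr (1 - \<theta> / 8)"
    have n: "real n > 0" using elim by simp
    have x1: "real n powr p \<ge> 2" "real n powr p \<le> real n / 2" using elim n by auto
    have rm': "real m' = real_of_int \<lfloor>real n powr p\<rfloor>" using x1 by (simp add: m'_def m_def)
    have fl: "real m' \<le> real n powr p" "real n powr p < real m' + 1" unfolding rm' by linarith+
    have m1: "real m' \<le> real n powr p" "real n powr p / 2 \<le> real m'" "m' > 0"
    proof -
      show "real m' \<le> real n powr p" "real n powr p / 2 \<le> real m'" using fl x1 by linarith+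
      have "real m' > 0" using fl x1 by linarith
      then show "m' > 0" by simp
    qed
    have mn: "real m' \<le> real n / 2" "m' \<le> n" using m1 x1 by linarith+
    have Nm: "N + m' = n" using mn by (simp add: N_def)
    have N2: "real n / 2 \<le> real N" "real N \<le> real n" using mn by (auto simp: N_def of_nat_diff)
    have r: "r > 0" "real n = r powr (2 + \<alpha>)" using n alpha_pos by (auto simp: r_def q powr_powr)
    have rm: "r \<le> sqrt v" if v: "\<mu> * real m' \<le> v" for v
    proof -
      have "r\<^sup>2 = real n powr (2 * q)" using n by (simp add: r_def power2_eq_square powr_add[symmetric])
      also have "\<dots> \<le> \<mu> * (real n powr p / 2)" using elim by simp
      also have "\<dots> \<le> \<mu> * real m'" using m1 \<mu> by (intro mult_left_mono) auto
      finally have "r\<^sup>2 \<le> v" using v by linarith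
      then show ?thesis by (rule real_le_rsqrt)
    qed
    have Eb: "E \<le> min 1 (\<kappa> / 8 / d) * real n powr b"
    proof -
      have "E \<le> C1 * r / (\<mu> * (real n powr p / 2))"
        unfolding E_def using C1(1) r \<mu> m1 x1 by (intro divide_left_mono mult_left_mono mult_pos_pos) auto
      also have "\<dots> = C1 * 2 / \<mu> * real n powr (q - p)"
        using n by (simp add: r_def powr_diff)
      also have "\<dots> \<le> min 1 (\<kappa> / 8 / d) * real n powr b" using elim by blast
      finally show ?thesis .
    qed
    have E1: "E \<le> real n powr b" "d * E \<le> \<kappa> / 8 * real n powr b"
    proof -
      have "min 1 (\<kappa> / 8 / d) * real n powr b \<le> 1 * real n powr b" by (intro mult_right_mono) auto
      then show "E \<le> real n powr b" using Eb by linarith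
      have "min 1 (\<kappa> / 8 / d) * real n powr b \<le> (\<kappa> / 8 / d) * real n powr b" by (intro mult_right_mono) auto
      then have "d * E \<le> d * ((\<kappa> / 8 / d) * real n powr b)" using Eb d by (intro mult_left_mono) auto
      then show "d * E \<le> \<kappa> / 8 * real n powr b" using d by simp
    qed
    have kh: "\<bar>(killed_step M ^^ N) (\<lambda>z. heat v (z - y) - heat v (z + y)) x
        - (heat (v + real N * \<sigma>\<^sup>2) (x - y) - heat (v + real N * \<sigma>\<^sup>2) (x + y))\<bar> \<le> E"
      if v: "\<mu> * real m' \<le> v" and x: "x \<ge> 0" for v x y
    proof -
      have vp: "\<mu> * real m' > 0" using \<mu> m1 by simp
      then have "\<bar>(killed_step M ^^ N) (\<lambda>z. heat v (z - y) - heat v (z + y)) x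
        - (heat (v + real N * \<sigma>\<^sup>2) (x - y) - heat (v + real N * \<sigma>\<^sup>2) (x + y))\<bar> \<le> C1 * r / v"
        using v x r N2 by (intro C1(2) rm) auto
      also have "\<dots> \<le> E" unfolding E_def using v vp C1(1) r by (intro divide_left_mono) auto
      finally show ?thesis .
    qed
    have am: "A\<^sup>2 * real m' \<le> Vmax"
    proof -
      have "A\<^sup>2 * real m' \<le> A\<^sup>2 * real n powr p" using m1 by (intro mult_left_mono) auto
      then show ?thesis using elim by (simp add: Vmax_def)
    qed
    have amp: "A\<^sup>2 * real m' > 0" using A m1 by simp
    \<comment> \<open>The dyadic family is stopped within a factor 4 of \<open>Vmax\<close>: wide
      enough to make the constant past the cutoff negligible, narrow enough for
      \<open>heat_comparison\<close>.\<close>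
    obtain J :: nat where J: "4 ^ J \<le> Vmax / (A\<^sup>2 * real m')" "Vmax / (A\<^sup>2 * real m') < 4 ^ Suc J"
      using ex_power4_between[of "Vmax / (A\<^sup>2 * real m')"] am amp by (auto simp: le_divide_eq)
    have J1: "A\<^sup>2 * real m' * 4 ^ J \<le> Vmax" "Vmax / 4 \<le> A\<^sup>2 * real m' * 4 ^ J"
    proof -
      show "A\<^sup>2 * real m' * 4 ^ J \<le> Vmax"
        using J(1) unfolding pos_le_divide_eq[OF amp] by (simp add: ac_simps)
      have "Vmax < 4 ^ Suc J * (A\<^sup>2 * real m')" using J(2) unfolding pos_divide_less_eq[OF amp] .
      also have "\<dots> = 4 * (A\<^sup>2 * real m' * 4 ^ J)" by (simp add: ac_simps)
      finally show "Vmax / 4 \<le> A\<^sup>2 * real m' * 4 ^ J" by linarith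
    qed
    have Vmp: "Vmax > 0" using n by (simp add: Vmax_def)
    have sm: "sqrt (real m') \<le> real n powr (p / 2)"
    proof -
      have "sqrt (real m') \<le> sqrt (real n powr p)" using m1 by simp
      also have "\<dots> = real n powr (p / 2)" using n by (simp add: powr_half_sqrt[symmetric] powr_powr)
      finally show ?thesis .
    qed
    show ?case
    proof (intro allI impI)
      fix x y :: real
      assume x: "x \<ge> 0" and y: "sqrt (real n) / \<eta> \<le> y"
      have yp: "y > 0" using y n \<eta> by (meson divide_pos_pos less_le_trans real_sqrt_gt_zero)
      have y2: "real n / \<eta>\<^sup>2 \<le> y\<^sup>2"
        using power_mono[OF y, of 2] n \<eta> by (simp add: power_divide)
      have over_y: "a / y\<^sup>2 \<le> a * \<eta>\<^sup>2 / real n" if "a \<ge> 0" for a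
      proof -
        have "a / y\<^sup>2 \<le> a / (real n / \<eta>\<^sup>2)" using y2 that yp n \<eta> by (intro divide_left_mono) auto
        then show ?thesis by simp
      qed
      let ?g = "\<lambda>z. ?I (z - y)" and ?h = "(free_step M ^^ m') ?I"
      let ?H = "heat (\<sigma>\<^sup>2 * real n) (x - y)"
      \<comment> \<open>A path below 0 is at distance at least y from the target, so
        \<open>interval_tail\<close> bounds its mass for each number j < m' of remaining
        steps.\<close>
      define B where "B = C2 * sqrt (real m') / y\<^sup>2"
      have B0: "B \<ge> 0" using C2 by (simp add: B_def)
      have gb: "?g \<in> bdd_borel" using bdd_borel_shift[OF Ib, of "- y"] by simp
      have hb: "?h \<in> bdd_borel" by (intro free_pow_bdd_borel Ib)
      have Pg: "(free_step M ^^ j) ?g z = (free_step M ^^ j) ?I (z - y)" for j z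
        using free_pow_shift[of j ?I "- y" z] by simp
      have gh: "\<bar>(killed_step M ^^ m') ?g z - ?h (z - y)\<bar> \<le> B" for z
      proof -
        have "(free_step M ^^ m') ?g z - (killed_step M ^^ m') ?g z \<le> B"
        proof (rule free_pow_minus_killed_pow[OF gb _ B0])
          fix j and w :: real assume j: "j < m'" and w: "w < 0"
          have nn: "0 \<le> (free_step M ^^ j) ?I (w - y)" by (intro free_pow_nonneg Ib) simp
          have "y\<^sup>2 \<le> (w - y)\<^sup>2" using w yp by (simp add: abs_le_square_iff[symmetric])
          then have "y\<^sup>2 * (free_step M ^^ j) ?I (w - y) \<le> (w - y)\<^sup>2 * (free_step M ^^ j) ?I (w - y)"
            using nn by (intro mult_right_mono)
          also have "\<dots> \<le> C2 * sqrt (real j + 1)" by (rule C2(2))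
          also have "\<dots> \<le> C2 * sqrt (real m')" using j C2(1) by (intro mult_left_mono) auto
          finally show "(free_step M ^^ j) ?g w \<le> B" unfolding Pg B_def using yp by (simp add: le_divide_eq mult.commute)
        qed
        moreover have "(killed_step M ^^ m') ?g z \<le> (free_step M ^^ m') ?g z"
          by (intro killed_pow_le_free_pow gb) simp
        ultimately show ?thesis unfolding Pg by simp
      qed
      have tail: "z\<^sup>2 * ?h z \<le> 2 * C2 * sqrt (real m')" for z
      proof -
        have "sqrt (real m' + 1) \<le> sqrt (4 * real m')" using m1 by (intro real_sqrt_le_mono) linarith
        also have "\<dots> = 2 * sqrt (real m')" by (simp only: real_sqrt_mult real_sqrt_four)
        finally have "C2 * sqrt (real m' + 1) \<le> C2 * (2 * sqrt (real m'))" using C2(1) by (intro mult_left_mono)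
        then show ?thesis using C2(2)[of z m'] by simp
      qed
      \<comment> \<open>One power of n comes from \<open>heat_comparison\<close>, one bounds the
        Lindeberg error and one the boundary value of the kernel.\<close>
      define Q where "Q = 4 * ?H + 3 * real n powr b"
      have Q: "heat (V + real N * \<sigma>\<^sup>2) (x - y) + E + heat V y \<le> Q" if V: "real m' \<le> V" "V \<le> Vmax" for V
      proof -
        have Vp: "V > 0" using V m1 by linarith
        have "\<sigma>\<^sup>2 * (real n / 2) \<le> \<sigma>\<^sup>2 * real N" "\<sigma>\<^sup>2 * real N \<le> \<sigma>\<^sup>2 * real n"
          using N2 by (intro mult_left_mono; simp)+
        then have "\<sigma>\<^sup>2 * real n / 2 \<le> V + real N * \<sigma>\<^sup>2" "V + real N * \<sigma>\<^sup>2 \<le> \<sigma>\<^sup>2 * real n + real n powr (1 - \<theta> / 8)"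
          using Vp V by (simp_all add: Vmax_def mult.commute)
        then have 1: "heat (V + real N * \<sigma>\<^sup>2) (x - y) \<le> 4 * ?H + real n powr b"
          using elim by (simp add: b_def)
        have "heat V y \<le> 2 * sqrt V / y\<^sup>2" using heat_tail[OF Vp, of y] yp by (simp add: le_divide_eq mult.commute)
        also have "\<dots> \<le> 2 * sqrt V * \<eta>\<^sup>2 / real n" using Vp by (intro over_y) auto
        also have "\<dots> \<le> 2 * real n powr ((1 - \<theta> / 8) / 2) * \<eta>\<^sup>2 / real n"
        proof -
          have "sqrt V \<le> sqrt Vmax" using V by simp
          also have "\<dots> = real n powr ((1 - \<theta> / 8) / 2)"
            using n by (simp add: Vmax_def powr_half_sqrt[symmetric] powr_powr)
          finally show ?thesis using n by (intro divide_right_mono mult_right_mono mult_left_mono) auto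
        qed
        also have "\<dots> = (2 * \<eta>\<^sup>2) * real n powr ((1 - \<theta> / 8) / 2 - 1)"
          using n by (simp add: powr_diff)
        also have "\<dots> \<le> real n powr b" using elim by simp
        finally show ?thesis using 1 E1(1) by (simp add: Q_def)
      qed
      have core: "\<bar>(killed_step M ^^ (N + m')) ?g x - d * (heat (real (N + m') * \<sigma>\<^sup>2) (x - y) - heat (real (N + m') * \<sigma>\<^sup>2) (x + y))\<bar>
        \<le> d * E + B + d * heat (\<sigma>\<^sup>2 * real m') y + (6 * e * A + 24 * (2 * C2 + 2 * d * \<sigma>) / A) * Q
          + (2 * C2 + 2 * d * \<sigma>) * sqrt (real m') / (A\<^sup>2 * real m' * 4 ^ J)"
      proof (rule killed_local_core[where h = ?h and Vmax = Vmax])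
        show "\<bar>sqrt (real m') * ?h z - d * heat (\<sigma>\<^sup>2) (z / sqrt (real m'))\<bar> \<le> e" for z
          using elim(1) by (simp add: m'_def)
        show "0 \<le> ?h z" for z by (intro free_pow_nonneg Ib) simp
      qed (use m1 x yp d gb hb gh tail kh Q A J1 in \<open>auto simp: \<mu>_def\<close>)
      have c1: "B \<le> \<kappa> / 8 * real n powr b"
      proof -
        have "B \<le> C2 * sqrt (real m') * \<eta>\<^sup>2 / real n" unfolding B_def using C2 by (intro over_y) auto
        also have "\<dots> \<le> C2 * real n powr (p / 2) * \<eta>\<^sup>2 / real n"
          using sm C2 n by (intro divide_right_mono mult_right_mono mult_left_mono) auto
        also have "\<dots> = (C2 * \<eta>\<^sup>2) * real n powr (p / 2 - 1)" using n by (simp add: powr_diff)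
        finally show ?thesis using elim by linarith
      qed
      have c2: "d * heat (\<sigma>\<^sup>2 * real m') y \<le> \<kappa> / 8 * real n powr b"
      proof -
        have vp: "\<sigma>\<^sup>2 * real m' > 0" using sigma_pos m1 by simp
        have "heat (\<sigma>\<^sup>2 * real m') y \<le> 2 * sqrt (\<sigma>\<^sup>2 * real m') / y\<^sup>2"
          using heat_tail[OF vp, of y] yp by (simp add: le_divide_eq mult.commute)
        also have "\<dots> \<le> 2 * sqrt (\<sigma>\<^sup>2 * real m') * \<eta>\<^sup>2 / real n" using vp by (intro over_y) auto
        also have "sqrt (\<sigma>\<^sup>2 * real m') = \<sigma> * sqrt (real m')" using sigma_pos by (simp add: real_sqrt_mult)
        also have "2 * (\<sigma> * sqrt (real m')) * \<eta>\<^sup>2 / real n \<le> 2 * (\<sigma> * real n powr (p / 2)) * \<eta>\<^sup>2 / real n"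
          using sm sigma_pos n by (intro divide_right_mono mult_right_mono mult_left_mono) auto
        also have "\<dots> = (2 * \<sigma> * \<eta>\<^sup>2) * real n powr (p / 2 - 1)" using n by (simp add: powr_diff)
        finally have "d * heat (\<sigma>\<^sup>2 * real m') y \<le> d * ((2 * \<sigma> * \<eta>\<^sup>2) * real n powr (p / 2 - 1))"
          using d by (intro mult_left_mono) auto
        also have "\<dots> = (2 * d * \<sigma> * \<eta>\<^sup>2) * real n powr (p / 2 - 1)" by simp
        finally show ?thesis using elim by linarith
      qed
      have c3: "K * sqrt (real m') / (A\<^sup>2 * real m' * 4 ^ J) \<le> \<kappa> / 8 * real n powr b"
      proof -
        have "K * sqrt (real m') / (A\<^sup>2 * real m' * 4 ^ J) \<le> K * real n powr (p / 2) / (Vmax / 4)"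
          using sm K J1 Vmp by (intro frac_le mult_left_mono) auto
        also have "\<dots> = (4 * K) * real n powr (p / 2 - (1 - \<theta> / 8))"
          using n by (simp add: Vmax_def powr_diff)
        finally show ?thesis using elim by linarith
      qed
      have c4: "(6 * e * A + 24 * K / A) * Q \<le> \<kappa> / 8 * Q"
      proof (rule mult_right_mono)
        show "6 * e * A + 24 * K / A \<le> \<kappa> / 8" using e A by linarith
        show "0 \<le> Q" using heat_nonneg[of "\<sigma>\<^sup>2 * real n" "x - y"] by (simp add: Q_def)
      qed
      have "\<bar>(killed_step M ^^ n) ?g x - d * (heat (\<sigma>\<^sup>2 * real n) (x - y) - heat (\<sigma>\<^sup>2 * real n) (x + y))\<bar>
          \<le> \<kappa> / 8 * real n powr b + \<kappa> / 8 * real n powr b + \<kappa> / 8 * real n powr b + \<kappa> / 8 * Q + \<kappa> / 8 * real n powr b"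
        using core E1(2) c1 c2 c3 c4 unfolding Nm K_def[symmetric] mult.commute[of "real n" "\<sigma>\<^sup>2"] by linarith
      also have "\<dots> = \<kappa> / 2 * ?H + 7 * \<kappa> / 8 * real n powr b" by (simp add: Q_def algebra_simps)
      also have "\<dots> \<le> \<kappa> * ?H + \<kappa> * real n powr b"
        using \<kappa> heat_nonneg[of "\<sigma>\<^sup>2 * real n" "x - y"] by (intro add_mono mult_right_mono) auto
      finally show "\<bar>(killed_step M ^^ n) ?g x - d * (heat (\<sigma>\<^sup>2 * real n) (x - y) - heat (\<sigma>\<^sup>2 * real n) (x + y))\<bar>
          \<le> \<kappa> * (?H + real n powr (- 1/2 - rate))"
        by (simp add: b_def distrib_left)
    qed
  qed
qed

end

section \<open>Killed expectations\<close>

lemma less_exit_time_iff: "enat n < exit_time X x \<omega> \<longleftrightarrow> (\<forall>k\<in>{1..n}. 0 \<le> x + walk X k \<omega>)"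
proof
  assume less: "enat n < exit_time X x \<omega>"
  show "\<forall>k\<in>{1..n}. 0 \<le> x + walk X k \<omega>"
  proof (rule ballI, rule ccontr)
    fix k assume k: "k \<in> {1..n}" "\<not> 0 \<le> x + walk X k \<omega>"
    then have "exit_time X x \<omega> \<le> enat k"
      unfolding exit_time_def by (intro Inf_lower) auto
    also have "\<dots> \<le> enat n" using k by simp
    finally show False using less by simp
  qed
next
  assume all: "\<forall>k\<in>{1..n}. 0 \<le> x + walk X k \<omega>"
  have "enat (Suc n) \<le> exit_time X x \<omega>"
    unfolding exit_time_def
  proof (rule Inf_greatest)
    fix e assume "e \<in> enat ` {k. 1 \<le> k \<and> x + walk X k \<omega> < 0}"
    then obtain k where k: "e = enat k" "1 \<le> k" "x + walk X k \<omega> < 0" by auto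
    then have "\<not> k \<le> n" using all by force
    then show "enat (Suc n) \<le> e" using k by simp
  qed
  then show "enat n < exit_time X x \<omega>" by (rule less_le_trans[rotated]) simp
qed

text \<open>The last increment is independent of the first n and becomes one application of
  \<open>killed_step\<close> to the test function. Hence the induction generalises over
  \<open>g\<close>, and the new operator enters at the right end of the iterate.\<close>

lemma (in prob_space) killed_expectation:
  fixes X :: "nat \<Rightarrow> 'a \<Rightarrow> real"
  assumes indep: "indep_vars (\<lambda>_. borel) X {1..}"
    and ident: "\<And>i. i \<ge> 1 \<Longrightarrow> distr M borel (X i) = \<mu>" and g: "g \<in> bdd_borel"
  shows "(\<integral>\<omega>. (if \<forall>k\<in>{1..n}. 0 \<le> x + walk X k \<omega> then g (x + walk X n \<omega>) else 0) \<partial>M) = (killed_step \<mu> ^^ n) g x"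
  using g
proof (induction n arbitrary: g)
  case 0
  then show ?case by (simp add: walk_def prob_space)
next
  case (Suc n)
  have rv: "random_variable borel (X i)" if "i \<ge> 1" for i
    using indep that by (auto simp: indep_vars_def)
  have [measurable]: "X (Suc n) \<in> borel_measurable M" by (rule rv) simp
  interpret \<mu>: real_distribution \<mu>
    using ident[of "Suc n"] real_distribution_distr[of "X (Suc n)"] by simp
  define G where "G z = indicator {0..} z * g z" for z :: real
  have Gb: "G \<in> bdd_borel" unfolding G_def[abs_def] by (rule bdd_borel_restrict[OF Suc.prems])
  obtain B where B: "\<And>z. \<bar>G z\<bar> \<le> B" "B \<ge> 0" using Gb by (rule bdd_borelE) auto
  have [measurable]: "G \<in> borel_measurable borel" using Gb by (rule bdd_borel_measurable)
  \<comment> \<open>Survival flag and position: all that the next step needs to know about the first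
    n increments.\<close>
  define F where "F p = (if \<forall>k\<in>{1..n}. 0 \<le> x + (\<Sum>i=1..k. p i) then 1 else (0::real), \<Sum>i=1..n. p i :: real)" for p :: "nat \<Rightarrow> real"
  define Y where "Y \<omega> = F (\<lambda>i\<in>{1..n}. X i \<omega>)" for \<omega>
  have Y: "Y \<omega> = (if \<forall>k\<in>{1..n}. 0 \<le> x + walk X k \<omega> then 1 else 0, walk X n \<omega>)" for \<omega>
    by (simp add: Y_def F_def walk_def)
  have comp: "(\<lambda>p. p i) \<in> borel_measurable (Pi\<^sub>M {1..n} (\<lambda>_. borel :: real measure))" if "i \<in> {1..n}" for i
    using that by (rule measurable_component_singleton)
  have psum: "(\<lambda>p. \<Sum>i=1..k. p i) \<in> borel_measurable (Pi\<^sub>M {1..n} (\<lambda>_. borel :: real measure))" if "k \<le> n" for k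
    using that by (intro borel_measurable_sum comp) auto
  have Fm: "F \<in> Pi\<^sub>M {1..n} (\<lambda>_. borel) \<rightarrow>\<^sub>M borel \<Otimes>\<^sub>M borel"
    unfolding F_def[abs_def]
  proof (intro measurable_Pair measurable_If psum)
    have "{p \<in> space (Pi\<^sub>M {1..n} (\<lambda>_. borel)). \<forall>k\<in>{1..n}. 0 \<le> x + (\<Sum>i=1..k. p i)} \<in> sets (Pi\<^sub>M {1..n} (\<lambda>_. borel :: real measure))"
    proof (cases "n = 0")
      case False
      then show ?thesis
        using psum by (intro sets.sets_Collect_finite_All' borel_measurable_le borel_measurable_add borel_measurable_const) auto
    qed simp
    then show "{p \<in> space (Pi\<^sub>M {1..n} (\<lambda>_. borel)). \<forall>k\<in>{1..n}. 0 \<le> x + (\<Sum>i=1..k. p i)} \<in> sets (Pi\<^sub>M {1..n} (\<lambda>_. borel :: real measure))" .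
  qed auto
  \<comment> \<open>The dummy coordinate gives \<open>Z\<close> the type of \<open>Y\<close>, as
    \<open>indep_var\<close> asks for.\<close>
  define Z where "Z \<omega> = (0 :: real, X (Suc n) \<omega>)" for \<omega>
  have ind: "indep_var (borel \<Otimes>\<^sub>M borel) Y (borel \<Otimes>\<^sub>M borel) Z"
  proof -
    have "indep_var (Pi\<^sub>M {1..n} (\<lambda>_. borel)) (\<lambda>\<omega>. \<lambda>i\<in>{1..n}. X i \<omega>) (Pi\<^sub>M {Suc n} (\<lambda>_. borel)) (\<lambda>\<omega>. \<lambda>i\<in>{Suc n}. X i \<omega>)"
      by (rule indep_var_restrict[OF indep]) auto
    then have "indep_var (borel \<Otimes>\<^sub>M borel) (F \<circ> (\<lambda>\<omega>. \<lambda>i\<in>{1..n}. X i \<omega>)) (borel \<Otimes>\<^sub>M borel) ((\<lambda>p. (0, p (Suc n))) \<circ> (\<lambda>\<omega>. \<lambda>i\<in>{Suc n}. X i \<omega>))"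
      by (rule indep_var_compose[OF _ Fm]) (intro measurable_Pair measurable_const measurable_component_singleton, auto)
    then show ?thesis by (simp add: comp_def Y_def[abs_def] Z_def[abs_def])
  qed
  have Zm [measurable]: "Z \<in> M \<rightarrow>\<^sub>M borel \<Otimes>\<^sub>M borel" using ind by (rule indep_var_rv2)
  have Ym [measurable]: "Y \<in> M \<rightarrow>\<^sub>M borel \<Otimes>\<^sub>M borel" using ind by (rule indep_var_rv1)
  interpret Yd: prob_space "distr M (borel \<Otimes>\<^sub>M borel) Y" by (rule prob_space_distr) fact
  interpret Zd: prob_space "distr M (borel \<Otimes>\<^sub>M borel) Z" by (rule prob_space_distr) fact
  interpret P: pair_prob_space "distr M (borel \<Otimes>\<^sub>M borel) Y" "distr M (borel \<Otimes>\<^sub>M borel) Z" ..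
  let ?\<phi> = "\<lambda>p :: (real \<times> real) \<times> (real \<times> real). indicator {1} (fst (fst p)) * G (x + snd (fst p) + snd (snd p)) :: real"
  let ?BB = "(borel \<Otimes>\<^sub>M borel) \<Otimes>\<^sub>M (borel \<Otimes>\<^sub>M borel) :: ((real \<times> real) \<times> (real \<times> real)) measure"
  have pr: "(\<lambda>p. fst (fst p)) \<in> borel_measurable ?BB" "(\<lambda>p. snd (fst p)) \<in> borel_measurable ?BB"
      "(\<lambda>p. snd (snd p)) \<in> borel_measurable ?BB"
    by (rule measurable_compose[OF measurable_fst measurable_fst] measurable_compose[OF measurable_fst measurable_snd]
        measurable_compose[OF measurable_snd measurable_snd])+
  have \<phi>m: "?\<phi> \<in> borel_measurable ?BB"
    by (intro borel_measurable_times measurable_compose[OF pr(1) borel_measurable_indicator]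
        measurable_compose[OF _ \<open>G \<in> borel_measurable borel\<close>] borel_measurable_add borel_measurable_const pr) auto
  have step: "(if \<forall>k\<in>{1..Suc n}. 0 \<le> x + walk X k \<omega> then g (x + walk X (Suc n) \<omega>) else 0) = ?\<phi> (Y \<omega>, Z \<omega>)" for \<omega>
  proof -
    have w: "walk X (Suc n) \<omega> = walk X n \<omega> + X (Suc n) \<omega>" by (simp add: walk_def)
    have "{1..Suc n} = insert (Suc n) {1..n}" by auto
    then show ?thesis by (auto simp: Y Z_def G_def w indicator_def add.assoc)
  qed
  have "(\<integral>\<omega>. (if \<forall>k\<in>{1..Suc n}. 0 \<le> x + walk X k \<omega> then g (x + walk X (Suc n) \<omega>) else 0) \<partial>M)
      = (\<integral>\<omega>. ?\<phi> (Y \<omega>, Z \<omega>) \<partial>M)" unfolding step ..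
  also have "\<dots> = (\<integral>p. ?\<phi> p \<partial>distr M ((borel \<Otimes>\<^sub>M borel) \<Otimes>\<^sub>M (borel \<Otimes>\<^sub>M borel)) (\<lambda>\<omega>. (Y \<omega>, Z \<omega>)))"
    by (subst integral_distr) (auto simp: \<phi>m)
  also have "distr M ((borel \<Otimes>\<^sub>M borel) \<Otimes>\<^sub>M (borel \<Otimes>\<^sub>M borel)) (\<lambda>\<omega>. (Y \<omega>, Z \<omega>))
      = distr M (borel \<Otimes>\<^sub>M borel) Y \<Otimes>\<^sub>M distr M (borel \<Otimes>\<^sub>M borel) Z"
    using ind by (simp add: indep_var_distribution_eq)
  also have "(\<integral>p. ?\<phi> p \<partial>(distr M (borel \<Otimes>\<^sub>M borel) Y \<Otimes>\<^sub>M distr M (borel \<Otimes>\<^sub>M borel) Z))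
      = (\<integral>a. (\<integral>b. ?\<phi> (a, b) \<partial>distr M (borel \<Otimes>\<^sub>M borel) Z) \<partial>distr M (borel \<Otimes>\<^sub>M borel) Y)"
  proof (rule P.integral_fst'[symmetric], rule P.integrable_const_bound[of _ B])
    show "AE p in distr M (borel \<Otimes>\<^sub>M borel) Y \<Otimes>\<^sub>M distr M (borel \<Otimes>\<^sub>M borel) Z. norm (?\<phi> p) \<le> B"
      using B by (intro AE_I2) (auto simp: indicator_def)
    show "?\<phi> \<in> borel_measurable (distr M (borel \<Otimes>\<^sub>M borel) Y \<Otimes>\<^sub>M distr M (borel \<Otimes>\<^sub>M borel) Z)"
      using \<phi>m by (simp cong: measurable_cong_sets)
  qed
  also have "\<dots> = (\<integral>\<omega>. (\<integral>b. ?\<phi> (Y \<omega>, b) \<partial>distr M (borel \<Otimes>\<^sub>M borel) Z) \<partial>M)"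
  proof (rule integral_distr[OF Ym])
    show "(\<lambda>a. \<integral>b. ?\<phi> (a, b) \<partial>distr M (borel \<Otimes>\<^sub>M borel) Z) \<in> borel_measurable (borel \<Otimes>\<^sub>M borel)"
    proof (rule Zd.borel_measurable_lebesgue_integral)
      have s: "sets ((borel \<Otimes>\<^sub>M borel :: (real \<times> real) measure) \<Otimes>\<^sub>M distr M (borel \<Otimes>\<^sub>M borel) Z) = sets ?BB"
        by (intro sets_pair_measure_cong) auto
      show "(\<lambda>(a, b). ?\<phi> (a, b)) \<in> borel_measurable ((borel \<Otimes>\<^sub>M borel) \<Otimes>\<^sub>M distr M (borel \<Otimes>\<^sub>M borel) Z)"
      proof -
        have "?\<phi> \<in> borel_measurable ((borel \<Otimes>\<^sub>M borel :: (real \<times> real) measure) \<Otimes>\<^sub>M distr M (borel \<Otimes>\<^sub>M borel) Z)"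
          using \<phi>m measurable_cong_sets[OF s refl] by blast
        moreover have "(\<lambda>(a, b). ?\<phi> (a, b)) = ?\<phi>" by (auto simp: fun_eq_iff)
        ultimately show ?thesis by (simp only:)
      qed
    qed
  qed
  also have "\<dots> = (\<integral>\<omega>. (if \<forall>k\<in>{1..n}. 0 \<le> x + walk X k \<omega> then killed_step \<mu> g (x + walk X n \<omega>) else 0) \<partial>M)"
  proof (rule Bochner_Integration.integral_cong[OF refl])
    fix \<omega>
    have "(\<integral>b. ?\<phi> (Y \<omega>, b) \<partial>distr M (borel \<Otimes>\<^sub>M borel) Z) = (\<integral>w. indicator {1} (fst (Y \<omega>)) * G (x + snd (Y \<omega>) + X (Suc n) w) \<partial>M)"
      by (subst integral_distr[OF Zm]) (auto simp: Z_def)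
    also have "\<dots> = (\<integral>t. indicator {1} (fst (Y \<omega>)) * G (x + snd (Y \<omega>) + t) \<partial>distr M borel (X (Suc n)))"
      by (subst integral_distr) auto
    also have "distr M borel (X (Suc n)) = \<mu>" using ident by simp
    finally show "(\<integral>b. ?\<phi> (Y \<omega>, b) \<partial>distr M (borel \<Otimes>\<^sub>M borel) Z) =
        (if \<forall>k\<in>{1..n}. 0 \<le> x + walk X k \<omega> then killed_step \<mu> g (x + walk X n \<omega>) else 0)"
      by (auto simp: Y G_def killed_step_def)
  qed
  also have "\<dots> = (killed_step \<mu> ^^ n) (killed_step \<mu> g) x"
    by (rule Suc.IH) (rule \<mu>.killed_step_bdd_borel[OF Suc.prems])
  finally show ?case by (simp only: funpow_Suc_right o_apply)
qed

section \<open>Directly Riemann integrable functions and step functions\<close>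

lemma grid_interval_unique:
  assumes "d > 0" "u \<in> grid_interval d j" "u \<in> grid_interval d k" shows "j = k"
proof -
  have "real_of_int j * d < (real_of_int k + 1) * d" "real_of_int k * d < (real_of_int j + 1) * d"
    using assms(2,3) by (auto simp: grid_interval_def)
  then have "real_of_int j < real_of_int k + 1" "real_of_int k < real_of_int j + 1"
    using assms(1) by (simp_all only: mult_less_cancel_right_pos)
  then show ?thesis by linarith
qed

lemma infsum_grid_interval:
  fixes c :: "int \<Rightarrow> ennreal"
  assumes "d > 0" "u \<in> grid_interval d k"
  shows "(\<Sum>\<^sub>\<infinity>j::int. indicator (grid_interval d j) u * c j) = c k"
proof -
  have "(\<Sum>\<^sub>\<infinity>j::int. indicator (grid_interval d j) u * c j) = (\<Sum>\<^sub>\<infinity>j\<in>{k}. indicator (grid_interval d j) u * c j)"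
    using assms grid_interval_unique[OF assms(1)] by (intro infsum_cong_neutral) (auto simp: indicator_def)
  also have "\<dots> = c k" using assms by simp
  finally show ?thesis .
qed

lemma upper_envelope_eq:
  "d > 0 \<Longrightarrow> u \<in> grid_interval d k \<Longrightarrow> upper_envelope f d u = (SUP v\<in>grid_interval d k. ennreal (f v))"
  unfolding upper_envelope_def by (rule infsum_grid_interval)

lemma lower_envelope_eq:
  "d > 0 \<Longrightarrow> u \<in> grid_interval d k \<Longrightarrow> lower_envelope f d u = (INF v\<in>grid_interval d k. ennreal (f v))"
  unfolding lower_envelope_def by (rule infsum_grid_interval)

lemma emeasure_grid_interval: "d > 0 \<Longrightarrow> emeasure lborel (grid_interval d k) = ennreal d"
  unfolding grid_interval_def by (subst emeasure_lborel_Ico) (auto simp: algebra_simps)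

lemma grid_interval_measurable [measurable]: "grid_interval d k \<in> sets borel"
  unfolding grid_interval_def by measurable

text \<open>\<open>nn_integral\<close> is monotone for arbitrary integrands, so the envelopes can be
  put for \<open>h\<close> directly.\<close>

lemma sum_le_nn_integral_grid:
  fixes c :: "nat \<Rightarrow> ennreal"
  assumes d: "d > 0" and h: "\<And>k u. u \<in> grid_interval d (int k) \<Longrightarrow> c k \<le> h u"
  shows "(\<Sum>k<n. c k * ennreal d) \<le> (\<integral>\<^sup>+u. h u \<partial>lborel)"
proof -
  have "(\<Sum>k<n. c k * ennreal d) = (\<Sum>k<n. \<integral>\<^sup>+u. c k * indicator (grid_interval d (int k)) u \<partial>lborel)"
    using d by (simp add: nn_integral_cmult_indicator emeasure_grid_interval)
  also have "\<dots> = (\<integral>\<^sup>+u. (\<Sum>k<n. c k * indicator (grid_interval d (int k)) u) \<partial>lborel)"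
    by (subst nn_integral_sum) auto
  also have "\<dots> \<le> (\<integral>\<^sup>+u. h u \<partial>lborel)"
  proof (rule nn_integral_mono)
    fix u
    show "(\<Sum>k<n. c k * indicator (grid_interval d (int k)) u) \<le> h u"
    proof (cases "\<exists>k<n. u \<in> grid_interval d (int k)")
      case True
      then obtain k where k: "k < n" "u \<in> grid_interval d (int k)" by auto
      have "(\<Sum>j<n. c j * indicator (grid_interval d (int j)) u) = (\<Sum>j\<in>{k}. c j * indicator (grid_interval d (int j)) u)"
      proof (intro sum.mono_neutral_right)
        have "i = k" if "u \<in> grid_interval d (int i)" for i
          using grid_interval_unique[OF d that k(2)] by simp
        then show "\<forall>i\<in>{..<n} - {k}. c i * indicator (grid_interval d (int i)) u = 0"
          by (auto simp: indicator_def)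
      qed (use k in auto)
      also have "\<dots> \<le> h u" using k h by simp
      finally show ?thesis .
    next
      case False
      then have "(\<Sum>k<n. c k * indicator (grid_interval d (int k)) u) = 0"
        by (intro sum.neutral) (auto simp: indicator_def)
      then show ?thesis by simp
    qed
  qed
  finally show ?thesis .
qed

text \<open>One mesh is fixed at which the upper envelope has finite integral and the envelopes are
  \<epsilon>-close in L1; the cell suprema and infima become real sequences. Cells with k >= 0
  suffice for functions that vanish on the negative half-line.\<close>

lemma directly_Riemann_integrable_step_bounds:
  assumes f: "nonneg_directly_Riemann_integrable f" and \<epsilon>: "\<epsilon> > 0"
  shows "\<exists>d>0. \<exists>U L. summable U \<and> (\<forall>k::nat. 0 \<le> L k \<and> L k \<le> U k) \<and>
     (\<forall>k t. t \<in> grid_interval d (int k) \<longrightarrow> L k \<le> f t \<and> f t \<le> U k) \<and> d * (suminf U - suminf L) \<le> (\<epsilon>::real)"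
proof -
  have f0: "\<And>t. 0 \<le> f t" using f by (auto simp: nonneg_directly_Riemann_integrable_def)
  have "\<forall>\<^sub>F d in at_right 0. (\<integral>\<^sup>+u. upper_envelope f d u \<partial>lborel) < \<infinity>"
    using f by (simp add: nonneg_directly_Riemann_integrable_def)
  moreover have "\<forall>\<^sub>F d in at_right 0. (\<integral>\<^sup>+u. (upper_envelope f d u - lower_envelope f d u) \<partial>lborel) < ennreal \<epsilon>"
    using f \<epsilon> by (intro order_tendstoD(2)[where y = 0]) (auto simp: nonneg_directly_Riemann_integrable_def)
  moreover have "\<forall>\<^sub>F d in at_right 0. (d::real) > 0" by (rule eventually_at_right_less)
  ultimately have "\<forall>\<^sub>F d in at_right 0. (\<integral>\<^sup>+u. upper_envelope f d u \<partial>lborel) < \<infinity> \<and>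
      (\<integral>\<^sup>+u. (upper_envelope f d u - lower_envelope f d u) \<partial>lborel) < ennreal \<epsilon> \<and> (d::real) > 0"
    by eventually_elim auto
  then obtain d where d: "(\<integral>\<^sup>+u. upper_envelope f d u \<partial>lborel) < \<infinity>"
      "(\<integral>\<^sup>+u. (upper_envelope f d u - lower_envelope f d u) \<partial>lborel) < ennreal \<epsilon>" "d > 0"
    using eventually_happens[of _ "at_right (0::real)"] by (auto simp: trivial_limit_at_right_real)
  define Us where "Us k = (SUP v\<in>grid_interval d (int k). ennreal (f v))" for k
  define Ls where "Ls k = (INF v\<in>grid_interval d (int k). ennreal (f v))" for k
  have ne: "real k * d \<in> grid_interval d (int k)" for k using d(3) by (simp add: grid_interval_def)
  have sU: "(\<Sum>k<n. Us k * ennreal d) \<le> (\<integral>\<^sup>+u. upper_envelope f d u \<partial>lborel)" for n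
    using d(3) by (intro sum_le_nn_integral_grid) (auto simp: upper_envelope_eq Us_def)
  have sUL: "(\<Sum>k<n. (Us k - Ls k) * ennreal d) \<le> (\<integral>\<^sup>+u. (upper_envelope f d u - lower_envelope f d u) \<partial>lborel)" for n
    using d(3) by (intro sum_le_nn_integral_grid) (auto simp: upper_envelope_eq lower_envelope_eq Us_def Ls_def)
  \<comment> \<open>An infinite supremum on a single cell would make the integral of the upper
    envelope infinite.\<close>
  have Ufin: "Us k < \<top>" for k
  proof (rule ccontr)
    assume "\<not> Us k < \<top>"
    then have "Us k = \<top>" using less_top by blast
    then have "Us k * ennreal d = \<top>" using d(3) by (simp add: ennreal_top_mult)
    moreover have "Us k * ennreal d \<le> (\<Sum>j<Suc k. Us j * ennreal d)" by simp
    ultimately show False using sU[of "Suc k"] d(1) by (simp add: top_unique)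
  qed
  have LU: "Ls k \<le> Us k" for k
    unfolding Ls_def Us_def using ne by (meson INF_lower SUP_upper order_trans)
  have Lfin: "Ls k < \<top>" for k using LU[of k] Ufin[of k] by (rule le_less_trans)
  define U where "U k = enn2real (Us k)" for k
  define L where "L k = enn2real (Ls k)" for k
  have eU: "ennreal (U k) = Us k" and eL: "ennreal (L k) = Ls k" for k
    using Ufin Lfin by (simp_all add: U_def L_def)
  have UL: "0 \<le> L k" "L k \<le> U k" for k
    using LU[of k] Ufin[of k] by (auto simp: L_def U_def intro: enn2real_mono)
  have U0: "0 \<le> U k" for k using UL[of k] by linarith
  have bounds: "L k \<le> f t \<and> f t \<le> U k" if "t \<in> grid_interval d (int k)" for k t
  proof
    have "ennreal (L k) \<le> ennreal (f t)" unfolding eL Ls_def using that by (rule INF_lower)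
    then show "L k \<le> f t" using f0[of t] by (simp add: ennreal_le_iff)
    have "ennreal (f t) \<le> ennreal (U k)" unfolding eU Us_def using that by (rule SUP_upper)
    then show "f t \<le> U k" using U0[of k] by (simp add: ennreal_le_iff)
  qed
  have sumU: "summable U"
  proof (rule summableI_nonneg_bounded[OF U0])
    fix n
    let ?S = "\<integral>\<^sup>+u. upper_envelope f d u \<partial>lborel"
    have "ennreal (\<Sum>k<n. U k * d) = (\<Sum>k<n. Us k * ennreal d)"
      using U0 d(3) by (subst sum_ennreal[symmetric]) (auto simp: eU[symmetric] ennreal_mult intro!: mult_nonneg_nonneg)
    also have "\<dots> \<le> ?S" by (rule sU)
    also have "?S = ennreal (enn2real ?S)" using d(1) by (simp add: less_top)
    finally have "(\<Sum>k<n. U k * d) \<le> enn2real ?S" by (subst (asm) ennreal_le_iff) auto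
    then show "(\<Sum>k<n. U k) \<le> enn2real ?S / d" using d(3) by (simp add: le_divide_eq sum_distrib_right)
  qed
  have sumL: "summable L"
    by (rule summable_comparison_test'[OF sumU, of 0]) (use UL in auto)
  have "(\<Sum>k<n. U k - L k) \<le> \<epsilon> / d" for n
  proof -
    have "ennreal (\<Sum>k<n. (U k - L k) * d) = (\<Sum>k<n. (Us k - Ls k) * ennreal d)"
      using UL d(3)
      by (subst sum_ennreal[symmetric]) (auto simp: eU[symmetric] eL[symmetric] ennreal_mult ennreal_minus intro!: mult_nonneg_nonneg)
    also have "\<dots> \<le> ennreal \<epsilon>" using sUL[of n] d(2) by (meson less_imp_le order_trans)
    finally have "(\<Sum>k<n. (U k - L k) * d) \<le> \<epsilon>" using \<epsilon> by (subst (asm) ennreal_le_iff) auto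
    then show ?thesis using d(3) by (simp add: le_divide_eq sum_distrib_right)
  qed
  then have "suminf (\<lambda>k. U k - L k) \<le> \<epsilon> / d"
    using sumU sumL by (intro suminf_le_const summable_diff) auto
  then have "d * (suminf U - suminf L) \<le> \<epsilon>"
    using d(3) by (simp add: suminf_diff[OF sumU sumL] le_divide_eq mult.commute)
  then show ?thesis using d(3) sumU UL bounds by blast
qed

lemma grid_cover:
  assumes d: "d > (0::real)" and t: "t \<ge> 0"
  shows "\<exists>k::nat. t \<in> grid_interval d (int k)"
proof -
  define k where "k = nat \<lfloor>t / d\<rfloor>"
  have f0: "0 \<le> \<lfloor>t / d\<rfloor>" using assms by simp
  then have k: "real_of_int (int k) = real_of_int \<lfloor>t / d\<rfloor>" by (simp add: k_def)
  have "real_of_int (int k) \<le> t / d" "t / d < real_of_int (int k) + 1" unfolding k by linarith+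
  then have "real_of_int (int k) * d \<le> t" "t < (real_of_int (int k) + 1) * d"
    unfolding pos_le_divide_eq[OF d] pos_divide_less_eq[OF d] .
  then have "t \<in> grid_interval d (int k)"
    unfolding grid_interval_def atLeastLessThan_iff by blast
  then show ?thesis ..
qed

text \<open>Integrates the two bracketing step functions; integrability of \<open>f\<close> comes
  from the upper one.\<close>

lemma integral_step_bounds:
  assumes d: "d > 0" and fm: "f \<in> borel_measurable borel" and f0: "\<And>t. 0 \<le> f t" and supp: "\<And>t. t < 0 \<Longrightarrow> f t = 0"
    and sumU: "summable U" and UL: "\<And>k::nat. 0 \<le> L k" "\<And>k. L k \<le> U k"
    and bounds: "\<And>k t. t \<in> grid_interval d (int k) \<Longrightarrow> L k \<le> f t \<and> f t \<le> U k"
  shows "integrable lborel f" "d * suminf L \<le> (\<integral>t. f t \<partial>lborel)" "(\<integral>t. f t \<partial>lborel) \<le> d * suminf U"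
proof -
  have U0: "0 \<le> U k" for k using UL[of k] by linarith
  have sumL: "summable L"
    by (rule summable_comparison_test'[OF sumU, of 0]) (use UL in auto)
  have pw: "ennreal (f t) \<le> (\<Sum>k. ennreal (U k) * indicator (grid_interval d (int k)) t)" for t
  proof (cases "t < 0")
    case True then show ?thesis using supp by simp
  next
    case False
    then obtain k where k: "t \<in> grid_interval d (int k)" using grid_cover[OF d, of t] by auto
    have "ennreal (f t) \<le> ennreal (U k) * indicator (grid_interval d (int k)) t"
      using bounds[OF k] k by (simp add: ennreal_leI)
    also have "\<dots> \<le> (\<Sum>k. ennreal (U k) * indicator (grid_interval d (int k)) t)"
    proof -
      have "g k \<le> suminf g" for g :: "nat \<Rightarrow> ennreal"
        using sum_le_suminf[of g "{k}"] by simp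
      then show ?thesis .
    qed
    finally show ?thesis .
  qed
  have "(\<integral>\<^sup>+t. ennreal (f t) \<partial>lborel) \<le> (\<integral>\<^sup>+t. (\<Sum>k. ennreal (U k) * indicator (grid_interval d (int k)) t) \<partial>lborel)"
    by (intro nn_integral_mono pw)
  also have "\<dots> = (\<Sum>k. \<integral>\<^sup>+t. ennreal (U k) * indicator (grid_interval d (int k)) t \<partial>lborel)"
    by (rule nn_integral_suminf) measurable
  also have "\<dots> = (\<Sum>k. ennreal (U k * d))"
    using d U0 by (simp add: nn_integral_cmult_indicator emeasure_grid_interval ennreal_mult)
  also have "\<dots> = ennreal (\<Sum>k. U k * d)"
    using d U0 sumU by (intro suminf_ennreal2 summable_mult2) auto
  also have "(\<Sum>k. U k * d) = d * suminf U" using suminf_mult2[OF sumU, of d] by (simp add: mult.commute)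
  finally have nn: "(\<integral>\<^sup>+t. ennreal (f t) \<partial>lborel) \<le> ennreal (d * suminf U)" .
  show int: "integrable lborel f"
    using fm f0 nn by (intro integrableI_nonneg) (auto intro: le_less_trans)
  have "ennreal (\<integral>t. f t \<partial>lborel) \<le> ennreal (d * suminf U)"
    using nn int f0 by (simp add: nn_integral_eq_integral)
  moreover have "0 \<le> d * suminf U" using d U0 sumU by (intro mult_nonneg_nonneg suminf_nonneg) auto
  ultimately show "(\<integral>t. f t \<partial>lborel) \<le> d * suminf U" by (simp add: ennreal_le_iff)
  have "(\<Sum>k<n. L k) \<le> (\<integral>t. f t \<partial>lborel) / d" for n
  proof -
    have "ennreal (\<Sum>k<n. L k * d) = (\<Sum>k<n. ennreal (L k) * ennreal d)"
      using UL d by (subst sum_ennreal[symmetric]) (auto simp: ennreal_mult)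
    also have "\<dots> \<le> (\<integral>\<^sup>+t. ennreal (f t) \<partial>lborel)"
      using bounds by (intro sum_le_nn_integral_grid d) (auto intro: ennreal_leI)
    also have "\<dots> = ennreal (\<integral>t. f t \<partial>lborel)" using int f0 by (simp add: nn_integral_eq_integral)
    finally have "(\<Sum>k<n. L k * d) \<le> (\<integral>t. f t \<partial>lborel)"
      using f0 by (subst (asm) ennreal_le_iff) (auto intro: integral_nonneg_AE)
    then show ?thesis using d by (simp add: le_divide_eq sum_distrib_right)
  qed
  then have "suminf L \<le> (\<integral>t. f t \<partial>lborel) / d" using sumL by (intro suminf_le_const)
  then show "d * suminf L \<le> (\<integral>t. f t \<partial>lborel)" using d by (simp add: le_divide_eq mult.commute)
qed

section \<open>Uniformity in the starting point and the target\<close>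

lemma abs_exp_minus_one_le: "\<bar>exp (- u) - 1\<bar> \<le> exp \<bar>u\<bar> - (1::real)"
proof (cases "u \<ge> 0")
  case True
  have "2 \<le> exp u + exp (- u)"
    using exp_ge_add_one_self[of u] exp_ge_add_one_self[of "- u"] by linarith
  then show ?thesis using True by simp
qed simp

text \<open>The two values have quotient exp (- (2 * w * h + h^2) / (2 * v)) exactly, so the bound
  is relative and survives where the kernel is tiny.\<close>

lemma heat_shift_le:
  assumes v: "v > 0" and w: "\<bar>w\<bar> \<le> D" and h: "0 \<le> h" "h \<le> h0"
  shows "\<bar>heat v (w + h) - heat v w\<bar> \<le> heat v w * (exp ((2 * D * h0 + h0\<^sup>2) / (2 * v)) - 1)"
proof -
  let ?u = "(2 * w * h + h\<^sup>2) / (2 * v)"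
  have "- (w + h)\<^sup>2 / (2 * v) = - w\<^sup>2 / (2 * v) + - ?u"
    using v by (simp add: power2_eq_square field_simps)
  then have "exp (- (w + h)\<^sup>2 / (2 * v)) = exp (- w\<^sup>2 / (2 * v)) * exp (- ?u)" by (simp only: exp_add)
  then have hw: "heat v (w + h) = heat v w * exp (- ?u)" unfolding heat_def by simp
  have "\<bar>heat v (w + h) - heat v w\<bar> = heat v w * \<bar>exp (- ?u) - 1\<bar>"
  proof -
    have "heat v (w + h) - heat v w = heat v w * (exp (- ?u) - 1)" unfolding hw by (simp only: right_diff_distrib mult_1_right)
    then show ?thesis using v by (simp only: abs_mult) simp
  qed
  also have "\<dots> \<le> heat v w * (exp ((2 * D * h0 + h0\<^sup>2) / (2 * v)) - 1)"
  proof (rule mult_left_mono)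
    have "\<bar>2 * w * h + h\<^sup>2\<bar> \<le> \<bar>2 * w * h\<bar> + \<bar>h\<^sup>2\<bar>" by (rule abs_triangle_ineq)
    also have "\<dots> = 2 * (\<bar>w\<bar> * h) + h\<^sup>2" using h by (simp add: abs_mult)
    also have "\<dots> \<le> 2 * (D * h0) + h0\<^sup>2" using w h by (intro add_mono mult_left_mono mult_mono power_mono) auto
    finally have "\<bar>?u\<bar> \<le> (2 * D * h0 + h0\<^sup>2) / (2 * v)" using v by (simp add: divide_right_mono)
    then have "exp \<bar>?u\<bar> \<le> exp ((2 * D * h0 + h0\<^sup>2) / (2 * v))" by simp
    then show "\<bar>exp (- ?u) - 1\<bar> \<le> exp ((2 * D * h0 + h0\<^sup>2) / (2 * v)) - 1"
      using abs_exp_minus_one_le[of ?u] by linarith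
  qed (use v in simp)
  finally show ?thesis .
qed

lemma heat_add_le_diff:
  assumes "v > 0" "0 \<le> x" "0 \<le> y" shows "heat v (x + y) \<le> heat v (x - y)"
proof -
  have "heat v (x - y) = heat v \<bar>x - y\<bar>" by (simp add: heat_def)
  moreover have "heat v (x + y) \<le> heat v \<bar>x - y\<bar>" using assms by (intro heat_antimono) auto
  ultimately show ?thesis by simp
qed

context nonlattice_law
begin

definition window :: "real \<Rightarrow> real \<Rightarrow> nat \<Rightarrow> (real \<times> real) set" where
  "window \<eta> q n = {sqrt (real n) / \<eta>..\<eta> * sqrt (real n)} \<times> {sqrt (real n) / \<eta>..\<sigma> * sqrt (q * real n * ln (real n))}"

text \<open>This is where q is restricted. For y > x the distance is at most \<open>y\<close>, so
  the Gaussian factor is at least n powr (- q / 2), and q / 2 < rate lets it beat the error term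
  including constants. For y <= x the factor is bounded below by a constant.\<close>

lemma heat_window_lower:
  assumes \<eta>: "\<eta> > 0" and q: "0 < q" "q < 2 * rate"
  shows "\<forall>\<^sub>F n in sequentially. \<forall>(x, y)\<in>window \<eta> q n. real n powr (- 1/2 - rate) \<le> heat (\<sigma>\<^sup>2 * real n) (x - y)"
proof -
  define c where "c = 1 / (sqrt (2 * pi) * \<sigma>)"
  define c1 where "c1 = c * exp (- (\<eta>\<^sup>2 / (2 * \<sigma>\<^sup>2)))"
  have c: "c > 0" "c1 > 0" using sigma_pos by (auto simp: c_def c1_def)
  have "\<forall>\<^sub>F n in sequentially. 1 * real n powr (- 1/2 - rate) \<le> c1 * real n powr (- 1/2)"
    using rate_pos c by (intro eventually_powr_le) auto
  moreover have "\<forall>\<^sub>F n in sequentially. 1 * real n powr (- 1/2 - rate) \<le> c * real n powr (- 1/2 - q / 2)"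
    using q c by (intro eventually_powr_le) auto
  ultimately show ?thesis using eventually_gt_at_top[of 1]
  proof eventually_elim
    case (elim n)
    have n: "real n > 1" using elim by simp
    have lnn: "ln (real n) > 0" using n by simp
    show ?case
    proof (clarify)
      fix x y assume "(x, y) \<in> window \<eta> q n"
      then have xy: "sqrt (real n) / \<eta> \<le> x" "x \<le> \<eta> * sqrt (real n)" "sqrt (real n) / \<eta> \<le> y" "y \<le> \<sigma> * sqrt (q * real n * ln (real n))"
        by (auto simp: window_def)
      have "0 < sqrt (real n) / \<eta>" using n \<eta> by simp
      then have p: "x > 0" "y > 0" using xy by linarith+
      have pre: "1 / sqrt (2 * pi * (\<sigma>\<^sup>2 * real n)) = c * real n powr (- 1/2)"
        using sigma_pos n by (simp add: c_def real_sqrt_mult powr_minus_divide powr_half_sqrt)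
      have H: "heat (\<sigma>\<^sup>2 * real n) (x - y) = c * real n powr (- 1/2) * exp (- (x - y)\<^sup>2 / (2 * (\<sigma>\<^sup>2 * real n)))"
        unfolding heat_def pre[symmetric] by simp
      show "real n powr (- 1/2 - rate) \<le> heat (\<sigma>\<^sup>2 * real n) (x - y)"
      proof (cases "x \<ge> y")
        case True
        have "(x - y)\<^sup>2 \<le> (\<eta> * sqrt (real n))\<^sup>2" using True p xy by (intro power_mono) auto
        also have "\<dots> = \<eta>\<^sup>2 * real n" using n by (simp add: power_mult_distrib)
        finally have "(x - y)\<^sup>2 / (2 * (\<sigma>\<^sup>2 * real n)) \<le> \<eta>\<^sup>2 * real n / (2 * (\<sigma>\<^sup>2 * real n))"
          using n by (intro divide_right_mono) auto
        also have "\<dots> = \<eta>\<^sup>2 / (2 * \<sigma>\<^sup>2)" using n by simp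
        finally have "exp (- (\<eta>\<^sup>2 / (2 * \<sigma>\<^sup>2))) \<le> exp (- (x - y)\<^sup>2 / (2 * (\<sigma>\<^sup>2 * real n)))" by simp
        then have "c * real n powr (- 1/2) * exp (- (\<eta>\<^sup>2 / (2 * \<sigma>\<^sup>2))) \<le> heat (\<sigma>\<^sup>2 * real n) (x - y)"
          unfolding H using c by (intro mult_left_mono) auto
        then show ?thesis using elim by (simp add: c1_def ac_simps)
      next
        case False
        have "(x - y)\<^sup>2 \<le> (\<sigma> * sqrt (q * real n * ln (real n)))\<^sup>2"
          using False p xy sigma_pos q n lnn by (subst power2_commute, intro power_mono) auto
        also have "\<dots> = \<sigma>\<^sup>2 * (q * real n * ln (real n))" using n lnn q by (simp add: power_mult_distrib)
        finally have "(x - y)\<^sup>2 / (2 * (\<sigma>\<^sup>2 * real n)) \<le> \<sigma>\<^sup>2 * (q * real n * ln (real n)) / (2 * (\<sigma>\<^sup>2 * real n))"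
          using n by (intro divide_right_mono) auto
        also have "\<dots> = q / 2 * ln (real n)" using n sigma_pos by simp
        finally have "- (q / 2) * ln (real n) \<le> - (x - y)\<^sup>2 / (2 * (\<sigma>\<^sup>2 * real n))" by simp
        then have "exp (- (q / 2) * ln (real n)) \<le> exp (- (x - y)\<^sup>2 / (2 * (\<sigma>\<^sup>2 * real n)))"
          by (simp only: exp_le_cancel_iff)
        moreover have "exp (- (q / 2) * ln (real n)) = real n powr (- (q / 2))" using n by (simp add: powr_def)
        ultimately have E: "real n powr (- (q / 2)) \<le> exp (- (x - y)\<^sup>2 / (2 * (\<sigma>\<^sup>2 * real n)))" by (simp only:)
        have "c * real n powr (- 1/2) * real n powr (- (q / 2)) \<le> heat (\<sigma>\<^sup>2 * real n) (x - y)"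
          unfolding H by (rule mult_left_mono[OF E]) (use c in simp)
        moreover have "real n powr (- 1/2) * real n powr (- (q / 2)) = real n powr (- 1/2 - q / 2)"
          by (simp add: powr_add[symmetric])
        ultimately show ?thesis using elim by (simp add: mult.assoc)
      qed
    qed
  qed
qed

text \<open>If x <= y, the shift moves the target further away from x. If x > y, then x - y <=
  \<eta> * sqrt n, so the kernel at x - y is already within a constant factor of its
  maximum.\<close>

lemma heat_shift_window:
  assumes x: "0 \<le> x" "x \<le> \<eta> * sqrt (real n)" and y: "y \<ge> 0" and h: "h \<ge> 0" and n: "n > 0"
  shows "heat (\<sigma>\<^sup>2 * real n) (x - (y + h)) \<le> exp (\<eta>\<^sup>2 / (2 * \<sigma>\<^sup>2)) * heat (\<sigma>\<^sup>2 * real n) (x - y)"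
proof -
  let ?v = "\<sigma>\<^sup>2 * real n"
  have v: "?v > 0" using sigma_pos n by simp
  show ?thesis
  proof (cases "x \<le> y")
    case True
    have "heat ?v (x - (y + h)) = heat ?v (y + h - x)" using heat_uminus[of ?v "y + h - x"] by simp
    also have "\<dots> \<le> heat ?v (y - x)" using v True h by (intro heat_antimono) auto
    also have "\<dots> = heat ?v (x - y)" using heat_uminus[of ?v "x - y"] by simp
    also have "\<dots> \<le> exp (\<eta>\<^sup>2 / (2 * \<sigma>\<^sup>2)) * heat ?v (x - y)"
      using mult_right_mono[of 1 "exp (\<eta>\<^sup>2 / (2 * \<sigma>\<^sup>2))" "heat ?v (x - y)"] v by simp
    finally show ?thesis .
  next
    case False
    have "(x - y)\<^sup>2 \<le> (\<eta> * sqrt (real n))\<^sup>2" using False x y by (intro power_mono) auto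
    also have "\<dots> = \<eta>\<^sup>2 * real n" by (simp add: power_mult_distrib)
    finally have "(x - y)\<^sup>2 / (2 * ?v) \<le> \<eta>\<^sup>2 * real n / (2 * ?v)"
      using v by (intro divide_right_mono) auto
    also have "\<dots> = \<eta>\<^sup>2 / (2 * \<sigma>\<^sup>2)" using n by simp
    finally have "0 \<le> \<eta>\<^sup>2 / (2 * \<sigma>\<^sup>2) + - (x - y)\<^sup>2 / (2 * ?v)" by simp
    then have "1 \<le> exp (\<eta>\<^sup>2 / (2 * \<sigma>\<^sup>2) + - (x - y)\<^sup>2 / (2 * ?v))" by (subst one_le_exp_iff)
    then have e: "1 \<le> exp (\<eta>\<^sup>2 / (2 * \<sigma>\<^sup>2)) * exp (- (x - y)\<^sup>2 / (2 * ?v))" by (simp only: exp_add)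
    have "heat ?v (x - (y + h)) \<le> 1 / sqrt (2 * pi * ?v)"
      unfolding heat_def using v by (intro divide_right_mono) auto
    also have "\<dots> \<le> exp (\<eta>\<^sup>2 / (2 * \<sigma>\<^sup>2)) * exp (- (x - y)\<^sup>2 / (2 * ?v)) / sqrt (2 * pi * ?v)"
      using e v by (intro divide_right_mono) auto
    finally show ?thesis by (simp add: heat_def)
  qed
qed

text \<open>On the window |x - y| and |x + y| are at most \<open>D n\<close>, which is o(n); by
  \<open>heat_shift_le\<close> a bounded shift then has a vanishing relative effect on both
  kernels.\<close>

lemma kernel_shift_window:
  assumes \<eta>: "\<eta> > 0" and q: "0 < q" and h0: "h0 \<ge> 0" and \<kappa>: "\<kappa> > 0"
  shows "\<forall>\<^sub>F n in sequentially. \<forall>(x, y)\<in>window \<eta> q n. \<forall>h. 0 \<le> h \<longrightarrow> h \<le> h0 \<longrightarrow>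
    \<bar>(heat (\<sigma>\<^sup>2 * real n) (x - (y + h)) - heat (\<sigma>\<^sup>2 * real n) (x + (y + h)))
      - (heat (\<sigma>\<^sup>2 * real n) (x - y) - heat (\<sigma>\<^sup>2 * real n) (x + y))\<bar> \<le> \<kappa> * heat (\<sigma>\<^sup>2 * real n) (x - y)"
proof -
  define D where "D n = \<eta> * sqrt (real n) + \<sigma> * sqrt (q * real n * ln (real n))" for n :: nat
  define R where "R n = exp ((2 * D n * h0 + h0\<^sup>2) / (2 * (\<sigma>\<^sup>2 * real n))) - 1" for n :: nat
  have "(\<lambda>n. (h0 * \<eta> / \<sigma>\<^sup>2) * (sqrt (real n) / real n) + (h0 * sqrt q / \<sigma>) * (sqrt (real n * ln (real n)) / real n)
       + (h0\<^sup>2 / (2 * \<sigma>\<^sup>2)) * (1 / real n)) \<longlonglongrightarrow> (h0 * \<eta> / \<sigma>\<^sup>2) * 0 + (h0 * sqrt q / \<sigma>) * 0 + (h0\<^sup>2 / (2 * \<sigma>\<^sup>2)) * 0"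
    by (intro tendsto_add tendsto_mult tendsto_const; real_asymp)
  moreover have "(2 * D n * h0 + h0\<^sup>2) / (2 * (\<sigma>\<^sup>2 * real n))
     = (h0 * \<eta> / \<sigma>\<^sup>2) * (sqrt (real n) / real n) + (h0 * sqrt q / \<sigma>) * (sqrt (real n * ln (real n)) / real n)
       + (h0\<^sup>2 / (2 * \<sigma>\<^sup>2)) * (1 / real n)" for n
  proof -
    have "sqrt (q * real n * ln (real n)) = sqrt q * sqrt (real n * ln (real n))" by (simp add: real_sqrt_mult)
    then show ?thesis using sigma_pos by (simp add: D_def power2_eq_square add_divide_distrib distrib_left distrib_right ac_simps)
  qed
  ultimately have "(\<lambda>n. (2 * D n * h0 + h0\<^sup>2) / (2 * (\<sigma>\<^sup>2 * real n))) \<longlonglongrightarrow> 0" by simp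
  then have "R \<longlonglongrightarrow> exp 0 - 1" unfolding R_def by (intro tendsto_intros)
  then have "R \<longlonglongrightarrow> 0" by simp
  then have "\<forall>\<^sub>F n in sequentially. R n < \<kappa> / 2" using \<kappa> by (intro order_tendstoD(2)) auto
  then show ?thesis using eventually_gt_at_top[of 0]
  proof eventually_elim
    case (elim n)
    let ?v = "\<sigma>\<^sup>2 * real n"
    have v: "?v > 0" using elim sigma_pos by simp
    show ?case
    proof (clarify)
      fix x y h :: real assume xy': "(x, y) \<in> window \<eta> q n" and h: "0 \<le> h" "h \<le> h0"
      then have xy: "sqrt (real n) / \<eta> \<le> x" "x \<le> \<eta> * sqrt (real n)" "sqrt (real n) / \<eta> \<le> y" "y \<le> \<sigma> * sqrt (q * real n * ln (real n))"
        by (auto simp: window_def)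
      have "0 \<le> sqrt (real n) / \<eta>" using \<eta> by simp
      then have p: "x \<ge> 0" "y \<ge> 0" using xy by linarith+
      have D: "\<bar>y - x\<bar> \<le> D n" "\<bar>x + y\<bar> \<le> D n" using p xy by (auto simp: D_def)
      have R0: "R n \<ge> 0"
        using heat_shift_le[OF v D(1) order_refl h(1)[THEN order_trans, OF h(2)]] heat_pos[OF v, of "y - x"]
        by (simp add: R_def zero_le_mult_iff)
      have "\<bar>heat ?v (y - x + h) - heat ?v (y - x)\<bar> \<le> heat ?v (y - x) * R n"
        unfolding R_def by (rule heat_shift_le[OF v D(1) h])
      moreover have "heat ?v (y - x + h) = heat ?v (x - (y + h))" using heat_uminus[of ?v "y - x + h"] by (simp add: algebra_simps)
      moreover have "heat ?v (y - x) = heat ?v (x - y)" using heat_uminus[of ?v "y - x"] by simp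
      ultimately have 1: "\<bar>heat ?v (x - (y + h)) - heat ?v (x - y)\<bar> \<le> heat ?v (x - y) * R n" by simp
      have "\<bar>heat ?v (x + y + h) - heat ?v (x + y)\<bar> \<le> heat ?v (x + y) * R n"
        unfolding R_def by (rule heat_shift_le[OF v D(2) h])
      also have "\<dots> \<le> heat ?v (x - y) * R n" using R0 v p by (intro mult_right_mono heat_add_le_diff) auto
      finally have 2: "\<bar>heat ?v (x + (y + h)) - heat ?v (x + y)\<bar> \<le> heat ?v (x - y) * R n" by (simp add: add.assoc)
      have "heat ?v (x - y) * R n \<le> heat ?v (x - y) * (\<kappa> / 2)"
        using elim v by (intro mult_left_mono) auto
      then show "\<bar>heat ?v (x - (y + h)) - heat ?v (x + (y + h)) - (heat ?v (x - y) - heat ?v (x + y))\<bar> \<le> \<kappa> * heat ?v (x - y)"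
        using 1 2 by (simp add: mult.commute)
    qed
  qed
qed

text \<open>The mirror term is \<open>exp (- 2 * x * y / (\<sigma>\<^sup>2 * n))\<close> times the
  direct one, and \<open>x * y \<ge> n / \<eta>\<^sup>2\<close>. Errors relative to the heat kernel
  thereby become errors relative to the limit.\<close>

lemma kernel_ge_heat:
  assumes \<eta>: "\<eta> > 0" and n: "n > 0" and x: "sqrt (real n) / \<eta> \<le> x" and y: "sqrt (real n) / \<eta> \<le> y"
  shows "(1 - exp (- (2 / (\<eta>\<^sup>2 * \<sigma>\<^sup>2)))) * heat (\<sigma>\<^sup>2 * real n) (x - y)
    \<le> heat (\<sigma>\<^sup>2 * real n) (x - y) - heat (\<sigma>\<^sup>2 * real n) (x + y)"
proof -
  let ?v = "\<sigma>\<^sup>2 * real n"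
  have v: "?v > 0" using sigma_pos n by simp
  have s: "0 \<le> sqrt (real n) / \<eta>" using \<eta> by simp
  have "sqrt (real n) / \<eta> * (sqrt (real n) / \<eta>) \<le> x * y" using x y s by (intro mult_mono) auto
  then have xy: "real n / \<eta>\<^sup>2 \<le> x * y" by (simp add: power2_eq_square)
  have "- (a + 4 * c) / (2 * v) = - a / (2 * v) + - (2 * c / v)" if "v > 0" for a c v :: real
    using that by (simp add: field_simps)
  moreover have "(x + y)\<^sup>2 = (x - y)\<^sup>2 + 4 * (x * y)" by (simp add: power2_eq_square algebra_simps)
  ultimately have "- (x + y)\<^sup>2 / (2 * ?v) = - (x - y)\<^sup>2 / (2 * ?v) + - (2 * (x * y) / ?v)"
    using v by (simp only:)
  then have "exp (- (x + y)\<^sup>2 / (2 * ?v)) = exp (- (x - y)\<^sup>2 / (2 * ?v)) * exp (- (2 * (x * y) / ?v))"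
    by (simp only: exp_add)
  then have "heat ?v (x + y) = exp (- (2 * (x * y) / ?v)) * heat ?v (x - y)" unfolding heat_def by simp
  also have "\<dots> \<le> exp (- (2 / (\<eta>\<^sup>2 * \<sigma>\<^sup>2))) * heat ?v (x - y)"
  proof (rule mult_right_mono)
    have "2 * (real n / \<eta>\<^sup>2) / ?v \<le> 2 * (x * y) / ?v" using xy v by (intro divide_right_mono) auto
    moreover have "2 * (real n / \<eta>\<^sup>2) / ?v = 2 / (\<eta>\<^sup>2 * \<sigma>\<^sup>2)" using n by simp
    ultimately show "exp (- (2 * (x * y) / ?v)) \<le> exp (- (2 / (\<eta>\<^sup>2 * \<sigma>\<^sup>2)))" by simp
  qed (use v in simp)
  finally show ?thesis by (simp add: left_diff_distrib)
qed

text \<open>\<open>f\<close> is bracketed by step functions of fixed mesh. On the first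
  \<open>N0\<close> cells the target may be shifted back to \<open>y\<close>; on later cells the
  kernel is only bounded by \<open>Cb\<close> times the heat kernel, which the small remainder
  \<open>R0\<close> of the series of suprema compensates.\<close>

lemma killed_nonneg_limit:
  assumes f: "nonneg_directly_Riemann_integrable f" and supp0: "\<forall>t<0. f t = 0"
    and \<eta>: "\<eta> > 0" and q: "0 < q" "q < 2 * rate" and \<kappa>: "\<kappa> > 0"
  shows "f \<in> bdd_borel \<and> integrable lborel f \<and> (\<forall>\<^sub>F n in sequentially. \<forall>(x, y)\<in>window \<eta> q n.
    \<bar>(killed_step M ^^ n) (\<lambda>z. f (z - y)) x
      - (\<integral>t. f t \<partial>lborel) * (heat (\<sigma>\<^sup>2 * real n) (x - y) - heat (\<sigma>\<^sup>2 * real n) (x + y))\<bar>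
    \<le> \<kappa> * heat (\<sigma>\<^sup>2 * real n) (x - y))"
proof -
  have supp: "f t = 0" if "t < 0" for t using supp0 that by blast
  have f0: "\<And>t. 0 \<le> f t" and fm: "f \<in> borel_measurable borel" using f by (auto simp: nonneg_directly_Riemann_integrable_def)
  obtain d U L where d: "d > 0" and sumU: "summable U" and UL: "\<And>k::nat. 0 \<le> L k" "\<And>k. L k \<le> U k"
    and bounds: "\<And>k t. t \<in> grid_interval d (int k) \<Longrightarrow> L k \<le> f t \<and> f t \<le> U k"
    and gap: "d * (suminf U - suminf L) \<le> \<kappa> / 4"
    using directly_Riemann_integrable_step_bounds[OF f, of "\<kappa> / 4"] \<kappa> by auto
  note ib = integral_step_bounds[OF d fm f0 supp sumU UL bounds]
  define F where "F = (\<integral>t. f t \<partial>lborel)"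
  have U0: "0 \<le> U k" for k using UL[of k] by linarith
  have sumL: "summable L"
    by (rule summable_comparison_test'[OF sumU, of 0]) (use UL in auto)
  have partU: "(\<Sum>k<N. U k) \<le> suminf U" for N using sum_le_suminf[OF sumU, of "{..<N}"] U0 by auto
  have SU0: "suminf U \<ge> 0" using partU[of 0] by simp
  have tailU: "U k \<le> suminf U - (\<Sum>j<N. U j)" if "N \<le> k" for k N
  proof -
    have "(\<Sum>j<N. U j) + U k = (\<Sum>j\<in>insert k {..<N}. U j)" using that by simp
    also have "\<dots> \<le> suminf U" using sum_le_suminf[OF sumU, of "insert k {..<N}"] U0 by auto
    finally show ?thesis by simp
  qed
  have f_le: "f t \<le> suminf U" for t
  proof (cases "t < 0")
    case True then show ?thesis using supp SU0 by simp
  next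
    case False
    then obtain k where "t \<in> grid_interval d (int k)" using grid_cover[OF d, of t] by auto
    then have "f t \<le> U k" using bounds by blast
    also have "\<dots> \<le> suminf U" using tailU[of 0 k] by simp
    finally show ?thesis .
  qed
  have fb: "f \<in> bdd_borel" using fm f0 f_le by (intro bdd_borelI[of _ "suminf U"]) auto
  define Cb where "Cb = exp (\<eta>\<^sup>2 / (2 * \<sigma>\<^sup>2))"
  have Cb: "Cb \<ge> 1" by (simp add: Cb_def)
  have "(\<lambda>N. suminf U - (\<Sum>k<N. U k)) \<longlonglongrightarrow> suminf U - suminf U"
    by (intro tendsto_diff tendsto_const summable_LIMSEQ sumU)
  then have "\<forall>\<^sub>F N in sequentially. suminf U - (\<Sum>k<N. U k) < \<kappa> / (4 * d * Cb)"
    using \<kappa> d Cb by (intro order_tendstoD(2)) auto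
  then obtain N0 where N0: "suminf U - (\<Sum>k<N0. U k) < \<kappa> / (4 * d * Cb)"
    by (auto simp: eventually_sequentially)
  define R0 where "R0 = suminf U - (\<Sum>k<N0. U k)"
  have R0: "R0 \<ge> 0" "d * Cb * R0 \<le> \<kappa> / 4"
    using partU[of N0] N0 d Cb by (auto simp: R0_def field_simps)
  \<comment> \<open>The errors per cell get multiplied by the whole sum of suprema, hence the
    denominator; the leading 1 keeps it positive.\<close>
  define \<epsilon> where "\<epsilon> = \<kappa> / (4 * (1 + (d + Cb + 1) * suminf U))"
  have den: "1 + (d + Cb + 1) * suminf U > 0" using SU0 d Cb by (intro add_pos_nonneg mult_nonneg_nonneg) auto
  have \<epsilon>: "\<epsilon> > 0" "\<epsilon> * (d + Cb + 1) * suminf U \<le> \<kappa> / 4"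
  proof -
    show "\<epsilon> > 0" using \<kappa> den by (simp add: \<epsilon>_def)
    have "(d + Cb + 1) * suminf U / (1 + (d + Cb + 1) * suminf U) \<le> 1" using den by (simp add: divide_le_eq)
    then have "\<kappa> / 4 * ((d + Cb + 1) * suminf U / (1 + (d + Cb + 1) * suminf U)) \<le> \<kappa> / 4 * 1"
      using \<kappa> by (intro mult_left_mono) auto
    then show "\<epsilon> * (d + Cb + 1) * suminf U \<le> \<kappa> / 4" by (simp add: \<epsilon>_def)
  qed
  have h0: "0 \<le> real N0 * d" using d by simp
  have "\<forall>\<^sub>F n in sequentially. \<forall>(x, y)\<in>window \<eta> q n.
    \<bar>(killed_step M ^^ n) (\<lambda>z. f (z - y)) x
      - F * (heat (\<sigma>\<^sup>2 * real n) (x - y) - heat (\<sigma>\<^sup>2 * real n) (x + y))\<bar> \<le> \<kappa> * heat (\<sigma>\<^sup>2 * real n) (x - y)"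
    using killed_interval_limit[OF d \<eta> \<epsilon>(1)] heat_window_lower[OF \<eta> q] kernel_shift_window[OF \<eta> q(1) h0 \<epsilon>(1)]
      eventually_gt_at_top[of 0]
  proof eventually_elim
    case (elim n)
    let ?v = "\<sigma>\<^sup>2 * real n"
    have v: "?v > 0" using elim sigma_pos by simp
    show ?case
    proof (clarify)
      fix x y :: real assume win: "(x, y) \<in> window \<eta> q n"
      then have xy: "sqrt (real n) / \<eta> \<le> x" "x \<le> \<eta> * sqrt (real n)" "sqrt (real n) / \<eta> \<le> y" "y \<le> \<sigma> * sqrt (q * real n * ln (real n))"
        by (auto simp: window_def)
      have "0 \<le> sqrt (real n) / \<eta>" using \<eta> by simp
      then have p: "x \<ge> 0" "y \<ge> 0" using xy by linarith+
      define H where "H = heat ?v (x - y)"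
      define b where "b h = heat ?v (x - (y + h)) - heat ?v (x + (y + h))" for h
      have H0: "H \<ge> 0" using v by (simp add: H_def)
      have small: "real n powr (- 1/2 - rate) \<le> H" using elim(2) win by (auto simp: H_def)
      have bH: "b h \<le> Cb * H" if "h \<ge> 0" for h
      proof -
        have "0 \<le> heat ?v (x + (y + h))" using v by simp
        then show ?thesis
          using heat_shift_window[OF p(1) xy(2) p(2) that elim(4)] unfolding b_def H_def Cb_def by linarith
      qed
      have b0: "0 \<le> b 0" "b 0 \<le> H" using heat_add_le_diff[OF v p] heat_nonneg[of ?v "x + y"] v by (auto simp: b_def H_def)
      have bs: "\<bar>b h - b 0\<bar> \<le> \<epsilon> * H" if "0 \<le> h" "h \<le> real N0 * d" for h
        using elim(3) win that by (auto simp: b_def H_def)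
      \<comment> \<open>The k-th cell seen from \<open>y\<close> is the interval [0, d) seen from
        the target y + k * d, to which \<open>killed_interval_limit\<close> applies.\<close>
      define g where "g k z = (indicator {0..<d} (z - (y + real k * d)) :: real)" for k :: nat and z :: real
      have gb: "g k \<in> bdd_borel" for k
      proof -
        have "(indicator {0..<d} :: real \<Rightarrow> real) \<in> bdd_borel" by auto
        moreover have "(\<lambda>z. indicator {0..<d} (z + - (y + real k * d))) = g k"
          by (rule ext) (simp only: g_def diff_conv_add_uminus)
        ultimately show ?thesis using bdd_borel_shift[of "indicator {0..<d}" "- (y + real k * d)"] by (simp only:)
      qed
      have g_iff: "g k z = indicator (grid_interval d (int k)) (z - y)" for k z
        by (auto simp: g_def grid_interval_def indicator_def algebra_simps)
      define w where "w k = (killed_step M ^^ n) (g k) x" for k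
      have kd: "real k * d \<ge> 0" for k using d by simp
      have w: "\<bar>w k - d * b (real k * d)\<bar> \<le> \<epsilon> * (Cb + 1) * H" for k
      proof -
        have "sqrt (real n) / \<eta> \<le> y + real k * d" using xy kd[of k] by linarith
        then have "\<bar>w k - d * b (real k * d)\<bar> \<le> \<epsilon> * (heat ?v (x - (y + real k * d)) + real n powr (- 1/2 - rate))"
          using elim(1) p unfolding w_def g_def[abs_def] b_def by blast
        also have "\<dots> \<le> \<epsilon> * (Cb * H + H)"
          using heat_shift_window[OF p(1) xy(2) p(2) kd elim(4), of k] small \<epsilon>(1)
          by (intro mult_left_mono add_mono) (auto simp: Cb_def H_def)
        also have "\<dots> = \<epsilon> * (Cb + 1) * H" by (simp add: algebra_simps)
        finally show ?thesis .
      qed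
      define e where "e = \<epsilon> * (d + Cb + 1) * H"
      have e0: "e \<ge> 0" using \<epsilon> d Cb H0 by (simp add: e_def)
      have near: "\<bar>w k - d * b 0\<bar> \<le> e" if "k < N0" for k
      proof -
        have "real k * d \<le> real N0 * d" using that d by (intro mult_right_mono) auto
        then have "\<bar>b (real k * d) - b 0\<bar> \<le> \<epsilon> * H" by (rule bs[OF kd])
        then have "d * \<bar>b (real k * d) - b 0\<bar> \<le> d * (\<epsilon> * H)" using d by (intro mult_left_mono) auto
        then have "\<bar>d * b (real k * d) - d * b 0\<bar> \<le> d * (\<epsilon> * H)" using d by (simp add: abs_mult right_diff_distrib[symmetric])
        moreover have "e = d * (\<epsilon> * H) + \<epsilon> * (Cb + 1) * H" by (simp add: e_def algebra_simps)
        ultimately show ?thesis using w[of k] by linarith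
      qed
      \<comment> \<open>The nonnegative summand d * b 0 is kept only to share the form of
        \<open>near\<close>.\<close>
      have far: "w k \<le> d * b 0 + e + d * Cb * H" for k
      proof -
        have "d * b (real k * d) \<le> d * (Cb * H)" using bH[OF kd] d by (intro mult_left_mono) auto
        moreover have "\<epsilon> * (Cb + 1) * H \<le> e" using \<epsilon> d H0 Cb unfolding e_def by (intro mult_right_mono mult_left_mono) auto
        moreover have "0 \<le> d * b 0" using d b0 by simp
        ultimately show ?thesis using w[of k] by (simp add: mult.assoc)
      qed
      have eU: "e * suminf U \<le> \<kappa> / 4 * H"
      proof -
        have "e * suminf U = (\<epsilon> * (d + Cb + 1) * suminf U) * H" by (simp add: e_def)
        also have "\<dots> \<le> \<kappa> / 4 * H" by (rule mult_right_mono[OF \<epsilon>(2) H0])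
        finally show ?thesis .
      qed
      let ?f = "\<lambda>z. f (z - y)"
      have fyb: "?f \<in> bdd_borel" using bdd_borel_shift[OF fb, of "- y"] by simp
      \<comment> \<open>Three ranges of cells: k < N0 by \<open>near\<close>, N0 <= k < N by
        \<open>far\<close>, and past N only f <= ?r with surviving mass at most 1. The last bound is
        not relative to \<open>H\<close>, so N tends to infinity with n, x and y fixed.\<close>
      have up: "(killed_step M ^^ n) ?f x \<le> d * suminf U * b 0 + \<kappa> / 2 * H + (suminf U - (\<Sum>k<N. U k))" if N: "N \<ge> N0" for N
      proof -
        let ?r = "suminf U - (\<Sum>k<N. U k)"
        have r0: "?r \<ge> 0" using partU[of N] by simp
        have pt: "f (z - y) \<le> 1 * (\<Sum>k<N. U k * g k z) + ?r * 1" for z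
        proof (cases "z - y < 0")
          case True
          have "0 \<le> (\<Sum>k<N. U k * g k z)" using U0 by (intro sum_nonneg) (auto simp: g_def)
          then show ?thesis using True supp r0 by simp
        next
          case False
          then obtain k where k: "z - y \<in> grid_interval d (int k)" using grid_cover[OF d, of "z - y"] by auto
          have fk: "f (z - y) \<le> U k" using bounds[OF k] by simp
          have nn: "0 \<le> (\<Sum>k<N. U k * g k z)" using U0 by (intro sum_nonneg) (auto simp: g_def)
          show ?thesis
          proof (cases "k < N")
            case True
            have "U k * g k z \<le> (\<Sum>k<N. U k * g k z)"
              using True U0 by (intro member_le_sum) (auto simp: g_def)
            then show ?thesis using fk k r0 by (simp add: g_iff)
          next
            case False
            then show ?thesis using fk tailU[of N k] nn by simp
          qed
        qed
        have "(killed_step M ^^ n) ?f x \<le> (killed_step M ^^ n) (\<lambda>z. 1 * (\<Sum>k<N. U k * g k z) + ?r * 1) x"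
          by (intro killed_pow_mono_on fyb bdd_borel_add bdd_borel_cmult bdd_borel_sum gb bdd_borel_const pt p)
        also have "\<dots> = 1 * (killed_step M ^^ n) (\<lambda>z. \<Sum>k<N. U k * g k z) x + ?r * (killed_step M ^^ n) (\<lambda>_. 1) x"
          by (intro killed_pow_linear bdd_borel_sum bdd_borel_cmult gb bdd_borel_const)
        also have "(killed_step M ^^ n) (\<lambda>z. \<Sum>k<N. U k * g k z) x = (\<Sum>k<N. U k * w k)"
          unfolding w_def by (intro killed_pow_sum gb) auto
        also have "1 * (\<Sum>k<N. U k * w k) + ?r * (killed_step M ^^ n) (\<lambda>_. 1) x \<le> (\<Sum>k<N. U k * w k) + ?r * 1"
          using r0 p killed_pow_le_const[of "\<lambda>_. 1" 1 x n] by (simp add: mult_left_le)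
        also have "(\<Sum>k<N. U k * w k) \<le> (\<Sum>k<N. U k * (d * b 0 + e) + (if k < N0 then 0 else U k * (d * Cb * H)))"
        proof (rule sum_mono)
          fix k assume "k \<in> {..<N}"
          show "U k * w k \<le> U k * (d * b 0 + e) + (if k < N0 then 0 else U k * (d * Cb * H))"
          proof (cases "k < N0")
            case True
            have "w k \<le> d * b 0 + e" using near[OF True] by linarith
            then show ?thesis using True U0[of k] by (simp add: mult_left_mono)
          next
            case False
            have "U k * w k \<le> U k * (d * b 0 + e + d * Cb * H)" using far[of k] U0[of k] by (rule mult_left_mono)
            then show ?thesis using False by (simp add: distrib_left)
          qed
        qed
        also have "\<dots> = (\<Sum>k<N. U k) * (d * b 0 + e) + (\<Sum>k<N. if k < N0 then 0 else U k * (d * Cb * H))"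
          by (simp add: sum.distrib sum_distrib_right)
        also have "(\<Sum>k<N. if k < N0 then 0 else U k * (d * Cb * H)) = (\<Sum>k\<in>{N0..<N}. U k * (d * Cb * H))"
          by (rule sum.mono_neutral_cong_right) auto
        also have "\<dots> = (\<Sum>k\<in>{N0..<N}. U k) * (d * Cb * H)" by (simp add: sum_distrib_right)
        also have "\<dots> \<le> R0 * (d * Cb * H)"
        proof (rule mult_right_mono)
          have "(\<Sum>k<N0. U k) + (\<Sum>k\<in>{N0..<N}. U k) = (\<Sum>k<N. U k)"
            using N by (subst sum.union_disjoint[symmetric]) (auto intro: arg_cong[where f = "sum U"])
          then show "(\<Sum>k\<in>{N0..<N}. U k) \<le> R0" using partU[of N] by (simp add: R0_def)
        qed (use d Cb H0 in auto)
        also have "R0 * (d * Cb * H) = (d * Cb * R0) * H" by simp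
        also have "\<dots> \<le> \<kappa> / 4 * H" using R0(2) H0 by (rule mult_right_mono)
        also have "(\<Sum>k<N. U k) * (d * b 0 + e) \<le> suminf U * (d * b 0 + e)"
          using partU[of N] d b0 e0 by (intro mult_right_mono) auto
        finally have "(killed_step M ^^ n) ?f x \<le> suminf U * (d * b 0 + e) + \<kappa> / 4 * H + ?r" by simp
        then show ?thesis using eU by (simp add: algebra_simps)
      qed
      have "(killed_step M ^^ n) ?f x \<le> d * suminf U * b 0 + \<kappa> / 2 * H + (suminf U - suminf U)"
      proof (rule tendsto_lowerbound)
        show "(\<lambda>N. d * suminf U * b 0 + \<kappa> / 2 * H + (suminf U - (\<Sum>k<N. U k))) \<longlonglongrightarrow> d * suminf U * b 0 + \<kappa> / 2 * H + (suminf U - suminf U)"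
          by (intro tendsto_intros summable_LIMSEQ sumU)
        show "\<forall>\<^sub>F N in sequentially. (killed_step M ^^ n) ?f x \<le> d * suminf U * b 0 + \<kappa> / 2 * H + (suminf U - (\<Sum>k<N. U k))"
          using eventually_ge_at_top[of N0] by eventually_elim (rule up)
      qed simp
      moreover have dU: "d * suminf U \<le> F + \<kappa> / 4" using gap ib(2) by (simp add: F_def right_diff_distrib)
      then have "d * suminf U * b 0 \<le> (F + \<kappa> / 4) * b 0" using b0 by (intro mult_right_mono) auto
      moreover have "\<kappa> / 4 * b 0 \<le> \<kappa> / 4 * H" using b0 \<kappa> by (intro mult_left_mono) auto
      ultimately have upper: "(killed_step M ^^ n) ?f x \<le> F * b 0 + \<kappa> * H"
        using H0 \<kappa> mult_nonneg_nonneg[of \<kappa> H] unfolding distrib_right by linarith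
      \<comment> \<open>From below finitely many cells suffice, since dropping the others only
        decreases the step function; the integral lost is at most d * R0.\<close>
      have lower: "F * b 0 - \<kappa> * H \<le> (killed_step M ^^ n) ?f x"
      proof -
        have pt: "(\<Sum>k<N0. L k * g k z) \<le> f (z - y)" for z
        proof (cases "\<exists>k<N0. z - y \<in> grid_interval d (int k)")
          case True
          then obtain k where k: "k < N0" "z - y \<in> grid_interval d (int k)" by auto
          have "(\<Sum>j<N0. L j * g j z) = (\<Sum>j\<in>{k}. L j * g j z)"
          proof (intro sum.mono_neutral_right)
            have "i = k" if "z - y \<in> grid_interval d (int i)" for i
              using grid_interval_unique[OF d that k(2)] by simp
            then show "\<forall>i\<in>{..<N0} - {k}. L i * g i z = 0" by (auto simp: g_iff indicator_def)
          qed (use k in auto)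
          also have "\<dots> \<le> f (z - y)" using k bounds[OF k(2)] by (simp add: g_iff)
          finally show ?thesis .
        next
          case False
          then have "(\<Sum>k<N0. L k * g k z) = 0" by (intro sum.neutral) (auto simp: g_iff indicator_def)
          then show ?thesis using f0 by simp
        qed
        have "d * b 0 - e \<le> w k" if "k < N0" for k using near[OF that] by linarith
        then have "(\<Sum>k<N0. L k * (d * b 0 - e)) \<le> (\<Sum>k<N0. L k * w k)"
          using UL by (intro sum_mono mult_left_mono) auto
        also have "\<dots> = (killed_step M ^^ n) (\<lambda>z. \<Sum>k<N0. L k * g k z) x"
          unfolding w_def by (subst killed_pow_sum) (auto intro: gb)
        also have "\<dots> \<le> (killed_step M ^^ n) ?f x"
          by (intro killed_pow_mono_on fyb bdd_borel_sum bdd_borel_cmult gb pt p)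
        finally have 1: "(\<Sum>k<N0. L k) * (d * b 0 - e) \<le> (killed_step M ^^ n) ?f x"
          by (simp add: sum_distrib_right)
        have 2: "(\<Sum>k<N0. L k) * e \<le> \<kappa> / 4 * H"
        proof -
          have "(\<Sum>k<N0. L k) \<le> suminf U" using sum_mono[of "{..<N0}" L U] UL partU[of N0] by fastforce
          then have "(\<Sum>k<N0. L k) * e \<le> suminf U * e" using e0 by (rule mult_right_mono)
          then show ?thesis using eU by (simp add: mult.commute)
        qed
        have 3: "F - \<kappa> / 4 - d * R0 \<le> d * (\<Sum>k<N0. L k)"
        proof -
          have "(\<Sum>k<N0. U k - L k) \<le> suminf (\<lambda>k. U k - L k)"
            using UL by (intro sum_le_suminf summable_diff sumU sumL) auto
          then have "suminf L - (\<Sum>k<N0. L k) \<le> R0"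
            unfolding R0_def suminf_diff[OF sumU sumL, symmetric] sum_subtractf by simp
          then have "d * (suminf L - (\<Sum>k<N0. L k)) \<le> d * R0" using d by (intro mult_left_mono) auto
          then show ?thesis using gap ib(3) by (simp add: F_def right_diff_distrib)
        qed
        have 4: "d * R0 * b 0 \<le> \<kappa> / 4 * H"
        proof -
          have "d * R0 * b 0 \<le> d * Cb * R0 * H"
          proof (rule mult_mono)
            show "d * R0 \<le> d * Cb * R0" using mult_right_mono[of 1 Cb "d * R0"] Cb d R0 by (simp add: ac_simps)
          qed (use b0 d Cb R0 in auto)
          also have "\<dots> \<le> \<kappa> / 4 * H" using R0(2) H0 by (rule mult_right_mono)
          finally show ?thesis .
        qed
        have "(F - \<kappa> / 4 - d * R0) * b 0 \<le> d * (\<Sum>k<N0. L k) * b 0" using 3 b0 by (intro mult_right_mono) auto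
        then have "F * b 0 - \<kappa> / 4 * b 0 - d * R0 * b 0 \<le> d * (\<Sum>k<N0. L k) * b 0" by (simp add: left_diff_distrib)
        moreover have "\<kappa> / 4 * b 0 \<le> \<kappa> / 4 * H" using b0 \<kappa> by (intro mult_left_mono) auto
        moreover have "(\<Sum>k<N0. L k) * (d * b 0 - e) = d * (\<Sum>k<N0. L k) * b 0 - (\<Sum>k<N0. L k) * e" by (simp add: algebra_simps)
        moreover have "0 \<le> \<kappa> * H" using \<kappa> H0 by simp
        ultimately show ?thesis using 1 2 4 by linarith
      qed
      show "\<bar>(killed_step M ^^ n) ?f x - F * (heat ?v (x - y) - heat ?v (x + y))\<bar> \<le> \<kappa> * heat ?v (x - y)"
        using upper lower by (simp add: b_def H_def abs_le_iff)
    qed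
  qed
  then show ?thesis using fb ib(1) by (simp add: F_def)
qed

end

section \<open>From killed operators to the exit time\<close>

lemma psi_eq_heat:
  assumes s: "\<sigma> > 0" and n: "n > 0"
  shows "1 / (\<sigma> * sqrt (real n)) * psi (y / (\<sigma> * sqrt (real n))) (x / (\<sigma> * sqrt (real n)))
    = heat (\<sigma>\<^sup>2 * real n) (x - y) - heat (\<sigma>\<^sup>2 * real n) (x + y)"
proof -
  let ?s = "\<sigma> * sqrt (real n)"
  have s2: "?s\<^sup>2 = \<sigma>\<^sup>2 * real n" by (simp add: power_mult_distrib)
  have 1: "- (y / ?s - x / ?s)\<^sup>2 / 2 = - (x - y)\<^sup>2 / (2 * (\<sigma>\<^sup>2 * real n))"
    unfolding diff_divide_distrib[symmetric] power_divide s2 power2_commute[of y x] by simp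
  have 2: "- (y / ?s + x / ?s)\<^sup>2 / 2 = - (x + y)\<^sup>2 / (2 * (\<sigma>\<^sup>2 * real n))"
    unfolding add_divide_distrib[symmetric] power_divide s2 add.commute[of y x] by simp
  have 3: "sqrt (2 * pi * (\<sigma>\<^sup>2 * real n)) = sqrt (2 * pi) * ?s"
    using s by (simp add: real_sqrt_mult)
  show ?thesis unfolding psi_def heat_def 1 2 3 by (simp add: diff_divide_distrib right_diff_distrib ac_simps)
qed

text \<open>The exponent is capped at 3 to meet \<open>alpha_le\<close>; the lower moment is bounded
  by 1 plus the given one.\<close>

lemma (in prob_space) nonlattice_law_distr:
  fixes Y :: "'a \<Rightarrow> real"
  assumes rv: "random_variable borel Y"
    and mean: "integrable M Y" "expectation Y = 0"
    and variance: "\<sigma> > 0" "integrable M (\<lambda>\<omega>. (Y \<omega>)\<^sup>2)" "expectation (\<lambda>\<omega>. (Y \<omega>)\<^sup>2) = \<sigma>\<^sup>2"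
    and nonlattice: "nonlattice M Y"
    and moment: "\<delta> > 0" "integrable M (\<lambda>\<omega>. \<bar>Y \<omega>\<bar> powr (2 + \<delta>))"
  shows "nonlattice_law (distr M borel Y) \<sigma> (min \<delta> 1)"
proof -
  let ?\<alpha> = "min \<delta> 1"
  have [measurable]: "Y \<in> borel_measurable M" by fact
  have "integrable M (\<lambda>\<omega>. \<bar>Y \<omega>\<bar> powr (2 + ?\<alpha>))"
  proof (rule Bochner_Integration.integrable_bound)
    show "integrable M (\<lambda>\<omega>. 1 + \<bar>Y \<omega>\<bar> powr (2 + \<delta>))" using moment by simp
    have "\<bar>t\<bar> powr (2 + ?\<alpha>) \<le> 1 + \<bar>t\<bar> powr (2 + \<delta>)" for t :: real
    proof (cases "\<bar>t\<bar> \<le> 1")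
      case True
      then have "\<bar>t\<bar> powr (2 + ?\<alpha>) \<le> 1" using moment by (intro powr_le1) auto
      then show ?thesis using powr_ge_zero[of "\<bar>t\<bar>" "2 + \<delta>"] by linarith
    next
      case False
      then have "\<bar>t\<bar> powr (2 + ?\<alpha>) \<le> \<bar>t\<bar> powr (2 + \<delta>)" by (intro powr_mono) auto
      then show ?thesis by simp
    qed
    then show "AE \<omega> in M. norm (\<bar>Y \<omega>\<bar> powr (2 + ?\<alpha>)) \<le> norm (1 + \<bar>Y \<omega>\<bar> powr (2 + \<delta>))"
      by (intro AE_I2) simp
  qed measurable
  moreover interpret D: real_distribution "distr M borel Y" by (rule real_distribution_distr) fact
  have "D.prob {x. \<exists>k::int. x = h * of_int k + a} \<noteq> 1" if "h > 0" "a \<in> {0..<h}" for h a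
  proof -
    have "D.prob {x. \<exists>k::int. x = h * of_int k + a} = prob (Y -` {x. \<exists>k::int. x = h * of_int k + a} \<inter> space M)"
      by (rule measure_distr) measurable
    also have "Y -` {x. \<exists>k::int. x = h * of_int k + a} \<inter> space M = {\<omega> \<in> space M. \<exists>k::int. Y \<omega> = h * of_int k + a}"
      by auto
    finally show ?thesis using nonlattice that by (simp add: nonlattice_def)
  qed
  ultimately show ?thesis
    using mean variance moment
    by unfold_locales (simp_all add: integrable_distr_eq integral_distr)
qed

theorem theorem1p5:
  fixes M :: "'a measure" and X :: "nat \<Rightarrow> 'a \<Rightarrow> real"
    and \<sigma> \<delta> \<eta> :: real and f :: "real \<Rightarrow> real"
  assumes "prob_space M"
    and indep: "prob_space.indep_vars M (\<lambda>_. borel) X {1..}"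
    and ident: "\<forall>i\<ge>1. distr M borel (X i) = distr M borel (X 1)"
    and mean: "integrable M (X 1)" "(LINT \<omega>|M. X 1 \<omega>) = 0"
    and variance: "\<sigma> > 0" "integrable M (\<lambda>\<omega>. (X 1 \<omega>)\<^sup>2)" "(LINT \<omega>|M. (X 1 \<omega>)\<^sup>2) = \<sigma>\<^sup>2"
    and nonlattice: "nonlattice M (X 1)"
    and moment: "\<delta> > 0" "integrable M (\<lambda>\<omega>. \<bar>X 1 \<omega>\<bar> powr (2 + \<delta>))"
    and eta: "\<eta> \<ge> 1"
    and f_dRi: "directly_Riemann_integrable f"
    and f_support: "{t. f t \<noteq> 0} \<subseteq> {0..}"
    and f_weight: "set_integrable lborel {0..} (\<lambda>t. f t * (1 + t))"
    and f_integral: "(LINT t:{0..}|lborel. f t) \<noteq> 0"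
  shows "\<exists>q0>0. \<forall>q\<in>{0<..<q0}.
    uniformly_equivalent
      (\<lambda>n. {sqrt (real n) / \<eta>..\<eta> * sqrt (real n)} \<times>
           {sqrt (real n) / \<eta>..\<sigma> * sqrt (q * real n * ln (real n))})
      (\<lambda>n (x, y). LINT \<omega>:{\<omega> \<in> space M. exit_time X x \<omega> > enat n}|M. f (x + walk X n \<omega> - y))
      (\<lambda>n (x, y). 1 / (\<sigma> * sqrt (real n)) *
           psi (y / (\<sigma> * sqrt (real n))) (x / (\<sigma> * sqrt (real n))) *
           (LINT t:{0..}|lborel. f t))"
proof -
  interpret prob_space M by fact
  define \<mu> where "\<mu> = distr M borel (X 1)"
  have "random_variable borel (X 1)" using indep by (auto simp: indep_vars_def)
  then interpret L: nonlattice_law \<mu> \<sigma> "min \<delta> 1"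
    unfolding \<mu>_def by (intro nonlattice_law_distr mean variance nonlattice moment)
  have law: "distr M borel (X i) = \<mu>" if "i \<ge> 1" for i
    using ident that unfolding \<mu>_def by blast
  have \<eta>: "\<eta> > 0" using eta by simp
  \<comment> \<open>Split into parts because the bracketing by step functions is set up for
    nonnegative functions.\<close>
  define fp fn where "fp t = max (f t) 0" and "fn t = max (- f t) 0" for t
  have f_eq: "f t = 1 * fp t + (-1) * fn t" for t by (auto simp: fp_def fn_def)
  have f_neg: "f t = 0" if "t < 0" for t using f_support that by fastforce
  then have supp: "\<forall>t<0. fp t = 0" "\<forall>t<0. fn t = 0" by (simp_all add: fp_def fn_def)
  have dRi: "nonneg_directly_Riemann_integrable fp" "nonneg_directly_Riemann_integrable fn"
    using f_dRi by (auto simp: directly_Riemann_integrable_def fp_def[abs_def] fn_def[abs_def])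
  define F where "F = (LINT t:{0..}|lborel. f t)"
  \<comment> \<open>The fraction of the heat kernel that survives reflection, from
    \<open>kernel_ge_heat\<close>.\<close>
  define c where "c = 1 - exp (- (2 / (\<eta>\<^sup>2 * \<sigma>\<^sup>2)))"
  have c: "c > 0" using \<eta> variance by (simp add: c_def)
  have "uniformly_equivalent (L.window \<eta> q)
      (\<lambda>n (x, y). LINT \<omega>:{\<omega> \<in> space M. exit_time X x \<omega> > enat n}|M. f (x + walk X n \<omega> - y))
      (\<lambda>n (x, y). 1 / (\<sigma> * sqrt (real n)) *
           psi (y / (\<sigma> * sqrt (real n))) (x / (\<sigma> * sqrt (real n))) * F)"
    if q: "0 < q" "q < 2 * L.rate" for q
    unfolding uniformly_equivalent_def
  proof (rule order_tendstoI)
    fix a :: ennreal assume "0 < a"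
    \<comment> \<open>A finite number strictly below \<open>a\<close> is needed: pointwise bounds
      yield only a non-strict bound on the supremum, and \<open>a\<close> itself may be
      infinite.\<close>
    then obtain e' where e': "0 < e'" "e' < a" using dense by blast
    have "e' < \<top>" using e'(2) top_greatest by (rule less_le_trans)
    define e where "e = enn2real e'"
    have e: "e > 0" "ennreal e < a" using e' \<open>e' < \<top>\<close> by (auto simp: e_def enn2real_positive_iff)
    \<comment> \<open>Both parts together err by 2 * \<kappa> * H = e * |F| * c * H, and c * H <= B.
      Positivity uses that the integral of \<open>f\<close> is not 0.\<close>
    define \<kappa> where "\<kappa> = e * c * \<bar>F\<bar> / 2"
    have \<kappa>: "\<kappa> > 0" using e c f_integral by (simp add: \<kappa>_def F_def)
    note P = L.killed_nonneg_limit[OF dRi(1) supp(1) \<eta> q \<kappa>]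
    note N = L.killed_nonneg_limit[OF dRi(2) supp(2) \<eta> q \<kappa>]
    have F_eq: "F = (\<integral>t. fp t \<partial>lborel) - (\<integral>t. fn t \<partial>lborel)"
    proof -
      have "F = (\<integral>t. fp t - fn t \<partial>lborel)"
        unfolding F_def set_lebesgue_integral_def
        using f_neg f_eq by (intro Bochner_Integration.integral_cong) (auto simp: indicator_def)
      then show ?thesis using P N by simp
    qed
    have "\<forall>\<^sub>F n in sequentially. (SUP \<theta>\<in>L.window \<eta> q n. ennreal
        \<bar>(case \<theta> of (x, y) \<Rightarrow> LINT \<omega>:{\<omega> \<in> space M. exit_time X x \<omega> > enat n}|M. f (x + walk X n \<omega> - y)) /
         (case \<theta> of (x, y) \<Rightarrow> 1 / (\<sigma> * sqrt (real n)) *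
           psi (y / (\<sigma> * sqrt (real n))) (x / (\<sigma> * sqrt (real n))) * F) - 1\<bar>) \<le> ennreal e"
      using P[THEN conjunct2, THEN conjunct2] N[THEN conjunct2, THEN conjunct2] eventually_gt_at_top[of 0]
    proof eventually_elim
      case (elim n)
      show ?case
      proof (rule SUP_least, clarify)
        fix x y assume win: "(x, y) \<in> L.window \<eta> q n"
        then have xy: "sqrt (real n) / \<eta> \<le> x" "sqrt (real n) / \<eta> \<le> y" by (auto simp: L.window_def)
        let ?v = "\<sigma>\<^sup>2 * real n"
        define H where "H = heat ?v (x - y)"
        define B where "B = heat ?v (x - y) - heat ?v (x + y)"
        have H: "H > 0" using variance elim by (simp add: H_def heat_pos)
        have BH: "c * H \<le> B" unfolding c_def H_def B_def by (rule L.kernel_ge_heat[OF \<eta> elim(3) xy])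
        then have B: "B > 0" using mult_pos_pos[OF c H] by linarith
        have fyb: "(\<lambda>z. fp (z - y)) \<in> bdd_borel" "(\<lambda>z. fn (z - y)) \<in> bdd_borel"
          using bdd_borel_shift[of fp "- y"] bdd_borel_shift[of fn "- y"] P N by auto
        have fy: "(\<lambda>z. f (z - y)) = (\<lambda>z. 1 * fp (z - y) + (-1) * fn (z - y))" using f_eq by (intro ext)
        have fb: "(\<lambda>z. f (z - y)) \<in> bdd_borel"
          unfolding fy by (intro bdd_borel_add bdd_borel_cmult fyb)
        define K where "K = (killed_step \<mu> ^^ n) (\<lambda>z. f (z - y)) x"
        have "(LINT \<omega>:{\<omega> \<in> space M. exit_time X x \<omega> > enat n}|M. f (x + walk X n \<omega> - y))
            = (\<integral>\<omega>. (if \<forall>k\<in>{1..n}. 0 \<le> x + walk X k \<omega> then f (x + walk X n \<omega> - y) else 0) \<partial>M)"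
          unfolding set_lebesgue_integral_def
          by (intro Bochner_Integration.integral_cong) (auto simp: less_exit_time_iff indicator_def)
        also have "\<dots> = K"
          unfolding K_def by (rule killed_expectation[OF indep law fb])
        finally have K: "(LINT \<omega>:{\<omega> \<in> space M. exit_time X x \<omega> > enat n}|M. f (x + walk X n \<omega> - y)) = K" .
        have "K = 1 * (killed_step \<mu> ^^ n) (\<lambda>z. fp (z - y)) x + (-1) * (killed_step \<mu> ^^ n) (\<lambda>z. fn (z - y)) x"
          unfolding K_def fy by (rule L.killed_pow_linear[OF fyb])
        moreover have "\<bar>(killed_step \<mu> ^^ n) (\<lambda>z. fp (z - y)) x - (\<integral>t. fp t \<partial>lborel) * B\<bar> \<le> \<kappa> * H"
          "\<bar>(killed_step \<mu> ^^ n) (\<lambda>z. fn (z - y)) x - (\<integral>t. fn t \<partial>lborel) * B\<bar> \<le> \<kappa> * H"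
          using elim win by (auto simp: B_def H_def)
        moreover have "F * B = (\<integral>t. fp t \<partial>lborel) * B - (\<integral>t. fn t \<partial>lborel) * B"
          by (simp add: F_eq left_diff_distrib)
        ultimately have "\<bar>K - F * B\<bar> \<le> 2 * (\<kappa> * H)" by linarith
        also have "\<dots> = e * \<bar>F\<bar> * (c * H)" by (simp add: \<kappa>_def)
        also have "\<dots> \<le> e * \<bar>F\<bar> * B" using BH e by (intro mult_left_mono) auto
        finally have "\<bar>K - F * B\<bar> \<le> e * \<bar>F * B\<bar>" using B by (simp add: abs_mult)
        moreover have FB: "F * B \<noteq> 0" using B f_integral by (simp add: F_def)
        ultimately have "\<bar>K - F * B\<bar> / \<bar>F * B\<bar> \<le> e" by (simp add: divide_le_eq)
        moreover have "K / (B * F) - 1 = (K - F * B) / (F * B)" using FB by (simp add: field_simps)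
        ultimately have "\<bar>K / (B * F) - 1\<bar> \<le> e" by (simp only: abs_divide)
        then show "ennreal \<bar>(LINT \<omega>:{\<omega> \<in> space M. exit_time X x \<omega> > enat n}|M. f (x + walk X n \<omega> - y)) /
            (1 / (\<sigma> * sqrt (real n)) * psi (y / (\<sigma> * sqrt (real n))) (x / (\<sigma> * sqrt (real n))) * F) - 1\<bar> \<le> ennreal e"
          unfolding K psi_eq_heat[OF variance(1) elim(3)] B_def[symmetric] by (rule ennreal_leI)
      qed
    qed
    then show "\<forall>\<^sub>F n in sequentially. (SUP \<theta>\<in>L.window \<eta> q n. ennreal
        \<bar>(case \<theta> of (x, y) \<Rightarrow> LINT \<omega>:{\<omega> \<in> space M. exit_time X x \<omega> > enat n}|M. f (x + walk X n \<omega> - y)) /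
         (case \<theta> of (x, y) \<Rightarrow> 1 / (\<sigma> * sqrt (real n)) *
           psi (y / (\<sigma> * sqrt (real n))) (x / (\<sigma> * sqrt (real n))) * F) - 1\<bar>) < a"
      by eventually_elim (use e in \<open>auto intro: le_less_trans\<close>)
  qed simp
  \<comment> \<open>The witness 2 * rate equals \<alpha> / (20 * (2 + \<alpha>)) with \<alpha> = min
    \<delta> 1, so it depends on \<delta> alone.\<close>
  then show ?thesis
    using L.rate_pos unfolding L.window_def[abs_def] F_def by (intro exI[of _ "2 * L.rate"]) auto
qed

end
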